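(* Let $\rho\in\mathbb{R}$ be irrational. The pointwise Hölder exponent $\alpha(\rho)$ at $\rho$ of the function $\phi:\mathbb{R}\to\mathbb{C}$, $\phi(x)=\sum_{n=1}^{\infty}\frac{1}{2\pi \mathrm{i} n^{2}}\mathrm{e}^{2\pi \mathrm{i} n^{2}x}$, is given by $$\alpha(\rho)=\frac{1}{2}+\frac{1}{2\tau(\rho)}.$$ The same result also holds for the Hölder exponent at $\rho$ of $\operatorname{Re}\phi$ and of $\operatorname{Im}\phi$ (that is, both of these are also equal to $\frac12+\frac{1}{2\tau(\rho)}$).
   Context: Hölder exponent: for a function $F$ on $\mathbb{R}$ and $x\in\mathbb{R}$, the pointwise Hölder exponent of $F$ at $x$ is the supremum of all $\alpha>0$ for which there is a polynomial $P_x$ such that $F(x+h)=P_x(h)+O_x(|h|^{\alpha})$ as $h\to0$, $h\in\mathbb{R}$. Definition of $\tau(\rho)$: let $r_n=p_n/q_n$, with $(p_n,q_n)=1$ and $q_n\ge 1$, be the $n$-th convergent in the continued fraction expansion of the irrational number $\rho$. For all $n$ with $q_n\ge2$ (all but finitely many $n$), define the real number $\tau_n$ by $|\rho-r_n|=(1/q_n)^{\tau_n}$. Let $(r_{n_k})_k$ be the (infinite) subsequence of those convergents with $q_{n_k}\not\equiv 2 \pmod 4$, and set $\tau(\rho)=\limsup_{k\to\infty}\tau_{n_k}\in[2,\infty]$, with the convention $1/\tau(\rho)=0$ if $\tau(\rho)=\infty$. *)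

theory Defs
  imports
    "HOL-Analysis.Analysis"
    "HOL-Library.Landau_Symbols"
    "HOL-Library.Infinite_Set"
    "HOL-Computational_Algebra.Polynomial"
begin

text \<open>
  For \<^typ>\<open>complex\<close>-valued \<open>F\<close> the polynomial may have complex coefficients, for
  \<^typ>\<open>real\<close>-valued \<open>F\<close> it has real ones. The supremum is taken in the extended reals.
\<close>

definition holder_exponent :: "(real \<Rightarrow> 'a::real_normed_field) \<Rightarrow> real \<Rightarrow> ereal" where
  "holder_exponent F x =
     Sup {ereal \<alpha> | \<alpha>. \<alpha> > 0 \<and>
       (\<exists>P :: 'a poly. (\<lambda>h. F (x + h) - poly P (of_real h)) \<in> O[at 0](\<lambda>h. of_real (\<bar>h\<bar> powr \<alpha>)))}"

definition phi :: "real \<Rightarrow> complex" where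
  "phi x = (\<Sum>n. 1 / (2 * of_real pi * \<i> * of_nat (Suc n) ^ 2) *
                  exp (2 * of_real pi * \<i> * of_nat (Suc n) ^ 2 * of_real x))"

text \<open>Complete quotients, partial quotients and convergents of the regular continued fraction.\<close>

primrec cf_quot :: "real \<Rightarrow> nat \<Rightarrow> real" where
  "cf_quot x 0 = x"
| "cf_quot x (Suc n) = 1 / frac (cf_quot x n)"

definition cf_coeff :: "real \<Rightarrow> nat \<Rightarrow> int" where
  "cf_coeff x n = \<lfloor>cf_quot x n\<rfloor>"

fun cf_num :: "real \<Rightarrow> nat \<Rightarrow> int" where
  "cf_num x 0 = cf_coeff x 0"
| "cf_num x (Suc 0) = cf_coeff x 1 * cf_coeff x 0 + 1"
| "cf_num x (Suc (Suc n)) = cf_coeff x (Suc (Suc n)) * cf_num x (Suc n) + cf_num x n"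

fun cf_den :: "real \<Rightarrow> nat \<Rightarrow> int" where
  "cf_den x 0 = 1"
| "cf_den x (Suc 0) = cf_coeff x 1"
| "cf_den x (Suc (Suc n)) = cf_coeff x (Suc (Suc n)) * cf_den x (Suc n) + cf_den x n"

definition cf_conv :: "real \<Rightarrow> nat \<Rightarrow> real" where
  "cf_conv x n = of_int (cf_num x n) / of_int (cf_den x n)"

text \<open>
  Only meaningful when \<^term>\<open>cf_den x n \<ge> 2\<close>; see \<open>cf_tau_characterization\<close> below.
\<close>

definition cf_tau :: "real \<Rightarrow> nat \<Rightarrow> real" where
  "cf_tau x n = log (1 / of_int (cf_den x n)) \<bar>x - cf_conv x n\<bar>"

definition tau_indices :: "real \<Rightarrow> nat set" where
  "tau_indices x = {n. cf_den x n \<ge> 2 \<and> cf_den x n mod 4 \<noteq> 2}"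

text \<open>
  The subsequence is enumerated in increasing order; the index set is infinite for
  irrational \<open>x\<close> (\<open>infinite_tau_indices\<close> below).
\<close>

definition tau :: "real \<Rightarrow> ereal" where
  "tau x = limsup (\<lambda>k. ereal (cf_tau x (enumerate (tau_indices x) k)))"


lemma cf_quot_irrational: "x \<notin> \<rat> \<Longrightarrow> cf_quot x n \<notin> \<rat>"
proof (induction n)
  case (Suc n)
  show ?case
  proof
    assume "cf_quot x (Suc n) \<in> \<rat>"
    then have "1 / cf_quot x (Suc n) \<in> \<rat>" by (intro Rats_divide) auto
    then have "frac (cf_quot x n) \<in> \<rat>" by simp
    then have "frac (cf_quot x n) + of_int \<lfloor>cf_quot x n\<rfloor> \<in> \<rat>" by (intro Rats_add) auto
    then show False using Suc by (simp add: frac_def)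
  qed
qed auto

lemma cf_coeff_pos:
  assumes "x \<notin> \<rat>"
  shows "cf_coeff x (Suc n) \<ge> 1"
proof -
  have "cf_quot x n \<notin> \<int>" using cf_quot_irrational[OF assms] Ints_subset_Rats by blast
  then have "frac (cf_quot x n) > 0" by (simp add: frac_gt_0_iff)
  moreover have "frac (cf_quot x n) < 1" by (rule frac_lt_1)
  ultimately have "cf_quot x (Suc n) \<ge> 1" by simp
  then show ?thesis unfolding cf_coeff_def by simp
qed

lemma cf_den_pos: "x \<notin> \<rat> \<Longrightarrow> cf_den x n \<ge> 1"
proof (induction x n rule: cf_den.induct)
  case (3 x n)
  have "cf_coeff x (Suc (Suc n)) * cf_den x (Suc n) \<ge> 0"
    using 3 cf_coeff_pos[of x "Suc n"] by (intro mult_nonneg_nonneg) auto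
  then show ?case using 3 by simp
qed (use cf_coeff_pos[of _ 0] in auto)

lemma cf_den_ge: "x \<notin> \<rat> \<Longrightarrow> cf_den x n \<ge> int n"
proof (induction x n rule: cf_den.induct)
  case (3 x n)
  have "cf_coeff x (Suc (Suc n)) * cf_den x (Suc n) \<ge> 1 * cf_den x (Suc n)"
    using 3 cf_coeff_pos[of x "Suc n"] cf_den_pos[of x "Suc n"] by (intro mult_right_mono) auto
  moreover have "cf_den x (Suc n) \<ge> int (Suc n)" using 3 by blast
  ultimately show ?case using cf_den_pos[OF 3(3), of n] unfolding cf_den.simps by linarith
qed (use cf_coeff_pos[of _ 0] in auto)

lemma cf_determinant:
  "cf_num x (Suc n) * cf_den x n - cf_num x n * cf_den x (Suc n) = (-1) ^ n"
proof (induction n)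
  case (Suc n)
  then show ?case by (simp add: algebra_simps)
qed simp

lemma cf_coprime: "coprime (cf_num x n) (cf_den x n)"
proof (rule coprimeI)
  fix d assume "d dvd cf_num x n" "d dvd cf_den x n"
  then have "d dvd cf_num x (Suc n) * cf_den x n - cf_num x n * cf_den x (Suc n)" by auto
  then have "d dvd (-1) ^ n" by (simp only: cf_determinant)
  then show "is_unit d" using dvd_trans[of d "(-1) ^ n" 1] by (cases "even n") auto
qed

lemma cf_den_not_both_even: "odd (cf_den x n) \<or> odd (cf_den x (Suc n))"
proof (rule ccontr)
  assume "\<not> ?thesis"
  then have "even (cf_num x (Suc n) * cf_den x n - cf_num x n * cf_den x (Suc n))" by auto
  then show False by (simp add: cf_determinant)
qed

lemma infinite_tau_indices:
  assumes "x \<notin> \<rat>"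
  shows "infinite (tau_indices x)"
  unfolding infinite_nat_iff_unbounded_le
proof
  fix m :: nat
  have *: "n \<in> tau_indices x" if "odd (cf_den x n)" "n \<ge> 2" for n
  proof -
    have "cf_den x n mod 4 \<noteq> 2"
      using that(1) by presburger
    then show ?thesis using that(2) cf_den_ge[OF assms, of n] by (auto simp: tau_indices_def)
  qed
  show "\<exists>n\<ge>m. n \<in> tau_indices x"
    using cf_den_not_both_even[of x "m + 2"] *[of "m + 2"] *[of "Suc (m + 2)"]
    by (metis le_add1 le_add2 le_SucI)
qed

lemma cf_tau_characterization:
  assumes "x \<notin> \<rat>" "cf_den x n \<ge> 2"
  shows "\<bar>x - cf_conv x n\<bar> = (1 / of_int (cf_den x n)) powr t \<longleftrightarrow> t = cf_tau x n"
proof -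
  have "cf_conv x n \<in> \<rat>" by (simp add: cf_conv_def)
  then have pos: "\<bar>x - cf_conv x n\<bar> > 0" using assms(1) by auto
  have b: "0 < 1 / real_of_int (cf_den x n)" "1 / real_of_int (cf_den x n) \<noteq> 1"
    using assms(2) by auto
  show ?thesis
    using b pos unfolding cf_tau_def by (metis log_powr_cancel powr_log_cancel)
qed

end

theory Submission
  imports Defs "HOL-Complex_Analysis.Complex_Analysis"
begin

text \<open>
  The exponent at \<open>\<rho>\<close> can be read off from the convergents of \<open>\<rho>\<close>, because near a reduced
  fraction \<open>p/q\<close> the function is known explicitly, with an error that is uniform in \<open>p/q\<close>:
  \<open>phi (p/q + h) - phi (p/q) = (\<i> G / (2 q)) sqrt (- 2 \<i> h) - h / 2 + O((q \<bar>h\<bar>)^(3/2))\<close>.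
  Here \<open>G\<close> is the quadratic Gauss sum with entries \<open>exp (2 \<pi> \<i> p a^2 / q)\<close>. So \<open>p/q\<close>
  carries a square-root cusp of height \<open>q^(-1/2)\<close>, unless \<open>q\<close> is congruent to 2 modulo 4: then
  \<open>G = 0\<close> and there is no cusp. This is why only the convergents with
  \<open>q mod 4 \<noteq> 2\<close> enter \<open>\<tau>(\<rho>)\<close>.

  Let \<open>r = p/q\<close> be a convergent and \<open>d = \<bar>\<rho> - r\<bar> = q^(-\<tau>)\<close>, so that \<open>d \<le> 1/q^2\<close>. For
  \<open>\<bar>h\<bar>\<close> a small multiple of \<open>d\<close> the cusp dominates the error. Hence \<open>phi\<close> varies by about
  \<open>(d / q)^(1/2) = d^(1/2 + 1/(2 \<tau>))\<close> within distance \<open>2 d\<close> of \<open>\<rho>\<close>, which bounds the exponent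
  from above. The coefficients of the cusp on the two sides of \<open>r\<close> differ by the factor \<open>\<i>\<close>, so
  for the real and for the imaginary part the cusp is visible on at least one side.
  Conversely, an increment of size \<open>\<bar>h\<bar>\<close> at \<open>\<rho>\<close> is estimated by expanding at the convergent
  whose distance from \<open>\<rho>\<close> first drops below \<open>\<bar>h\<bar>\<close>, or at the one before it: for one of the
  two, up to constants, the error is at most \<open>\<bar>h\<bar>^(3/4)\<close> and the cusp contributes at most
  \<open>\<bar>h\<bar>^(1/2 + 1/(2 \<tau>))\<close>. These two halves are \<open>holder_bound_at_convergents\<close> and
  \<open>phi_holder_bound\<close>.

  The expansion, \<open>phi_expansion_rational\<close>, comes from the theta series: in the upper half-plane
  the derivative of \<open>phi\<close> at \<open>p/q + w\<close> is a sum of \<open>exp (2 \<pi> \<i> n^2 w)\<close> with coefficients of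
  period \<open>q\<close>. Sorting \<open>n\<close> by its residue and inverting each of the \<open>q\<close> theta series turns it
  into \<open>(- 2 \<i> w)^(-1/2) / q\<close> times a sum of Gauss sums
  against \<open>exp (- 2 \<pi> \<i> k^2 / (4 q^2 w))\<close> (\<open>theta_transformation\<close>). The term \<open>k = 0\<close>
  integrates to the cusp. The others oscillate rapidly, and one integration by parts shows that
  they contribute the error term, since each Gauss sum is \<open>O(q^(1/2))\<close>.

  The inversion of the theta series needs no Gaussian integral. Both sides of Jacobi's identity are
  entire functions of period 1, and \<open>sum exp (- \<pi> s (z + m)^2)\<close> reproduces itself up to an
  exponential factor under \<open>z \<mapsto> z - \<i> / s\<close>. Moving the line of integration by this shift gives a
  recursion for its Fourier coefficients, which determines them up to a factor independent of
  \<open>k\<close>. That factor is found for squares of rationals by summing the identity over the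
  points \<open>a/q\<close>, and analytic continuation does the rest.
\<close>

section \<open>Theta series and their quasi-periods\<close>

definition e2pi :: "complex \<Rightarrow> complex" where
  "e2pi z = exp (2 * of_real pi * \<i> * z)"

lemma e2pi_add: "e2pi (a + b) = e2pi a * e2pi b"
  by (simp add: e2pi_def ring_distribs exp_add)

lemma e2pi_0 [simp]: "e2pi 0 = 1"
  by (simp add: e2pi_def)

lemma e2pi_nonzero [simp]: "e2pi z \<noteq> 0"
  by (simp add: e2pi_def)

lemma e2pi_of_int [simp]: "e2pi (of_int k) = 1"
  unfolding e2pi_def exp_eq_1 by auto

lemma e2pi_minus: "e2pi (- z) = inverse (e2pi z)"
  by (simp add: e2pi_def exp_minus)

lemma e2pi_add_of_int [simp]: "e2pi (z + of_int k) = e2pi z"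
  by (simp add: e2pi_add)

lemma norm_e2pi: "norm (e2pi z) = exp (- 2 * pi * Im z)"
  by (simp add: e2pi_def)

lemma norm_e2pi_of_real [simp]: "norm (e2pi (of_real x)) = 1"
  by (simp add: norm_e2pi)

lemma norm_e2pi_frac [simp]: "norm (e2pi (of_int a / of_int q)) = 1"
  using norm_e2pi_of_real [of "of_int a / of_int q"] by (simp del: norm_e2pi_of_real)

lemma e2pi_holomorphic [holomorphic_intros]:
  "f holomorphic_on S \<Longrightarrow> (\<lambda>z. e2pi (f z)) holomorphic_on S"
  unfolding e2pi_def by (intro holomorphic_intros)

lemma e2pi_continuous [continuous_intros]:
  "continuous_on S f \<Longrightarrow> continuous_on S (\<lambda>z. e2pi (f z))"
  unfolding e2pi_def by (intro continuous_intros)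

lemma e2pi_eq_1_iff: "e2pi z = 1 \<longleftrightarrow> (\<exists>k::int. z = of_int k)"
proof
  assume "e2pi z = 1"
  then obtain k :: int where k: "Re (2 * of_real pi * \<i> * z) = 0" "Im (2 * of_real pi * \<i> * z) = real_of_int (2 * k) * pi"
    unfolding e2pi_def exp_eq_1 by blast
  then have "z = of_int k" by (auto simp: complex_eq_iff)
  then show "\<exists>k::int. z = of_int k" ..
qed auto

lemma e2pi_has_field_derivative [derivative_intros]:
  "(f has_field_derivative f') (at x within S) \<Longrightarrow>
    ((\<lambda>x. e2pi (f x)) has_field_derivative (2 * of_real pi * \<i> * f' * e2pi (f x))) (at x within S)"
  unfolding e2pi_def by (auto intro!: derivative_eq_intros)

lemma summable_on_exp_neg_abs_int: "(\<lambda>k::int. exp (- real_of_int \<bar>k\<bar>)) summable_on UNIV"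
proof -
  have s: "(\<lambda>n::nat. exp (- real n)) summable_on UNIV"
  proof (rule norm_summable_imp_summable_on)
    have "summable (\<lambda>n. (exp (-1::real)) ^ n)" by (rule summable_geometric) simp
    then show "summable (\<lambda>n. norm (exp (- real n)))"
      by (simp add: exp_of_nat_mult [symmetric])
  qed
  have "(\<lambda>k::int. exp (- real_of_int \<bar>k\<bar>)) summable_on (range int \<union> range (\<lambda>n. - int n))"
  proof (rule summable_on_union)
    show "(\<lambda>k::int. exp (- real_of_int \<bar>k\<bar>)) summable_on range int"
      by (subst summable_on_reindex) (auto simp: o_def s)
    show "(\<lambda>k::int. exp (- real_of_int \<bar>k\<bar>)) summable_on range (\<lambda>n. - int n)"
      by (subst summable_on_reindex) (auto simp: o_def s inj_on_def)
  qed
  also have "range int \<union> range (\<lambda>n. - int n) = UNIV"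
    by (auto simp: image_iff) (metis int_cases2)
  finally show ?thesis .
qed

lemma summable_on_gaussian_int:
  assumes "t > 0"
  shows "(\<lambda>k::int. exp (- pi * t * real_of_int k ^ 2 + B * real_of_int \<bar>k\<bar>)) summable_on UNIV"
proof (rule summable_on_comparison_test)
  define C where "C = (B + 1)\<^sup>2 / (4 * (pi * t))"
  show "(\<lambda>k::int. exp C * exp (- real_of_int \<bar>k\<bar>)) summable_on UNIV"
    by (intro summable_on_cmult_right summable_on_exp_neg_abs_int)
  fix k :: int
  define x where "x = real_of_int \<bar>k\<bar>"
  have pt: "pi * t > 0" using assms by simp
  have "0 \<le> (2 * (pi * t) * x - (B + 1))\<^sup>2 / (4 * (pi * t))" using pt by simp
  also have "\<dots> = pi * t * x\<^sup>2 - (B + 1) * x + C"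
    unfolding C_def using pt assms by (simp add: field_simps power2_eq_square)
  finally have "- pi * t * x\<^sup>2 + B * x \<le> C - x" by (simp add: algebra_simps)
  then have "- pi * t * real_of_int k ^ 2 + B * real_of_int \<bar>k\<bar> \<le> C + - real_of_int \<bar>k\<bar>"
    unfolding x_def by simp
  then show "exp (- pi * t * real_of_int k ^ 2 + B * real_of_int \<bar>k\<bar>) \<le> exp C * exp (- real_of_int \<bar>k\<bar>)"
    unfolding exp_add [symmetric] by simp
qed auto

text \<open>
  The theta function with nome \<open>exp (- \<pi> t)\<close>, in its elliptic variable \<open>z\<close>.
\<close>

definition theta :: "real \<Rightarrow> complex \<Rightarrow> complex" where
  "theta t z = (\<Sum>\<^sub>\<infinity>k::int. exp (- of_real (pi * t * real_of_int k ^ 2)) * e2pi (of_int k * z))"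

lemma norm_theta_term:
  "norm (exp (- of_real (pi * t * real_of_int k ^ 2)) * e2pi (of_int k * z))
     = exp (- pi * t * real_of_int k ^ 2 - 2 * pi * real_of_int k * Im z)"
proof -
  have "norm (exp (- of_real (pi * t * real_of_int k ^ 2)) * e2pi (of_int k * z))
     = exp (- (pi * t * real_of_int k ^ 2)) * exp (- 2 * pi * (real_of_int k * Im z))"
    unfolding norm_mult norm_e2pi norm_exp_eq_Re by simp
  then show ?thesis by (simp flip: exp_add)
qed

lemma norm_theta_term_le:
  assumes "\<bar>Im z\<bar> \<le> B"
  shows "norm (exp (- of_real (pi * t * real_of_int k ^ 2)) * e2pi (of_int k * z))
     \<le> exp (- pi * t * real_of_int k ^ 2 + 2 * pi * B * real_of_int \<bar>k\<bar>)"
proof -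
  have "- (real_of_int k * Im z) \<le> \<bar>real_of_int k\<bar> * \<bar>Im z\<bar>"
    by (metis abs_ge_minus_self abs_mult)
  also have "\<dots> \<le> \<bar>real_of_int k\<bar> * B" using assms by (intro mult_left_mono) auto
  finally have "pi * (- (real_of_int k * Im z)) \<le> pi * (\<bar>real_of_int k\<bar> * B)"
    by (intro mult_left_mono) auto
  then show ?thesis unfolding norm_theta_term by (simp add: mult_ac)
qed

lemma theta_summable:
  assumes "t > 0"
  shows "(\<lambda>k::int. exp (- of_real (pi * t * real_of_int k ^ 2)) * e2pi (of_int k * z)) summable_on UNIV"
proof -
  have "(\<lambda>k::int. norm (exp (- of_real (pi * t * real_of_int k ^ 2)) * e2pi (of_int k * z))) summable_on UNIV"
    by (rule Infinite_Sum.abs_summable_on_comparison_test' [OF summable_on_gaussian_int [OF assms]])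
       (rule norm_theta_term_le, rule order_refl)
  then show ?thesis by (rule abs_summable_summable)
qed

lemma theta_uniform_limit:
  assumes "t > 0" "\<And>z. z \<in> S \<Longrightarrow> \<bar>Im z\<bar> \<le> B"
  shows "uniform_limit S (\<lambda>X z. \<Sum>k\<in>X. exp (- of_real (pi * t * real_of_int k ^ 2)) * e2pi (of_int k * z))
           (theta t) (finite_subsets_at_top UNIV)"
  unfolding theta_def
  by (rule Weierstrass_m_test_general [OF norm_theta_term_le summable_on_gaussian_int [OF assms(1)]])
     (use assms in auto)

lemma theta_holomorphic:
  assumes "t > 0"
  shows "theta t holomorphic_on UNIV"
proof -
  have "theta t holomorphic_on ball z 1" for z
  proof (rule holomorphic_uniform_limit)
    show "uniform_limit (cball z 1) (\<lambda>X z. \<Sum>k\<in>X. exp (- of_real (pi * t * real_of_int k ^ 2)) * e2pi (of_int k * z))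
           (theta t) (finite_subsets_at_top UNIV)"
    proof (rule theta_uniform_limit [OF assms, where B = "\<bar>Im z\<bar> + 1"])
      fix y assume "y \<in> cball z 1"
      then have "\<bar>Im (z - y)\<bar> \<le> 1"
        using abs_Im_le_cmod [of "z - y"] by (simp add: dist_norm)
      then show "\<bar>Im y\<bar> \<le> \<bar>Im z\<bar> + 1" by simp
    qed
  qed (auto intro!: always_eventually holomorphic_intros continuous_intros)
  then have "theta t field_differentiable at z" for z
    by (meson centre_in_ball holomorphic_on_imp_differentiable_at open_ball zero_less_one)
  then show ?thesis
    by (simp add: holomorphic_on_def field_differentiable_at_within)
qed

lemma theta_add_1: "theta t (z + 1) = theta t z"
  unfolding theta_def by (simp add: distrib_left e2pi_add)

text \<open>
  Completing the square: the shift of \<open>z\<close> amounts to shifting the summation index by one.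
\<close>

lemma theta_add_period:
  assumes "s > 0"
  shows "theta s (z + \<i> * of_real s) = exp (of_real (pi * s)) * e2pi (- z) * theta s z"
proof -
  let ?f = "\<lambda>k::int. exp (- of_real (pi * s * real_of_int k ^ 2)) * e2pi (of_int k * z)"
  have *: "exp (- of_real (pi * s * real_of_int k ^ 2)) * e2pi (of_int k * (z + \<i> * of_real s))
      = exp (of_real (pi * s)) * e2pi (- z) * ?f (k + 1)" for k :: int
    unfolding e2pi_def exp_add [symmetric]
    by (rule arg_cong [where f = exp]) (simp add: algebra_simps power2_eq_square)
  have "theta s (z + \<i> * of_real s) = (\<Sum>\<^sub>\<infinity>k::int. exp (of_real (pi * s)) * e2pi (- z) * ?f (k + 1))"
    unfolding theta_def by (simp only: *)
  also have "\<dots> = exp (of_real (pi * s)) * e2pi (- z) * (\<Sum>\<^sub>\<infinity>k::int. ?f (k + 1))"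
  proof (rule infsum_cmult_right)
    have "(\<lambda>k. ?f (k + 1)) summable_on UNIV \<longleftrightarrow> ?f summable_on UNIV"
      by (rule summable_on_reindex_bij_betw) (rule bij_plus_right)
    then show "(\<lambda>k. ?f (k + 1)) summable_on UNIV" using theta_summable [OF assms] by blast
  qed
  also have "(\<Sum>\<^sub>\<infinity>k::int. ?f (k + 1)) = theta s z"
    unfolding theta_def by (rule infsum_reindex_bij_betw) (rule bij_plus_right)
  finally show ?thesis .
qed

lemma theta_0_nonzero:
  assumes "t > 0"
  shows "theta t 0 \<noteq> 0"
proof -
  have s: "(\<lambda>k::int. exp (- (pi * t * real_of_int k ^ 2))) summable_on UNIV"
    using summable_on_gaussian_int [OF assms, of 0] by simp
  have "theta t 0 = (\<Sum>\<^sub>\<infinity>k::int. of_real (exp (- (pi * t * real_of_int k ^ 2))))"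
    unfolding theta_def by (simp flip: exp_of_real)
  also have "\<dots> = of_real (\<Sum>\<^sub>\<infinity>k::int. exp (- (pi * t * real_of_int k ^ 2)))"
    by (rule infsum_bounded_linear_strong [OF _ bounded_linear_of_real]) (use s summable_on_of_real in blast)
  finally have eq: "theta t 0 = of_real (\<Sum>\<^sub>\<infinity>k::int. exp (- (pi * t * real_of_int k ^ 2)))" .
  have "(\<Sum>\<^sub>\<infinity>k\<in>{0::int}. exp (- (pi * t * real_of_int k ^ 2)))
      \<le> (\<Sum>\<^sub>\<infinity>k::int. exp (- (pi * t * real_of_int k ^ 2)))"
    by (rule infsum_mono2) (use s in auto)
  then have "(\<Sum>\<^sub>\<infinity>k::int. exp (- (pi * t * real_of_int k ^ 2))) \<ge> 1" by simp
  then show ?thesis unfolding eq by (simp only: of_real_eq_0_iff)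
qed

text \<open>
  This is \<open>sum exp (- \<pi> s (z + m)^2)\<close> over all integers \<open>m\<close> (\<open>gauss_theta_has_sum\<close>). Written in
  terms of \<open>theta\<close> it is visibly entire, and its behaviour under translation follows from the
  quasi-periods of \<open>theta\<close>.
\<close>

definition gauss_theta :: "real \<Rightarrow> complex \<Rightarrow> complex" where
  "gauss_theta s z = exp (- of_real (pi * s) * z\<^sup>2) * theta s (\<i> * of_real s * z)"

lemma gauss_theta_holomorphic:
  assumes "s > 0" shows "gauss_theta s holomorphic_on S"
proof -
  have "(theta s \<circ> (\<lambda>z. \<i> * of_real s * z)) holomorphic_on S"
    by (rule holomorphic_on_compose_gen [OF _ theta_holomorphic [OF assms]]) (auto intro!: holomorphic_intros)
  then show ?thesis unfolding gauss_theta_def o_def by (intro holomorphic_intros)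
qed

lemma gauss_theta_add_1:
  assumes "s > 0" shows "gauss_theta s (z + 1) = gauss_theta s z"
proof -
  have "\<i> * of_real s * (z + 1) = \<i> * of_real s * z + \<i> * of_real s" by (simp add: algebra_simps)
  then have "gauss_theta s (z + 1) = (exp (- of_real (pi * s) * (z + 1)\<^sup>2) * exp (of_real (pi * s)) *
      e2pi (- (\<i> * of_real s * z))) * theta s (\<i> * of_real s * z)"
    unfolding gauss_theta_def by (simp add: theta_add_period [OF assms] del: of_real_mult)
  also have "exp (- of_real (pi * s) * (z + 1)\<^sup>2) * exp (of_real (pi * s)) * e2pi (- (\<i> * of_real s * z))
      = exp (- of_real (pi * s) * z\<^sup>2)"
    unfolding e2pi_def exp_add [symmetric]
    by (rule arg_cong [where f = exp]) (simp add: algebra_simps power2_eq_square)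
  finally show ?thesis unfolding gauss_theta_def .
qed

text \<open>
  Together with the period 1, this relation determines the ratios of consecutive Fourier coefficients.
\<close>

lemma gauss_theta_shift:
  assumes "s > 0"
  shows "gauss_theta s (z + (- \<i> / of_real s)) = exp (of_real (pi / s)) * e2pi z * gauss_theta s z"
proof -
  have 1: "\<i> * of_real s * (z + (- \<i> / of_real s)) = \<i> * of_real s * z + 1"
    using assms by (simp add: field_simps)
  have 2: "exp (- of_real (pi * s) * (z + (- \<i> / of_real s))\<^sup>2)
      = exp (of_real (pi / s)) * e2pi z * exp (- of_real (pi * s) * z\<^sup>2)"
    unfolding e2pi_def exp_add [symmetric] using assms
    by (intro arg_cong [where f = exp]) (simp add: field_simps power2_eq_square)
  show ?thesis unfolding gauss_theta_def 1 2 theta_add_1 by (simp add: mult_ac)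
qed

lemma gauss_theta_has_sum:
  assumes "s > 0"
  shows "((\<lambda>m::int. exp (- of_real (pi * s * (x + real_of_int m)\<^sup>2))) has_sum gauss_theta s (of_real x)) UNIV"
proof -
  have *: "exp (- of_real (pi * s * (x + real_of_int m)\<^sup>2)) =
    exp (- of_real (pi * s) * (of_real x)\<^sup>2) * (exp (- of_real (pi * s * real_of_int m ^ 2)) * e2pi (of_int m * (\<i> * of_real s * of_real x)))"
    for m :: int
    unfolding e2pi_def exp_add [symmetric]
    by (rule arg_cong [where f = exp]) (simp add: algebra_simps power2_eq_square)
  show ?thesis
    unfolding * gauss_theta_def theta_def
    by (intro has_sum_cmult_right has_sum_infsum theta_summable assms)
qed

section \<open>Fourier coefficients on the unit interval\<close>

lemma integral_e2pi_int:
  "integral {0..1} (\<lambda>x. e2pi (of_int k * of_real x)) = (if k = 0 then 1 else 0)"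
proof (cases "k = 0")
  case False
  define c where "c = 2 * of_real pi * \<i> * of_int k"
  have c: "c \<noteq> 0" using False by (simp add: c_def)
  have "((\<lambda>x. e2pi (of_int k * of_real x)) has_integral
          (e2pi (of_int k * of_real 1) / c - e2pi (of_int k * of_real 0) / c)) {0..1}"
  proof (rule fundamental_theorem_of_calculus)
    fix x :: real assume "x \<in> {0..1}"
    have "((\<lambda>z. e2pi (of_int k * z) / c) has_field_derivative e2pi (of_int k * of_real x)) (at (of_real x))"
      using c by (auto intro!: derivative_eq_intros simp: c_def)
    then have "((\<lambda>z. e2pi (of_int k * of_real z) / c) has_vector_derivative e2pi (of_int k * of_real x)) (at x)"
      by (rule has_vector_derivative_real_field)
    then show "((\<lambda>z. e2pi (of_int k * of_real z) / c) has_vector_derivative e2pi (of_int k * of_real x)) (at x within {0..1})"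
      by (rule has_vector_derivative_at_within)
  qed simp
  moreover have "e2pi (of_int k) = 1" by simp
  ultimately show ?thesis using False by (simp add: integral_unique)
qed simp

definition fourier_coeff :: "(real \<Rightarrow> complex) \<Rightarrow> int \<Rightarrow> complex" where
  "fourier_coeff f k = integral {0..1} (\<lambda>x. f x * e2pi (- of_int k * of_real x))"

lemma continuous_integrable_01:
  "continuous_on {0..1} f \<Longrightarrow> f integrable_on {0..1::real}" for f :: "real \<Rightarrow> complex"
  by (rule integrable_continuous_interval)

lemma fourier_coeff_cmult: "fourier_coeff (\<lambda>x. c * f x) k = c * fourier_coeff f k"
  unfolding fourier_coeff_def by (simp add: mult.assoc)

lemma fourier_coeff_diff:
  assumes "continuous_on {0..1} f" "continuous_on {0..1} g"
  shows "fourier_coeff (\<lambda>x. f x - g x) k = fourier_coeff f k - fourier_coeff g k"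
proof -
  have "(\<lambda>x. f x * e2pi (- of_int k * of_real x)) integrable_on {0..1}"
       "(\<lambda>x. g x * e2pi (- of_int k * of_real x)) integrable_on {0..1}"
    by (intro continuous_integrable_01 continuous_intros assms)+
  then show ?thesis unfolding fourier_coeff_def left_diff_distrib by (rule integral_diff)
qed

lemma fourier_coeff_e2pi:
  "fourier_coeff (\<lambda>x. e2pi (of_int j * of_real x) * f x) k = fourier_coeff f (k - j)"
proof -
  have "e2pi (of_int j * of_real x) * f x * e2pi (- of_int k * of_real x)
      = f x * (e2pi (of_int j * of_real x) * e2pi (- of_int k * of_real x))" for x
    by simp
  also have "\<dots> x = f x * e2pi (- of_int (k - j) * of_real x)" for x
    unfolding e2pi_add [symmetric] by (simp add: algebra_simps)
  finally have "(\<lambda>x. e2pi (of_int j * of_real x) * f x * e2pi (- of_int k * of_real x))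
      = (\<lambda>x. f x * e2pi (- of_int (k - j) * of_real x))" by (rule ext)
  then show ?thesis unfolding fourier_coeff_def by (rule arg_cong)
qed

lemma fourier_coeff_const: "fourier_coeff (\<lambda>x. c) k = (if k = 0 then c else 0)"
  using integral_e2pi_int [of "- k"] unfolding fourier_coeff_def by simp

lemma fourier_coeff_character:
  "fourier_coeff (\<lambda>x. e2pi (of_int j * of_real x)) k = (if k = j then 1 else 0)"
  using fourier_coeff_e2pi [of j "\<lambda>_. 1" k] by (simp add: fourier_coeff_const)

lemma cnj_e2pi_of_real: "cnj (e2pi (of_int j * of_real x)) = e2pi (- of_int j * of_real x)"
  unfolding e2pi_def exp_cnj by simp

lemma integral_cnj_01:
  assumes "continuous_on {0..1} (f :: real \<Rightarrow> complex)"
  shows "integral {0..1} (\<lambda>x. cnj (f x)) = cnj (integral {0..1} f)"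
  using integral_linear [OF continuous_integrable_01 [OF assms] bounded_linear_cnj] by (simp add: o_def)

text \<open>
  When the square is expanded, the two cross terms contribute \<open>- (cmod c)\<^sup>2\<close> each and the square of the
  subtracted mode contributes \<open>(cmod c)\<^sup>2\<close>.
\<close>

lemma bessel_step:
  fixes j :: int
  assumes f: "continuous_on {0..1} f"
  defines "c \<equiv> fourier_coeff f j"
  shows "integral {0..1} (\<lambda>x. (cmod (f x - c * e2pi (of_int j * of_real x)))\<^sup>2)
       = integral {0..1} (\<lambda>x. (cmod (f x))\<^sup>2) - (cmod c)\<^sup>2"
proof -
  let ?e = "\<lambda>x::real. e2pi (of_int j * of_real x)"
  let ?m = "\<lambda>x::real. e2pi (- of_int j * of_real x)"
  have of_real_int: "of_real (integral {0..1} (\<lambda>x. (cmod (g x))\<^sup>2)) = integral {0..1} (\<lambda>x. g x * cnj (g x))"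
    if "continuous_on {0..1} g" for g :: "real \<Rightarrow> complex"
  proof -
    have "(\<lambda>x. (cmod (g x))\<^sup>2) integrable_on {0..1}"
      by (rule integrable_continuous_interval) (intro continuous_intros that)
    from integral_linear [OF this bounded_linear_of_real [where 'a = complex]]
    have "integral {0..1} (\<lambda>x. complex_of_real ((cmod (g x))\<^sup>2)) = of_real (integral {0..1} (\<lambda>x. (cmod (g x))\<^sup>2))"
      by (simp add: o_def)
    then show ?thesis by (simp only: complex_norm_square)
  qed
  have i: "(\<lambda>x. f x * cnj (f x)) integrable_on {0..1}" "(\<lambda>x. cnj c * (f x * ?m x)) integrable_on {0..1}"
     "(\<lambda>x. c * cnj (f x * ?m x)) integrable_on {0..1}"
    by (intro continuous_integrable_01 continuous_intros f)+
  have em: "?e x * ?m x = 1" for x by (simp flip: e2pi_add)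
  have eq: "(f x - c * ?e x) * cnj (f x - c * ?e x) =
     f x * cnj (f x) - cnj c * (f x * ?m x) - c * cnj (f x * ?m x) + c * cnj c" for x
  proof -
    have "cnj (?m x) = ?e x" using cnj_e2pi_of_real [of "- j" x] by simp
    then have "(f x - c * ?e x) * cnj (f x - c * ?e x) -
     (f x * cnj (f x) - cnj c * (f x * ?m x) - c * cnj (f x * ?m x) + c * cnj c) = c * cnj c * (?e x * ?m x - 1)"
      unfolding complex_cnj_diff complex_cnj_mult cnj_e2pi_of_real by (simp add: algebra_simps)
    also have "\<dots> = 0" by (simp only: em diff_self mult_zero_right)
    finally show ?thesis by (simp only: right_minus_eq)
  qed
  have "of_real (integral {0..1} (\<lambda>x. (cmod (f x - c * ?e x))\<^sup>2)) =
     integral {0..1} (\<lambda>x. (f x - c * ?e x) * cnj (f x - c * ?e x))"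
    by (rule of_real_int) (intro continuous_intros f)
  also have "\<dots> = integral {0..1} (\<lambda>x. f x * cnj (f x)) - integral {0..1} (\<lambda>x. cnj c * (f x * ?m x))
     - integral {0..1} (\<lambda>x. c * cnj (f x * ?m x)) + c * cnj c"
  proof -
    have "((\<lambda>x::real. c * cnj c) has_integral c * cnj c) {0..1}"
      using has_integral_const_real [of "c * cnj c" 0 1] by simp
    from has_integral_add [OF has_integral_diff [OF has_integral_diff [OF integrable_integral [OF i(1)]
          integrable_integral [OF i(2)]] integrable_integral [OF i(3)]] this]
    show ?thesis unfolding eq by (rule integral_unique)
  qed
  also have "integral {0..1} (\<lambda>x. cnj c * (f x * ?m x)) = cnj c * c"
    by (simp add: c_def fourier_coeff_def)
  also have "integral {0..1} (\<lambda>x. c * cnj (f x * ?m x)) = c * cnj c"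
  proof -
    have "integral {0..1} (\<lambda>x. cnj (f x * ?m x)) = cnj c"
      unfolding c_def fourier_coeff_def by (rule integral_cnj_01) (intro continuous_intros f)
    then show ?thesis by simp
  qed
  finally have "complex_of_real (integral {0..1} (\<lambda>x. (cmod (f x - c * ?e x))\<^sup>2)) =
     of_real (integral {0..1} (\<lambda>x. (cmod (f x))\<^sup>2) - (cmod c)\<^sup>2)"
    by (simp add: of_real_int [OF f] complex_norm_square [of c] del: of_real_power)
  then show ?thesis by (simp only: of_real_eq_iff)
qed

text \<open>
  A weak form of the Riemann-Lebesgue lemma: by Bessel's inequality, infinitely many Fourier
  coefficients of a continuous function cannot share a positive modulus.
\<close>

lemma bessel_constant_modulus:
  fixes \<sigma> :: "nat \<Rightarrow> int"
  assumes "continuous_on {0..1} f" "inj \<sigma>" "\<And>n. cmod (fourier_coeff f (\<sigma> n)) = A"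
  shows "A = 0"
proof -
  have *: "real N * A\<^sup>2 \<le> integral {0..1} (\<lambda>x. (cmod (f x))\<^sup>2)" for N
    using assms
  proof (induction N arbitrary: f \<sigma>)
    case 0
    show ?case by (simp add: integral_nonneg integrable_continuous_interval 0 continuous_intros)
  next
    case (Suc N)
    define c where "c = fourier_coeff f (\<sigma> 0)"
    define g where "g = (\<lambda>x. f x - c * e2pi (of_int (\<sigma> 0) * of_real x))"
    have cg: "continuous_on {0..1} g" unfolding g_def by (intro continuous_intros Suc.prems)
    have "fourier_coeff g (\<sigma> (Suc n)) = fourier_coeff f (\<sigma> (Suc n))" for n
    proof -
      have "\<sigma> (Suc n) \<noteq> \<sigma> 0" using Suc.prems(2) by (auto dest: injD)
      moreover have "fourier_coeff g (\<sigma> (Suc n)) = fourier_coeff f (\<sigma> (Suc n)) -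
           fourier_coeff (\<lambda>x. c * e2pi (of_int (\<sigma> 0) * of_real x)) (\<sigma> (Suc n))"
        unfolding g_def by (rule fourier_coeff_diff) (intro continuous_intros Suc.prems)+
      ultimately show ?thesis by (simp add: fourier_coeff_cmult fourier_coeff_character)
    qed
    then have "real N * A\<^sup>2 \<le> integral {0..1} (\<lambda>x. (cmod (g x))\<^sup>2)"
      using Suc.prems by (intro Suc.IH [OF cg, of "\<lambda>n. \<sigma> (Suc n)"]) (auto simp: inj_def)
    moreover have "(cmod c)\<^sup>2 = A\<^sup>2" using Suc.prems(3) [of 0] by (simp add: c_def)
    ultimately show ?case
      using bessel_step [OF Suc.prems(1), of "\<sigma> 0"] unfolding g_def c_def by (simp add: algebra_simps)
  qed
  show "A = 0"
  proof (rule ccontr)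
    assume "A \<noteq> 0"
    then have "A\<^sup>2 > 0" by simp
    from reals_Archimedean3 [OF this] obtain N :: nat where
      "integral {0..1} (\<lambda>x. (cmod (f x))\<^sup>2) < real N * A\<^sup>2" by blast
    with * [of N] show False by linarith
  qed
qed

text \<open>
  Chernoff's argument. Divide \<open>F z - F x\<^sub>0\<close> by \<open>exp (2 \<pi> \<i> (z - x\<^sub>0)) - 1\<close>; the quotient
  \<open>\<kappa>\<close> is continuous because \<open>F\<close> is differentiable. Multiplying back expresses each Fourier
  coefficient of \<open>F - F x\<^sub>0\<close> through two neighbouring coefficients of \<open>\<kappa>\<close>. Where it vanishes, the
  neighbours have equal modulus, so all coefficients of \<open>\<kappa>\<close> with nonnegative index share one modulus, and
  likewise those with negative index. Both moduli must be 0, and the relation at index 0 then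
  says \<open>F x\<^sub>0 = 0\<close>. Only an interior point is treated, since \<open>exp (2 \<pi> \<i> (x - x\<^sub>0)) = 1\<close> would also hold at
  the opposite end point if \<open>x\<^sub>0\<close> were an end point.
\<close>

lemma fourier_coeff_zero_imp_zero:
  assumes F: "F holomorphic_on UNIV" and x0: "0 < x0" "x0 < 1"
    and zero: "\<And>k. fourier_coeff (\<lambda>x. F (of_real x)) k = 0"
  shows "F (of_real x0) = 0"
proof -
  define a :: complex where "a = of_real x0"
  define K where "K z = (if z = a then deriv F a / (2 * of_real pi * \<i>) else (F z - F a) / (e2pi (z - a) - 1))" for z
  define \<kappa> where "\<kappa> x = K (of_real x)" for x :: real
  have e_ne: "e2pi (of_real x - a) \<noteq> 1" if "x \<in> {0..1}" "x \<noteq> x0" for x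
  proof
    assume "e2pi (of_real x - a) = 1"
    then obtain k :: int where "of_real x - a = of_int k" unfolding e2pi_eq_1_iff by blast
    then have "x - x0 = of_int k"
      unfolding a_def by (metis of_real_diff of_real_eq_iff of_real_of_int_eq)
    moreover have "\<bar>x - x0\<bar> < 1" using that x0 by auto
    ultimately have "\<bar>real_of_int k\<bar> < 1" by simp
    then have "k = 0" by linarith
    then show False using \<open>x - x0 = of_int k\<close> that by simp
  qed
  have dF: "(F has_field_derivative deriv F z) (at z)" for z
    using F by (simp add: holomorphic_derivI [of F UNIV])
  have contF: "continuous_on S F" for S
    using F holomorphic_on_imp_continuous_on continuous_on_subset by blast
  have "isCont K (of_real x)" if x: "x \<in> {0..1}" for x
  proof (cases "x = x0")
    case True
    have "((\<lambda>z. e2pi (z - a)) has_field_derivative 2 * of_real pi * \<i>) (at a)"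
      by (auto intro!: derivative_eq_intros)
    then have "((\<lambda>z. (e2pi (z - a) - 1) / (z - a)) \<longlongrightarrow> 2 * of_real pi * \<i>) (at a)"
      by (simp add: has_field_derivative_iff)
    moreover have "((\<lambda>z. (F z - F a) / (z - a)) \<longlongrightarrow> deriv F a) (at a)"
      using dF [of a] by (simp add: has_field_derivative_iff)
    ultimately have "((\<lambda>z. ((F z - F a) / (z - a)) / ((e2pi (z - a) - 1) / (z - a))) \<longlongrightarrow> deriv F a / (2 * of_real pi * \<i>)) (at a)"
      by (intro tendsto_divide) auto
    moreover have "\<forall>\<^sub>F z in at a. ((F z - F a) / (z - a)) / ((e2pi (z - a) - 1) / (z - a)) = K z"
      unfolding eventually_at_topological by (rule exI [of _ UNIV]) (auto simp: K_def)
    ultimately have "(K \<longlongrightarrow> deriv F a / (2 * of_real pi * \<i>)) (at a)"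
      using Lim_transform_eventually by blast
    then have "isCont K a" by (simp add: isCont_def K_def)
    then show ?thesis using True by (simp add: a_def)
  next
    case False
    then have ne: "complex_of_real x \<noteq> a" by (simp add: a_def)
    have cont: "isCont (\<lambda>z. (F z - F a) / (e2pi (z - a) - 1)) (of_real x)"
      using e_ne [OF x False] DERIV_isCont [OF dF] unfolding e2pi_def
      by (intro continuous_intros) auto
    have ev: "\<forall>\<^sub>F z in nhds (of_real x). (F z - F a) / (e2pi (z - a) - 1) = K z"
      using ne unfolding eventually_nhds by (intro exI [of _ "- {a}"]) (auto simp: K_def)
    show ?thesis by (rule isCont_cong [OF ev, THEN iffD1]) (fact cont)
  qed
  then have "continuous_on (of_real ` {0..1}) K"
    by (intro continuous_at_imp_continuous_on) blast
  then have cont\<kappa>: "continuous_on {0..1} \<kappa>"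
    unfolding \<kappa>_def by (rule continuous_on_compose2) (auto intro: continuous_on_of_real_id)
  have eq: "F (of_real x) - F a = e2pi (- a) * (e2pi (of_int 1 * of_real x) * \<kappa> x) - \<kappa> x" if "x \<in> {0..1}" for x
  proof (cases "x = x0")
    case True
    have "e2pi (- a) * e2pi (of_int 1 * of_real x) = 1" using True by (simp add: a_def e2pi_minus)
    then have "e2pi (- a) * (e2pi (of_int 1 * of_real x) * \<kappa> x) = \<kappa> x"
      by (metis mult.assoc mult_1)
    then show ?thesis using True by (simp add: a_def)
  next
    case False
    then have "complex_of_real x \<noteq> a" by (simp add: a_def)
    then have "\<kappa> x * (e2pi (of_real x - a) - 1) = F (of_real x) - F a"
      using e_ne [OF that False] by (simp add: \<kappa>_def K_def)
    moreover have "e2pi (of_real x - a) = e2pi (- a) * e2pi (of_int 1 * of_real x)"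
      unfolding e2pi_add [symmetric] by simp
    ultimately show ?thesis by (simp add: algebra_simps)
  qed
  have rec: "e2pi (- a) * fourier_coeff \<kappa> (k - 1) - fourier_coeff \<kappa> k = (if k = 0 then - F a else 0)" for k
  proof -
    have "fourier_coeff (\<lambda>x. F (of_real x) - F a) k = fourier_coeff (\<lambda>x. F (of_real x)) k - fourier_coeff (\<lambda>x. F a) k"
      by (rule fourier_coeff_diff) (auto intro!: continuous_intros continuous_on_compose2 [OF contF])
    moreover have "fourier_coeff (\<lambda>x. F (of_real x) - F a) k = fourier_coeff (\<lambda>x. e2pi (- a) * (e2pi (of_int 1 * of_real x) * \<kappa> x) - \<kappa> x) k"
      unfolding fourier_coeff_def by (rule integral_cong) (simp only: eq)
    moreover have "\<dots> = e2pi (- a) * fourier_coeff \<kappa> (k - 1) - fourier_coeff \<kappa> k"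
    proof -
      have "fourier_coeff (\<lambda>x. e2pi (- a) * (e2pi (of_int 1 * of_real x) * \<kappa> x) - \<kappa> x) k
         = fourier_coeff (\<lambda>x. e2pi (- a) * (e2pi (of_int 1 * of_real x) * \<kappa> x)) k - fourier_coeff \<kappa> k"
        by (rule fourier_coeff_diff) (intro continuous_intros cont\<kappa>)+
      then show ?thesis by (simp only: fourier_coeff_cmult fourier_coeff_e2pi)
    qed
    ultimately show ?thesis by (auto simp: zero fourier_coeff_const split: if_splits)
  qed
  have na: "norm (e2pi (- a)) = 1" unfolding a_def by (simp add: norm_e2pi)
  have up: "cmod (fourier_coeff \<kappa> (int n)) = cmod (fourier_coeff \<kappa> 0)" for n
  proof (induction n)
    case (Suc n)
    from rec [of "int (Suc n)"] have "fourier_coeff \<kappa> (int (Suc n)) = e2pi (- a) * fourier_coeff \<kappa> (int n)" by simp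
    then show ?case using Suc na by (simp add: norm_mult)
  qed simp
  have down: "cmod (fourier_coeff \<kappa> (- 1 - int n)) = cmod (fourier_coeff \<kappa> (-1))" for n
  proof (induction n)
    case (Suc n)
    from rec [of "- 1 - int n"] have "e2pi (- a) * fourier_coeff \<kappa> (- 1 - int (Suc n)) = fourier_coeff \<kappa> (- 1 - int n)"
      by (simp add: algebra_simps)
    then have "cmod (e2pi (- a)) * cmod (fourier_coeff \<kappa> (- 1 - int (Suc n))) = cmod (fourier_coeff \<kappa> (- 1 - int n))"
      by (metis norm_mult)
    then show ?case using Suc na by simp
  qed simp
  have "cmod (fourier_coeff \<kappa> 0) = 0"
    by (rule bessel_constant_modulus [OF cont\<kappa> _ up]) (auto simp: inj_def)
  moreover have "cmod (fourier_coeff \<kappa> (-1)) = 0"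
    by (rule bessel_constant_modulus [OF cont\<kappa> _ down]) (auto simp: inj_def)
  ultimately show ?thesis using rec [of 0] by (simp add: a_def)
qed

section \<open>Inversion of the theta series up to a factor\<close>

text \<open>
  With a primitive \<open>P\<close> of \<open>F\<close>, the integral equals \<open>P (c + 1) - P c\<close>, whose derivative in \<open>c\<close> is
  \<open>F (c + 1) - F c = 0\<close>.
\<close>

lemma integral_shift_periodic_entire:
  assumes F: "F holomorphic_on UNIV" and per: "\<And>z. F (z + 1) = F z"
  shows "integral {0..1} (\<lambda>x. F (of_real x + c)) = integral {0..1} (\<lambda>x. F (of_real x))"
proof -
  obtain P where P: "\<And>z. (P has_field_derivative F z) (at z)"
    using holomorphic_convex_primitive' [OF _ _ F] by auto
  have int: "integral {0..1} (\<lambda>x. F (of_real x + c)) = P (1 + c) - P c" for c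
  proof (rule integral_unique)
    have "((\<lambda>x. F (of_real x + c)) has_integral (P (of_real 1 + c) - P (of_real 0 + c))) {0..1}"
    proof (rule fundamental_theorem_of_calculus)
      fix x :: real
      have "((\<lambda>z. P (z + c)) has_field_derivative F (of_real x + c)) (at (of_real x))"
        by (rule DERIV_chain' [where g = P and f = "\<lambda>z. z + c", OF _ P, THEN DERIV_cong])
           (auto intro!: derivative_eq_intros)
      then have "((\<lambda>x. P (of_real x + c)) has_vector_derivative F (of_real x + c)) (at x)"
        by (rule has_vector_derivative_real_field)
      then show "((\<lambda>x. P (of_real x + c)) has_vector_derivative F (of_real x + c)) (at x within {0..1})"
        by (rule has_vector_derivative_at_within)
    qed simp
    then show "((\<lambda>x. F (of_real x + c)) has_integral P (1 + c) - P c) {0..1}" by simp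
  qed
  have "((\<lambda>c. P (1 + c) - P c) has_field_derivative 0) (at z within UNIV)" for z
  proof -
    have "((\<lambda>c. P (1 + c)) has_field_derivative F (1 + z)) (at z)"
      by (rule DERIV_chain' [where g = P and f = "\<lambda>z. 1 + z", OF _ P, THEN DERIV_cong])
         (auto intro!: derivative_eq_intros)
    from DERIV_diff [OF this P [of z]] show ?thesis using per [of z] by (simp add: add.commute)
  qed
  then obtain C where "\<And>c. P (1 + c) - P c = C"
    using has_field_derivative_zero_constant [of UNIV "\<lambda>c. P (1 + c) - P c"] by auto
  then have "P (1 + c) - P c = P (1 + 0) - P 0" by metis
  then show ?thesis using int [of c] int [of 0] by simp
qed

lemma fourier_coeff_theta:
  assumes "t > 0"
  shows "fourier_coeff (\<lambda>x. theta t (of_real x)) k = exp (- of_real (pi * t * real_of_int k ^ 2))"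
proof -
  define a where "a j = exp (- complex_of_real (pi * t * real_of_int j ^ 2))" for j
  let ?S = "\<lambda>X x. (\<Sum>j\<in>X. a j * e2pi (of_int j * of_real x)) * e2pi (- of_int k * of_real x)"
  have "uniform_limit {0..1::real} (\<lambda>X x. \<Sum>j\<in>X. a j * e2pi (of_int j * of_real x))
     (\<lambda>x. theta t (of_real x)) (finite_subsets_at_top UNIV)"
    unfolding theta_def a_def
  proof (rule Weierstrass_m_test_general [OF _ summable_on_gaussian_int [OF assms, of "2 * pi * 0"]])
    show "norm (exp (- complex_of_real (pi * t * real_of_int j ^ 2)) * e2pi (of_int j * of_real x))
        \<le> exp (- pi * t * real_of_int j ^ 2 + 2 * pi * 0 * real_of_int \<bar>j\<bar>)" for j and x :: real
      by (rule norm_theta_term_le) simp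
  qed
  then have lim: "uniform_limit {0..1::real} ?S
     (\<lambda>x. theta t (of_real x) * e2pi (- of_int k * of_real x)) (finite_subsets_at_top UNIV)"
  proof (rule uniform_lim_mult [OF _ uniform_limit_const])
    have "continuous_on {0..1::real} (\<lambda>x. theta t (of_real x))"
      using holomorphic_on_imp_continuous_on [OF theta_holomorphic [OF assms]]
      by (rule continuous_on_compose2) (auto intro!: continuous_intros)
    then show "bounded ((\<lambda>x. theta t (of_real x)) ` {0..1::real})"
      by (intro compact_imp_bounded compact_continuous_image) auto
    show "bounded ((\<lambda>x. e2pi (- of_int k * of_real x)) ` {0..1::real})"
      by (intro compact_imp_bounded compact_continuous_image continuous_intros) auto
  qed
  obtain I J where IJ: "\<And>X. (?S X has_integral I X) {0..1}"
     "((\<lambda>x. theta t (of_real x) * e2pi (- of_int k * of_real x)) has_integral J) {0..1}"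
     "(I \<longlongrightarrow> J) (finite_subsets_at_top UNIV)"
    by (rule uniform_limit_integral [OF lim]) (auto intro!: continuous_intros)
  have "I X = a k" if X: "finite X" "k \<in> X" for X
  proof -
    have "I X = integral {0..1} (?S X)" by (rule integral_unique [OF IJ(1), symmetric])
    also have "\<dots> = integral {0..1} (\<lambda>x. \<Sum>j\<in>X. a j * (e2pi (of_int j * of_real x) * e2pi (- of_int k * of_real x)))"
      by (simp add: sum_distrib_right mult.assoc)
    also have "\<dots> = (\<Sum>j\<in>X. integral {0..1} (\<lambda>x. a j * (e2pi (of_int j * of_real x) * e2pi (- of_int k * of_real x))))"
      by (intro integral_sum continuous_integrable_01 continuous_intros X)
    also have "\<dots> = (\<Sum>j\<in>X. a j * fourier_coeff (\<lambda>x. e2pi (of_int j * of_real x)) k)"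
      unfolding fourier_coeff_def by simp
    also have "\<dots> = a k" using X by (simp add: fourier_coeff_character if_distrib [where f = "(*) _"] cong: if_cong)
    finally show ?thesis .
  qed
  then have "\<forall>\<^sub>F X in finite_subsets_at_top UNIV. I X = a k"
    unfolding eventually_finite_subsets_at_top by (intro exI [of _ "{k}"]) auto
  then have "(I \<longlongrightarrow> a k) (finite_subsets_at_top UNIV)" by (rule tendsto_eventually)
  then have "J = a k" using IJ(3) tendsto_unique finite_subsets_at_top_neq_bot by blast
  then show ?thesis using IJ(2) by (simp add: fourier_coeff_def a_def integral_unique)
qed

text \<open>
  Shifting the line of integration by \<open>- \<i> / s\<close> turns the integrand for index \<open>k\<close> into the one for
  index \<open>k - 1\<close> times \<open>exp (\<pi> (1 - 2 k) / s)\<close>. The exponents telescope to \<open>- \<pi> k^2 / s\<close>.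
\<close>

lemma fourier_coeff_gauss_theta:
  assumes "s > 0"
  shows "fourier_coeff (\<lambda>x. gauss_theta s (of_real x)) k
    = exp (- of_real (pi * (1 / s) * real_of_int k ^ 2)) * fourier_coeff (\<lambda>x. gauss_theta s (of_real x)) 0"
proof -
  define c where "c = fourier_coeff (\<lambda>x. gauss_theta s (of_real x))"
  have rec: "c k = exp (of_real (pi * (1 - 2 * real_of_int k) / s)) * c (k - 1)" for k
  proof -
    define F where "F z = gauss_theta s z * e2pi (- of_int k * z)" for z
    have "e2pi (- of_int k * (z + 1)) = e2pi (- of_int k * z)" for z
      using e2pi_add_of_int [of "- of_int k * z" "- k"] by (simp add: algebra_simps)
    then have per: "F (z + 1) = F z" for z
      unfolding F_def by (simp add: gauss_theta_add_1 [OF assms])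
    have hol: "F holomorphic_on UNIV"
      unfolding F_def by (intro holomorphic_intros gauss_theta_holomorphic assms)
    have *: "F (of_real x + (- \<i> / of_real s)) =
       exp (of_real (pi * (1 - 2 * real_of_int k) / s)) * (gauss_theta s (of_real x) * e2pi (- of_int (k - 1) * of_real x))" for x
    proof -
      have "exp (of_real (pi / s)) * e2pi (of_real x) * e2pi (- of_int k * (of_real x + (- \<i> / of_real s)))
         = exp (of_real (pi * (1 - 2 * real_of_int k) / s)) * e2pi (- of_int (k - 1) * of_real x)"
        unfolding e2pi_def exp_add [symmetric] using assms
        by (intro arg_cong [where f = exp]) (simp add: field_simps)
      then show ?thesis unfolding F_def gauss_theta_shift [OF assms] by (simp add: mult_ac)
    qed
    have "c k = integral {0..1} (\<lambda>x. F (of_real x))" by (simp add: c_def fourier_coeff_def F_def)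
    also have "\<dots> = integral {0..1} (\<lambda>x. F (of_real x + (- \<i> / of_real s)))"
      by (rule integral_shift_periodic_entire [OF hol per, symmetric])
    also have "\<dots> = exp (of_real (pi * (1 - 2 * real_of_int k) / s)) * c (k - 1)"
      unfolding * c_def fourier_coeff_def by simp
    finally show ?thesis .
  qed
  have "c k = exp (- of_real (pi * (1 / s) * real_of_int k ^ 2)) * c 0"
  proof (induction k rule: int_induct [of _ 0])
    case (step1 i)
    have "c (i + 1) = exp (of_real (pi * (1 - 2 * real_of_int (i + 1)) / s)) * c i" using rec [of "i + 1"] by simp
    also have "\<dots> = exp (of_real (pi * (1 - 2 * real_of_int (i + 1)) / s)) * exp (- of_real (pi * (1 / s) * real_of_int i ^ 2)) * c 0"
      by (subst step1.IH) simp
    also have "exp (of_real (pi * (1 - 2 * real_of_int (i + 1)) / s)) * exp (- of_real (pi * (1 / s) * real_of_int i ^ 2))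
      = exp (- complex_of_real (pi * (1 / s) * real_of_int (i + 1) ^ 2))"
      unfolding exp_add [symmetric] using assms
      by (intro arg_cong [where f = exp]) (simp add: field_simps power2_eq_square)
    finally show ?case .
  next
    case (step2 i)
    have "exp (- of_real (pi * (1 - 2 * real_of_int i) / s)) * c i =
       exp (- of_real (pi * (1 - 2 * real_of_int i) / s)) * exp (of_real (pi * (1 - 2 * real_of_int i) / s)) * c (i - 1)"
      by (subst rec [of i]) simp
    then have "c (i - 1) = exp (- of_real (pi * (1 - 2 * real_of_int i) / s)) * c i"
      by (simp flip: exp_add)
    also have "\<dots> = exp (- of_real (pi * (1 - 2 * real_of_int i) / s)) * exp (- of_real (pi * (1 / s) * real_of_int i ^ 2)) * c 0"
      by (subst step2.IH) simp
    also have "exp (- of_real (pi * (1 - 2 * real_of_int i) / s)) * exp (- of_real (pi * (1 / s) * real_of_int i ^ 2))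
      = exp (- complex_of_real (pi * (1 / s) * real_of_int (i - 1) ^ 2))"
      unfolding exp_add [symmetric] using assms
      by (intro arg_cong [where f = exp]) (simp add: field_simps power2_eq_square)
    finally show ?case .
  qed simp
  then show ?thesis unfolding c_def .
qed

text \<open>
  The constant in Jacobi's inversion formula. It equals \<open>s^(-1/2)\<close>; this is shown below when \<open>s\<close> is
  the square of a rational, which suffices for the analytic continuation.
\<close>

definition theta_factor :: "real \<Rightarrow> complex" where
  "theta_factor s = fourier_coeff (\<lambda>x. gauss_theta s (of_real x)) 0"

text \<open>
  Both sides have the same Fourier coefficients. The value at \<open>0\<close> is reached by continuity, because
  uniqueness was proved at interior points of the unit interval.
\<close>

lemma theta_inversion_upto_factor:
  assumes "s > 0" "0 \<le> x" "x < 1"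
  shows "gauss_theta s (of_real x) = theta_factor s * theta (1 / s) (of_real x)"
proof -
  define F where "F z = gauss_theta s z - theta_factor s * theta (1 / s) z" for z
  have s': "1 / s > 0" using assms by simp
  have hol: "F holomorphic_on UNIV"
    unfolding F_def by (intro holomorphic_intros gauss_theta_holomorphic theta_holomorphic s' assms)
  have cont: "continuous_on {0..1} (\<lambda>x. G (complex_of_real x))" if "G holomorphic_on UNIV" for G
    using holomorphic_on_imp_continuous_on [OF that]
    by (rule continuous_on_compose2) (auto intro!: continuous_intros)
  have zero: "fourier_coeff (\<lambda>x. F (of_real x)) k = 0" for k
  proof -
    have "fourier_coeff (\<lambda>x. F (of_real x)) k = fourier_coeff (\<lambda>x. gauss_theta s (of_real x)) k
        - fourier_coeff (\<lambda>x. theta_factor s * theta (1 / s) (of_real x)) k"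
      unfolding F_def
      by (intro fourier_coeff_diff continuous_intros cont gauss_theta_holomorphic theta_holomorphic s' assms)
    then show ?thesis
      by (simp only: fourier_coeff_cmult fourier_coeff_theta [OF s'] fourier_coeff_gauss_theta [OF assms(1), of k]
            theta_factor_def) simp
  qed
  have inner: "F (of_real y) = 0" if "0 < y" "y < 1" for y
    by (rule fourier_coeff_zero_imp_zero [OF hol that zero])
  have "F (of_real x) = 0"
  proof (cases "x = 0")
    case True
    have "continuous_on {0..1} (\<lambda>x. F (of_real x))" by (rule cont [OF hol])
    then have "((\<lambda>x. F (of_real x)) \<longlongrightarrow> F (of_real 0)) (at 0 within {0..1})"
      unfolding continuous_on_def by (rule bspec) simp
    then have "((\<lambda>x. F (of_real x)) \<longlongrightarrow> F (of_real 0)) (at_right 0)"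
      by (simp add: at_within_Icc_at_right)
    moreover have "((\<lambda>x. F (of_real x)) \<longlongrightarrow> 0) (at_right (0::real))"
    proof (rule tendsto_eventually)
      show "\<forall>\<^sub>F x in at_right (0::real). F (of_real x) = 0"
        unfolding eventually_at_right_field by (rule exI [of _ 1]) (use inner in auto)
    qed
    ultimately have "F (of_real 0) = 0"
      by (rule tendsto_unique [OF trivial_limit_at_right_real])
    then show ?thesis using True by simp
  qed (use inner assms in auto)
  then show ?thesis by (simp add: F_def)
qed

lemma theta_factor_1: "theta_factor 1 = 1"
  using theta_inversion_upto_factor [of 1 0] theta_0_nonzero [of 1] by (simp add: gauss_theta_def)

section \<open>Quadratic Gauss sums\<close>

definition gauss_sum :: "int \<Rightarrow> int \<Rightarrow> int \<Rightarrow> complex" where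
  "gauss_sum p q k = (\<Sum>a\<in>{0..<q}. e2pi (of_int (p * a\<^sup>2 + k * a) / of_int q))"

lemma e2pi_frac_cong:
  assumes "q > 0" "a mod q = b mod q"
  shows "e2pi (of_int a / of_int q) = e2pi (of_int b / of_int q)"
proof -
  obtain m where "a = b + q * m"
    using assms(2) by (metis mod_eqE)
  then have "complex_of_int a / of_int q = of_int b / of_int q + of_int m"
    using assms(1) by (simp add: field_simps)
  then show ?thesis by simp
qed

lemma e2pi_frac_eq_1_iff:
  assumes "q > 0"
  shows "e2pi (of_int a / of_int q) = 1 \<longleftrightarrow> q dvd a"
proof
  assume "e2pi (of_int a / of_int q) = 1"
  then obtain k :: int where "complex_of_int a / of_int q = of_int k" unfolding e2pi_eq_1_iff by blast
  then have "complex_of_int a = of_int (k * q)" using assms by (simp add: field_simps)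
  then have "a = k * q" by (simp only: of_int_eq_iff)
  then show "q dvd a" by simp
next
  assume "q dvd a"
  then have "e2pi (of_int a / of_int q) = e2pi (of_int 0 / of_int q)"
    by (intro e2pi_frac_cong assms) simp
  then show "e2pi (of_int a / of_int q) = 1" by simp
qed

lemma sum_residues_shift:
  fixes f :: "int \<Rightarrow> 'a::comm_monoid_add"
  assumes "q > 0" "\<And>a b. a mod q = b mod q \<Longrightarrow> f a = f b"
  shows "(\<Sum>a\<in>{0..<q}. f (a + d)) = (\<Sum>a\<in>{0..<q}. f a)"
proof (rule sum.reindex_bij_witness [of _ "\<lambda>a. (a - d) mod q" "\<lambda>a. (a + d) mod q"])
  fix a assume a: "a \<in> {0..<q}"
  show "((a + d) mod q - d) mod q = a" using a by (simp add: mod_diff_left_eq)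
  show "(a + d) mod q \<in> {0..<q}" "(a - d) mod q \<in> {0..<q}" using assms by auto
  show "((a - d) mod q + d) mod q = a" using a by (simp add: mod_add_left_eq)
  show "f ((a + d) mod q) = f (a + d)" by (rule assms(2)) simp
qed

lemma sum_roots_of_unity:
  assumes "q > 0"
  shows "(\<Sum>b\<in>{0..<q}. e2pi (of_int (m * b) / of_int q)) = (if q dvd m then of_int q else 0)"
proof (cases "q dvd m")
  case True
  then have "e2pi (of_int (m * b) / of_int q) = 1" for b
    by (subst e2pi_frac_eq_1_iff [OF assms]) simp
  then show ?thesis using True assms by simp
next
  case False
  let ?S = "\<Sum>b\<in>{0..<q}. e2pi (of_int (m * b) / of_int q)"
  have "?S = (\<Sum>b\<in>{0..<q}. e2pi (of_int (m * (b + 1)) / of_int q))"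
    by (rule sum_residues_shift [OF assms, symmetric])
       (intro e2pi_frac_cong [OF assms] mod_mult_cong refl)
  also have "\<dots> = (\<Sum>b\<in>{0..<q}. e2pi (of_int m / of_int q) * e2pi (of_int (m * b) / of_int q))"
    by (simp add: ring_distribs add_divide_distrib e2pi_add mult.commute)
  also have "\<dots> = e2pi (of_int m / of_int q) * ?S" by (simp add: sum_distrib_left)
  finally have "(e2pi (of_int m / of_int q) - 1) * ?S = 0" by (simp add: algebra_simps)
  then show ?thesis using False e2pi_frac_eq_1_iff [OF assms, of m] by auto
qed

text \<open>
  Expand the square, write the first summation variable as \<open>b + d\<close>, and sum over \<open>b\<close> first: the inner sum
  runs over powers of the root of unity with index \<open>2 p d\<close> and survives only if \<open>q\<close> divides \<open>2 d\<close>.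
\<close>

lemma gauss_sum_norm_square:
  assumes q: "q > 0" and cop: "coprime p q"
  shows "of_real ((cmod (gauss_sum p q k))\<^sup>2) =
     of_int q * (\<Sum>d | d \<in> {0..<q} \<and> q dvd 2 * d. e2pi (of_int (p * d\<^sup>2 + k * d) / of_int q))"
proof -
  define f where "f a = p * a\<^sup>2 + k * a" for a :: int
  have f_cong: "f a mod q = f b mod q" if "a mod q = b mod q" for a b
    unfolding f_def power2_eq_square using that by (intro mod_add_cong mod_mult_cong refl)
  have cnj: "cnj (e2pi (of_int n / of_int q)) = e2pi (- of_int n / of_int q)" for n
    unfolding e2pi_def exp_cnj by simp
  have "of_real ((cmod (gauss_sum p q k))\<^sup>2) = gauss_sum p q k * cnj (gauss_sum p q k)"
    by (rule complex_norm_square)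
  also have "\<dots> = (\<Sum>b\<in>{0..<q}. \<Sum>a\<in>{0..<q}. e2pi (of_int (f a - f b) / of_int q))"
    unfolding gauss_sum_def f_def [symmetric] cnj_sum cnj sum_product
    by (subst sum.swap) (simp add: e2pi_add [symmetric] diff_divide_distrib)
  also have "\<dots> = (\<Sum>b\<in>{0..<q}. \<Sum>d\<in>{0..<q}. e2pi (of_int (f (d + b) - f b) / of_int q))"
    by (intro sum.cong refl sum_residues_shift [OF q, symmetric] e2pi_frac_cong [OF q] mod_diff_cong f_cong)
  also have "\<dots> = (\<Sum>b\<in>{0..<q}. \<Sum>d\<in>{0..<q}. e2pi (of_int (f d) / of_int q) * e2pi (of_int (2 * p * d * b) / of_int q))"
    unfolding e2pi_add [symmetric] add_divide_distrib [symmetric] of_int_add [symmetric] f_def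
    by (intro sum.cong refl arg_cong [where f = e2pi]) (simp add: algebra_simps power2_eq_square)
  also have "\<dots> = (\<Sum>d\<in>{0..<q}. e2pi (of_int (f d) / of_int q) * (\<Sum>b\<in>{0..<q}. e2pi (of_int (2 * p * d * b) / of_int q)))"
    by (subst sum.swap) (simp add: sum_distrib_left)
  also have "\<dots> = (\<Sum>d\<in>{0..<q}. if q dvd 2 * d then of_int q * e2pi (of_int (f d) / of_int q) else 0)"
  proof (rule sum.cong [OF refl])
    fix d
    have "q dvd 2 * p * d \<longleftrightarrow> q dvd 2 * d"
      using coprime_dvd_mult_right_iff [of q p "2 * d"] cop by (simp add: coprime_commute mult_ac)
    then show "e2pi (of_int (f d) / of_int q) * (\<Sum>b\<in>{0..<q}. e2pi (of_int (2 * p * d * b) / of_int q)) =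
       (if q dvd 2 * d then of_int q * e2pi (of_int (f d) / of_int q) else 0)"
      unfolding sum_roots_of_unity [OF q] by simp
  qed
  also have "\<dots> = (\<Sum>d | d \<in> {0..<q} \<and> q dvd 2 * d. of_int q * e2pi (of_int (f d) / of_int q))"
    by (rule sum.inter_filter [symmetric]) simp
  finally show ?thesis by (simp add: sum_distrib_left f_def)
qed

lemma half_period_residues:
  assumes "q > (0::int)"
  shows "{d. d \<in> {0..<q} \<and> q dvd 2 * d} = (if even q then {0, q div 2} else {0})"
proof (intro set_eqI iffI)
  fix d assume d: "d \<in> {d. d \<in> {0..<q} \<and> q dvd 2 * d}"
  then obtain m where m: "2 * d = q * m" by auto
  have "m = 0 \<or> m = 1"
  proof -
    have "q * m < q * 2" "q * m \<ge> 0" using d m unfolding mem_Collect_eq atLeastLessThan_iff by linarith+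
    then have "m < 2" using mult_less_cancel_left_pos [OF assms] by blast
    moreover have "m \<ge> 0" using \<open>q * m \<ge> 0\<close> assms by (simp add: zero_le_mult_iff)
    ultimately show ?thesis by linarith
  qed
  then show "d \<in> (if even q then {0, q div 2} else {0})" using m by auto
qed (use assms in \<open>auto split: if_splits\<close>)

lemma gauss_sum_norm_le:
  assumes q: "q > 0" and cop: "coprime p q"
  shows "cmod (gauss_sum p q k) \<le> sqrt (2 * of_int q)"
proof -
  let ?D = "{d. d \<in> {0..<q} \<and> q dvd 2 * d}"
  have "(cmod (gauss_sum p q k))\<^sup>2 = cmod (of_real ((cmod (gauss_sum p q k))\<^sup>2))"
    unfolding norm_of_real by simp
  also have "\<dots> = of_int q * cmod (\<Sum>d\<in>?D. e2pi (of_int (p * d\<^sup>2 + k * d) / of_int q))"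
    unfolding gauss_sum_norm_square [OF assms] norm_mult using q by simp
  also have "cmod (\<Sum>d\<in>?D. e2pi (of_int (p * d\<^sup>2 + k * d) / of_int q)) \<le> (\<Sum>d\<in>?D. 1)"
    by (rule sum_norm_le) (simp only: norm_e2pi_frac order_refl)
  also have "(\<Sum>d\<in>?D. 1) = real (card ?D)" by simp
  also have "card ?D \<le> 2" unfolding half_period_residues [OF q] by (simp add: card_insert_if)
  finally have "(cmod (gauss_sum p q k))\<^sup>2 \<le> 2 * of_int q" using q by simp
  then show ?thesis using real_le_rsqrt by blast
qed

lemma gauss_sum_pair_norm_le:
  assumes q: "q > 0" and cop: "coprime p q"
  shows "cmod (gauss_sum p q k + gauss_sum p q (- k)) \<le> 2 * sqrt (2 * of_int q)"
  using norm_triangle_ineq [of "gauss_sum p q k" "gauss_sum p q (- k)"]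
    gauss_sum_norm_le [OF assms, of k] gauss_sum_norm_le [OF assms, of "- k"] by linarith

text \<open>
  For even \<open>q\<close> the term \<open>d = q / 2\<close> of the squared modulus is \<open>exp (2 \<pi> \<i> p q / 4)\<close>: it
  doubles the term \<open>d = 0\<close> if 4 divides \<open>q\<close> and cancels it if \<open>q mod 4 = 2\<close>.
\<close>

lemma gauss_sum_0_norm_ge:
  assumes q: "q > 0" and cop: "coprime p q" and "q mod 4 \<noteq> 2"
  shows "cmod (gauss_sum p q 0) \<ge> sqrt (of_int q)"
proof -
  have "(cmod (gauss_sum p q 0))\<^sup>2 \<ge> of_int q"
  proof (cases "even q")
    case False
    then have "complex_of_real ((cmod (gauss_sum p q 0))\<^sup>2) = of_real (of_int q)"
      unfolding gauss_sum_norm_square [OF q cop] half_period_residues [OF q] by simp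
    then show ?thesis by (simp only: of_real_eq_iff)
  next
    case True
    then have "4 dvd q" using assms(3) by presburger
    then obtain r where r: "q = 4 * r" ..
    have "e2pi (of_int (p * (q div 2)\<^sup>2 + 0 * (q div 2)) / of_int q) = 1"
      by (subst e2pi_frac_eq_1_iff [OF q]) (simp add: r power2_eq_square)
    moreover have "0 \<noteq> q div 2" using q r by auto
    ultimately have "complex_of_real ((cmod (gauss_sum p q 0))\<^sup>2) = of_real (2 * of_int q)"
      unfolding gauss_sum_norm_square [OF q cop] half_period_residues [OF q] using True by simp
    then have "(cmod (gauss_sum p q 0))\<^sup>2 = 2 * of_int q" by (simp only: of_real_eq_iff)
    then show ?thesis using q by simp
  qed
  then show ?thesis by (intro real_le_lsqrt) auto
qed

lemma gauss_sum_0_eq_0: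
  assumes q: "q > 0" and cop: "coprime p q" and "q mod 4 = 2"
  shows "gauss_sum p q 0 = 0"
proof -
  define r where "r = q div 2"
  have r: "q = 2 * r" "odd r" using assms(3) unfolding r_def by presburger+
  have "odd p"
  proof
    assume "even p"
    then have "is_unit (2::int)" using coprime_common_divisor [OF cop, of 2] r by simp
    then show False by simp
  qed
  then have "odd (p * r)" using r by simp
  then obtain m where m: "p * r = 2 * m + 1" by (rule oddE)
  have "e2pi (of_int (p * (q div 2)\<^sup>2 + 0 * (q div 2)) / of_int q) = e2pi (1 / 2 + of_int m)"
  proof (rule arg_cong [where f = e2pi])
    have "complex_of_int (p * (q div 2)\<^sup>2 + 0 * (q div 2)) / of_int q = of_int (p * r) / 2"
      using q unfolding r by (simp add: power2_eq_square)
    also have "\<dots> = 1 / 2 + of_int m" unfolding m by (simp add: field_simps)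
    finally show "complex_of_int (p * (q div 2)\<^sup>2 + 0 * (q div 2)) / of_int q = 1 / 2 + of_int m" .
  qed
  also have "\<dots> = -1" unfolding e2pi_add_of_int by (simp add: e2pi_def)
  finally have "complex_of_real ((cmod (gauss_sum p q 0))\<^sup>2) = 0"
    unfolding gauss_sum_norm_square [OF q cop] half_period_residues [OF q] using q r by simp
  then show ?thesis by simp
qed

section \<open>Theta series at rational shifts and the inversion factor\<close>

lemma has_sum_finite_sum:
  fixes f :: "'a \<Rightarrow> 'b \<Rightarrow> 'c::topological_comm_monoid_add"
  assumes "finite A" "\<And>a. a \<in> A \<Longrightarrow> (f a has_sum S a) B"
  shows "((\<lambda>x. \<Sum>a\<in>A. f a x) has_sum (\<Sum>a\<in>A. S a)) B"
  using assms by (induction A rule: finite_induct) (auto intro: has_sum_add)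

lemma has_sum_residue_class:
  assumes q: "q > (0::int)" and a: "a \<in> {0..<q}"
    and h: "((\<lambda>m. h (a + q * m)) has_sum S) UNIV"
  shows "((\<lambda>n. if n mod q = a then h n else 0) has_sum S) UNIV"
proof -
  have "((\<lambda>m. h (a + q * m)) has_sum S) UNIV \<longleftrightarrow> (h has_sum S) {n. n mod q = a}"
  proof (rule has_sum_reindex_bij_witness [of _ "\<lambda>n. n div q" "\<lambda>m. a + q * m"])
    fix n assume "n \<in> {n. n mod q = a}"
    then show "a + q * (n div q) = n" by auto
  qed (use q a in auto)
  moreover have "(h has_sum S) {n. n mod q = a} \<longleftrightarrow> ((\<lambda>n. if n mod q = a then h n else 0) has_sum S) UNIV"
    by (rule has_sum_cong_neutral) auto
  ultimately show ?thesis using h by simp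
qed

lemma has_sum_all_residues:
  fixes h :: "int \<Rightarrow> 'a::{topological_comm_monoid_add}"
  assumes q: "q > (0::int)" and h: "\<And>a. a \<in> {0..<q} \<Longrightarrow> ((\<lambda>m. h (a + q * m)) has_sum S a) UNIV"
  shows "(h has_sum (\<Sum>a\<in>{0..<q}. S a)) UNIV"
proof -
  have "((\<lambda>n. \<Sum>a\<in>{0..<q}. if n mod q = a then h n else 0) has_sum (\<Sum>a\<in>{0..<q}. S a)) UNIV"
    by (intro has_sum_finite_sum finite_atLeastLessThan_int has_sum_residue_class q h)
  moreover have "(\<Sum>a\<in>{0..<q}. if n mod q = a then h n else 0) = h n" for n
    using q by (simp add: sum.delta')
  ultimately show ?thesis by simp
qed

text \<open>
  Sorting \<open>n\<close> by its residue \<open>a\<close> modulo \<open>q\<close> gives \<open>q\<close> Gaussian series centred at \<open>a / q\<close>. Inversion of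
  each of them lets the phases in \<open>a\<close> recombine to a Gauss sum for every dual index \<open>k\<close>.
\<close>

lemma theta_rational_shift:
  fixes p q :: int
  assumes s: "s > 0" and q: "q > 0"
  defines "f \<equiv> (\<lambda>k::int. gauss_sum p q k * exp (- of_real (pi * (1 / (s * of_int q ^ 2)) * real_of_int k ^ 2)))"
  shows "\<exists>S. (f has_sum S) UNIV \<and>
    ((\<lambda>n::int. e2pi (of_int (p * n\<^sup>2) / of_int q) * exp (- of_real (pi * s * real_of_int n ^ 2)))
       has_sum (theta_factor (s * of_int q ^ 2) * S)) UNIV"
proof -
  define t where "t = s * real_of_int q ^ 2"
  have t: "t > 0" "1 / t > 0" using s q by (auto simp: t_def)
  define c where "c a = e2pi (of_int (p * a\<^sup>2) / of_int q)" for a :: int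
  define S where "S = (\<Sum>a\<in>{0..<q}. c a * theta (1 / t) (of_real (of_int a / of_int q)))"
  have "(f has_sum S) UNIV"
  proof -
    have "((\<lambda>k::int. \<Sum>a\<in>{0..<q}. c a * (exp (- of_real (pi * (1 / t) * real_of_int k ^ 2)) *
        e2pi (of_int k * of_real (of_int a / of_int q)))) has_sum S) UNIV"
      unfolding S_def theta_def
      by (intro has_sum_finite_sum finite_atLeastLessThan_int has_sum_cmult_right has_sum_infsum theta_summable t)
    moreover have "(\<Sum>a\<in>{0..<q}. c a * (exp (- of_real (pi * (1 / t) * real_of_int k ^ 2)) *
        e2pi (of_int k * of_real (of_int a / of_int q)))) = f k" for k
    proof -
      have *: "c a * e2pi (of_int k * of_real (of_int a / of_int q)) = e2pi (of_int (p * a\<^sup>2 + k * a) / of_int q)" for a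
        unfolding c_def e2pi_add [symmetric] by (simp add: add_divide_distrib)
      show ?thesis
        unfolding f_def gauss_sum_def t_def [symmetric] sum_distrib_right
        by (intro sum.cong refl, unfold * [symmetric]) (simp only: mult_ac)
    qed
    ultimately show ?thesis by simp
  qed
  moreover have "((\<lambda>n::int. e2pi (of_int (p * n\<^sup>2) / of_int q) * exp (- of_real (pi * s * real_of_int n ^ 2)))
       has_sum (\<Sum>a\<in>{0..<q}. c a * gauss_theta t (of_real (of_int a / of_int q)))) UNIV"
  proof (rule has_sum_all_residues [OF q])
    fix a assume "a \<in> {0..<q}"
    have "((\<lambda>m::int. c a * exp (- of_real (pi * t * (of_int a / of_int q + real_of_int m)\<^sup>2)))
       has_sum (c a * gauss_theta t (of_real (of_int a / of_int q)))) UNIV"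
      by (intro has_sum_cmult_right gauss_theta_has_sum t)
    moreover have "c a = e2pi (of_int (p * (a + q * m)\<^sup>2) / of_int q)" for m
    proof -
      have "p * (a + q * m)\<^sup>2 = p * a\<^sup>2 + q * (p * (2 * a * m + q * m\<^sup>2))"
        by (simp add: power2_eq_square ring_distribs mult_ac)
      then show ?thesis unfolding c_def by (intro e2pi_frac_cong [OF q]) simp
    qed
    moreover have "pi * t * (of_int a / of_int q + real_of_int m)\<^sup>2 = pi * s * real_of_int (a + q * m) ^ 2" for m
    proof -
      have "of_int a / of_int q + real_of_int m = real_of_int (a + q * m) / of_int q"
        using q by (simp add: add_divide_distrib)
      then show ?thesis unfolding t_def using q by (simp add: power_divide)
    qed
    ultimately show "((\<lambda>m. e2pi (of_int (p * (a + q * m)\<^sup>2) / of_int q) * exp (- of_real (pi * s * real_of_int (a + q * m) ^ 2)))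
       has_sum (c a * gauss_theta t (of_real (of_int a / of_int q)))) UNIV"
      by simp
  qed
  moreover have "(\<Sum>a\<in>{0..<q}. c a * gauss_theta t (of_real (of_int a / of_int q))) = theta_factor t * S"
    unfolding S_def sum_distrib_left using q
    by (intro sum.cong refl, subst theta_inversion_upto_factor [OF t(1)]) auto
  ultimately show ?thesis unfolding t_def by auto
qed

text \<open>
  The case \<open>p = 0\<close> of the previous lemma: the Gauss sum then keeps only the multiples of \<open>q\<close>, so both the
  original and the dual series are theta series at \<open>0\<close>, and these are also related by plain inversion.
\<close>

lemma theta_factor_scale:
  assumes s: "s > 0" and q: "q > 0"
  shows "theta_factor s = of_int q * theta_factor (s * of_int q ^ 2)"
proof -
  define t where "t = s * real_of_int q ^ 2"
  obtain S where S: "((\<lambda>k::int. gauss_sum 0 q k * exp (- of_real (pi * (1 / t) * real_of_int k ^ 2))) has_sum S) UNIV"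
    and S': "((\<lambda>n::int. exp (- of_real (pi * s * real_of_int n ^ 2))) has_sum (theta_factor t * S)) UNIV"
    using theta_rational_shift [OF s q, of 0] unfolding t_def by auto
  have "theta s 0 = theta_factor t * S"
    unfolding theta_def using S' by (simp add: infsumI)
  moreover have "S = of_int q * theta (1 / s) 0"
  proof -
    have "((\<lambda>k. of_int q * (exp (- of_real (pi * (1 / s) * real_of_int k ^ 2)) * e2pi (of_int k * 0)))
        has_sum (of_int q * theta (1 / s) 0)) UNIV"
      unfolding theta_def using s by (intro has_sum_cmult_right has_sum_infsum theta_summable) auto
    also have "?this \<longleftrightarrow> ((\<lambda>k::int. gauss_sum 0 q k * exp (- of_real (pi * (1 / t) * real_of_int k ^ 2)))
        has_sum (of_int q * theta (1 / s) 0)) {k. q dvd k}"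
    proof (rule has_sum_reindex_bij_witness [of _ "\<lambda>k. k div q" "\<lambda>k. q * k"])
      fix k :: int
      have "pi * (1 / t) * real_of_int (q * k) ^ 2 = pi * (1 / s) * real_of_int k ^ 2"
        unfolding t_def using q by (simp add: field_simps)
      then show "gauss_sum 0 q (q * k) * exp (- of_real (pi * (1 / t) * real_of_int (q * k) ^ 2)) =
         of_int q * (exp (- of_real (pi * (1 / s) * real_of_int k ^ 2)) * e2pi (of_int k * 0))"
        using sum_roots_of_unity [OF q, of "q * k"] by (simp add: gauss_sum_def)
    qed (use q in auto)
    also have "\<dots> \<longleftrightarrow> ((\<lambda>k::int. gauss_sum 0 q k * exp (- of_real (pi * (1 / t) * real_of_int k ^ 2)))
        has_sum (of_int q * theta (1 / s) 0)) UNIV"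
    proof (rule has_sum_cong_neutral)
      fix k assume "k \<in> UNIV - {k. q dvd k}"
      then show "gauss_sum 0 q k * exp (- of_real (pi * (1 / t) * real_of_int k ^ 2)) = 0"
        using sum_roots_of_unity [OF q, of k] by (simp add: gauss_sum_def)
    qed auto
    finally show ?thesis using S has_sum_unique by blast
  qed
  moreover have "theta s 0 = theta_factor s * theta (1 / s) 0"
    using theta_inversion_upto_factor [OF s, of 0] by (simp add: gauss_theta_def)
  moreover have "theta (1 / s) 0 \<noteq> 0" using s by (intro theta_0_nonzero) simp
  ultimately show ?thesis unfolding t_def by simp
qed

lemma theta_factor_rational_square:
  assumes "a > 0" "b > 0"
  shows "theta_factor ((of_int a / of_int b)\<^sup>2) = of_int b / of_int a"
proof -
  have "theta_factor ((of_int a / of_int b)\<^sup>2) = of_int b * theta_factor (of_int a ^ 2)"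
    using theta_factor_scale [of "(of_int a / of_int b)\<^sup>2" b] assms by (simp add: power_divide)
  moreover have "1 = of_int a * theta_factor (of_int a ^ 2)"
    using theta_factor_scale [of 1 a] assms by (simp add: theta_factor_1)
  ultimately show ?thesis using assms by (simp add: field_simps)
qed

lemma has_sum_int_imp_sums:
  fixes f :: "int \<Rightarrow> 'a::banach"
  assumes "(f has_sum S) UNIV"
  shows "(\<lambda>n. f (int (Suc n)) + f (- int (Suc n))) sums (S - f 0)"
proof -
  have sub: "f summable_on A" for A
    using assms summable_on_subset_banach [of f UNIV A] by (auto simp: summable_on_def)
  have 1: "((\<lambda>n. f (int (Suc n))) has_sum infsum f (range (\<lambda>n. int (Suc n)))) UNIV"
    using has_sum_infsum [OF sub [of "range (\<lambda>n. int (Suc n))"]]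
    by (subst (asm) has_sum_reindex) (auto simp: inj_on_def o_def)
  have 2: "((\<lambda>n. f (- int (Suc n))) has_sum infsum f (range (\<lambda>n. - int (Suc n)))) UNIV"
    using has_sum_infsum [OF sub [of "range (\<lambda>n. - int (Suc n))"]]
    by (subst (asm) has_sum_reindex) (auto simp: inj_on_def o_def)
  have un: "UNIV = insert 0 (range (\<lambda>n. int (Suc n)) \<union> range (\<lambda>n. - int (Suc n)))"
  proof (intro set_eqI iffI)
    fix k :: int
    consider "k = 0" | "k > 0" | "k < 0" by linarith
    then show "k \<in> insert 0 (range (\<lambda>n. int (Suc n)) \<union> range (\<lambda>n. - int (Suc n)))"
    proof cases
      case 2
      then have "k = int (Suc (nat (k - 1)))" by simp
      then show ?thesis by blast
    next
      case 3
      then have "k = - int (Suc (nat (- k - 1)))" by simp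
      then show ?thesis by blast
    qed simp
  qed simp
  have "S = infsum f UNIV" using assms by (simp add: infsumI)
  also have "\<dots> = infsum f {0} + infsum f (range (\<lambda>n. int (Suc n)) \<union> range (\<lambda>n. - int (Suc n)))"
    by (subst un, subst insert_is_Un, rule infsum_Un_disjoint [OF sub sub]) auto
  also have "infsum f (range (\<lambda>n. int (Suc n)) \<union> range (\<lambda>n. - int (Suc n)))
      = infsum f (range (\<lambda>n. int (Suc n))) + infsum f (range (\<lambda>n. - int (Suc n)))"
    by (rule infsum_Un_disjoint [OF sub sub]) auto
  finally have "S - f 0 = infsum f (range (\<lambda>n. int (Suc n))) + infsum f (range (\<lambda>n. - int (Suc n)))" by simp
  then show ?thesis using has_sum_imp_sums [OF has_sum_add [OF 1 2]] by simp
qed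

section \<open>Sums over squares in the upper half-plane\<close>

lemma sums_inverse_squares: "(\<lambda>n. 1 / (real n + 1)\<^sup>2) sums (pi\<^sup>2 / 6)"
  using inverse_squares_sums by (simp add: add.commute)

definition square_series :: "(nat \<Rightarrow> complex) \<Rightarrow> complex \<Rightarrow> complex" where
  "square_series c u = (\<Sum>n. c n * e2pi (of_nat (Suc n) ^ 2 * u))"

text \<open>
  Up to the factor \<open>2 \<pi> \<i>\<close> this is the primitive of \<open>square_series c\<close>. Unlike the latter it still converges on
  the real axis, where it represents \<open>phi\<close>.
\<close>

definition square_series_int :: "(nat \<Rightarrow> complex) \<Rightarrow> complex \<Rightarrow> complex" where
  "square_series_int c u = (\<Sum>n. c n / of_nat (Suc n) ^ 2 * e2pi (of_nat (Suc n) ^ 2 * u))"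

lemma norm_e2pi_square: "norm (e2pi (of_nat (Suc n) ^ 2 * u)) = exp (- 2 * pi * real (Suc n) ^ 2 * Im u)"
proof -
  have "of_nat (Suc n) ^ 2 * u = of_real (real (Suc n) ^ 2) * u" by simp
  then have "Im (of_nat (Suc n) ^ 2 * u) = real (Suc n) ^ 2 * Im u"
    by (simp only: times_complex.sel Re_complex_of_real Im_complex_of_real mult_zero_left add_0_right)
  then show ?thesis unfolding norm_e2pi by (simp add: mult.assoc)
qed

lemma norm_e2pi_square_le_1:
  assumes "Im u \<ge> 0"
  shows "norm (e2pi (of_nat (Suc n) ^ 2 * u)) \<le> 1"
  unfolding norm_e2pi_square using assms by simp

lemma norm_e2pi_square_le_geometric:
  assumes "Im u \<ge> y" "y > 0"
  shows "norm (e2pi (of_nat (Suc n) ^ 2 * u)) \<le> exp (- 2 * pi * y) ^ n"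
proof -
  have "real n \<le> real (Suc n) * real (Suc n)" by (simp add: algebra_simps)
  then have "real n * y \<le> real (Suc n) ^ 2 * Im u"
    using assms unfolding power2_eq_square by (intro mult_mono) auto
  then have "2 * pi * (real n * y) \<le> 2 * pi * (real (Suc n) ^ 2 * Im u)"
    by (intro mult_left_mono) auto
  then have "- 2 * pi * real (Suc n) ^ 2 * Im u \<le> real n * (- 2 * pi * y)" by (simp add: algebra_simps)
  then show ?thesis unfolding norm_e2pi_square exp_of_nat_mult [symmetric] by simp
qed

lemma square_series_int_deriv:
  assumes c: "\<And>n. norm (c n) \<le> B" and u: "Im u > 0"
  shows "(square_series_int c has_field_derivative 2 * of_real pi * \<i> * square_series c u) (at u)"
proof -
  define y where "y = Im u / 2"
  have y: "y > 0" "Im u > y" using u by (auto simp: y_def)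
  define r where "r = exp (- 2 * pi * y)"
  have r: "0 < r" "r < 1" using y by (auto simp: r_def)
  have B: "B \<ge> 0" using c [of 0] norm_ge_zero order_trans by blast
  let ?f = "\<lambda>n u. c n / of_nat (Suc n) ^ 2 * e2pi (of_nat (Suc n) ^ 2 * u)"
  let ?f' = "\<lambda>n u. 2 * of_real pi * \<i> * (c n * e2pi (of_nat (Suc n) ^ 2 * u))"
  have geo: "summable (\<lambda>n. B * r ^ n)"
    using r by (intro summable_mult summable_geometric) simp
  have term_le: "norm (c n * e2pi (of_nat (Suc n) ^ 2 * x)) \<le> B * r ^ n" if "Im x \<ge> y" for n x
    unfolding norm_mult r_def using norm_e2pi_square_le_geometric [OF that y(1), of n] c [of n] B
    by (intro mult_mono) auto
  have sum_T: "summable (\<lambda>n. c n * e2pi (of_nat (Suc n) ^ 2 * u))"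
    by (rule summable_comparison_test' [OF geo, of 0]) (use term_le y in auto)
  have "((\<lambda>u. \<Sum>n. ?f n u) has_field_derivative (\<Sum>n. ?f' n u)) (at u)"
  proof (rule has_field_derivative_series' (2))
    show "convex {u. Im u \<ge> y}" by (rule convex_halfspace_Im_ge)
    show "(?f n has_field_derivative ?f' n x) (at x within {u. Im u \<ge> y})" for n x
    proof -
      define m where "m = complex_of_nat (Suc n) ^ 2"
      have m: "m \<noteq> 0" unfolding m_def by (simp del: of_nat_Suc)
      have "((\<lambda>u. e2pi (m * u)) has_field_derivative 2 * of_real pi * \<i> * m * e2pi (m * x)) (at x within {u. Im u \<ge> y})"
        by (auto intro!: derivative_eq_intros)
      from DERIV_cmult [OF this, of "c n / m"] show ?thesis
        unfolding m_def [symmetric] using m by (simp add: mult_ac)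
    qed
    show "uniformly_convergent_on {u. Im u \<ge> y} (\<lambda>n x. \<Sum>i<n. ?f' i x)"
    proof (rule Weierstrass_m_test_ev [THEN uniformly_convergentI])
      show "summable (\<lambda>n. 2 * pi * (B * r ^ n))" by (intro summable_mult geo)
      have "norm (?f' n x) \<le> 2 * pi * (B * r ^ n)" if "Im x \<ge> y" for n x
        using term_le [OF that, of n] unfolding norm_mult [of "2 * of_real pi * \<i>"] by (simp add: norm_mult)
      then show "\<forall>\<^sub>F n in sequentially. \<forall>x\<in>{u. Im u \<ge> y}. norm (?f' n x) \<le> 2 * pi * (B * r ^ n)"
        by auto
    qed
    show "u \<in> {u. Im u \<ge> y}" using y by simp
    have "norm (?f n u) \<le> B * r ^ n" for n
    proof -
      have "norm (?f n u) = norm (c n * e2pi (of_nat (Suc n) ^ 2 * u)) / real (Suc n) ^ 2"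
        by (simp add: norm_mult norm_divide norm_power del: of_nat_Suc)
      also have "\<dots> \<le> norm (c n * e2pi (of_nat (Suc n) ^ 2 * u)) / 1"
        by (intro divide_left_mono) (auto simp: power_increasing one_le_power)
      also have "\<dots> \<le> B * r ^ n" using term_le [of u n] y by simp
      finally show ?thesis .
    qed
    then show "summable (\<lambda>n. ?f n u)" by (intro summable_comparison_test' [OF geo, of 0]) auto
    show "u \<in> interior {u. Im u \<ge> y}"
      by (rule interiorI [OF open_halfspace_Im_gt [of y]]) (use y in auto)
  qed
  moreover have "(\<Sum>n. ?f' n u) = 2 * of_real pi * \<i> * square_series c u"
    unfolding square_series_def by (rule suminf_mult [OF sum_T])
  ultimately show ?thesis unfolding square_series_int_def [abs_def] by simp
qed

lemma square_series_holomorphic: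
  assumes c: "\<And>n. norm (c n) \<le> B"
  shows "square_series c holomorphic_on {u. Im u > 0}"
proof -
  have op: "open {u. Im u > 0}" by (rule open_halfspace_Im_gt)
  have "square_series_int c holomorphic_on {u. Im u > 0}"
    unfolding holomorphic_on_open [OF op] using square_series_int_deriv [of c B, OF c] by blast
  then have "deriv (square_series_int c) holomorphic_on {u. Im u > 0}"
    by (rule holomorphic_deriv [OF _ op])
  from holomorphic_on_divide [OF this holomorphic_on_const, of "2 * of_real pi * \<i>"]
  have "(\<lambda>u. deriv (square_series_int c) u / (2 * of_real pi * \<i>)) holomorphic_on {u. Im u > 0}"
    by simp
  also have "?this \<longleftrightarrow> ?thesis"
  proof (rule holomorphic_cong [OF refl])
    fix u assume "u \<in> {u. Im u > 0}"
    then have "deriv (square_series_int c) u = 2 * of_real pi * \<i> * square_series c u"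
      by (intro DERIV_imp_deriv square_series_int_deriv [OF c]) simp
    then show "deriv (square_series_int c) u / (2 * of_real pi * \<i>) = square_series c u" by simp
  qed
  finally show ?thesis .
qed

lemma norm_square_series_int_term:
  assumes c: "\<And>n. norm (c n) \<le> B" and u: "Im u \<ge> 0"
  shows "norm (c n / of_nat (Suc n) ^ 2 * e2pi (of_nat (Suc n) ^ 2 * u)) \<le> B * (1 / (real n + 1)\<^sup>2)"
proof -
  have B: "B \<ge> 0" using c [of 0] norm_ge_zero order_trans by blast
  have "norm (c n / of_nat (Suc n) ^ 2 * e2pi (of_nat (Suc n) ^ 2 * u))
      = norm (c n) / real (Suc n) ^ 2 * norm (e2pi (of_nat (Suc n) ^ 2 * u))"
    by (simp only: norm_mult norm_divide norm_power norm_of_nat)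
  also have "\<dots> \<le> B / real (Suc n) ^ 2 * 1"
    using c [of n] B by (intro mult_mono divide_right_mono norm_e2pi_square_le_1 u) auto
  finally show ?thesis by (simp add: add.commute)
qed

lemma norm_square_series_int_le:
  assumes c: "\<And>n. norm (c n) \<le> B" and u: "Im u \<ge> 0"
  shows "norm (square_series_int c u) \<le> B * (pi\<^sup>2 / 6)"
proof -
  have s: "(\<lambda>n. B * (1 / (real n + 1)\<^sup>2)) sums (B * (pi\<^sup>2 / 6))"
    by (intro sums_mult sums_inverse_squares)
  have "norm (square_series_int c u) \<le> (\<Sum>n. B * (1 / (real n + 1)\<^sup>2))"
    unfolding square_series_int_def
    by (rule norm_suminf_le [OF norm_square_series_int_term [OF c u] sums_summable [OF s]])
  then show ?thesis using s by (simp add: sums_iff)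
qed

lemma square_series_int_continuous:
  assumes c: "\<And>n. norm (c n) \<le> B"
  shows "continuous_on {u. Im u \<ge> 0} (square_series_int c)"
proof (rule uniform_limit_theorem)
  show "uniform_limit {u. Im u \<ge> 0} (\<lambda>m u. \<Sum>n<m. c n / of_nat (Suc n) ^ 2 * e2pi (of_nat (Suc n) ^ 2 * u))
      (square_series_int c) sequentially"
    unfolding square_series_int_def
  proof (rule Weierstrass_m_test)
    show "summable (\<lambda>n. B * (1 / (real n + 1)\<^sup>2))"
      by (intro summable_mult sums_summable [OF sums_inverse_squares])
    show "norm (c n / of_nat (Suc n) ^ 2 * e2pi (of_nat (Suc n) ^ 2 * u)) \<le> B * (1 / (real n + 1)\<^sup>2)"
      if "u \<in> {u. Im u \<ge> 0}" for n u
      by (rule norm_square_series_int_term [OF c]) (use that in simp)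
  qed
qed (auto intro!: always_eventually continuous_intros simp del: of_nat_Suc)

lemma Im_inversion_pos:
  assumes "q > (0::int)" "Im w > 0"
  shows "Im (- 1 / (4 * of_int q ^ 2 * w)) > 0"
proof -
  have Im_mult: "Im (of_real r * z) = r * Im z" for r z by simp
  have "- 1 / (4 * of_int q ^ 2 * w) = of_real (- (1 / (4 * of_int q ^ 2))) * (1 / w)" by simp
  then have "Im (- 1 / (4 * of_int q ^ 2 * w)) = - (1 / (4 * of_int q ^ 2)) * Im (1 / w)" by (simp only: Im_mult)
  also have "Im (1 / w) = - Im w / (cmod w)\<^sup>2" by (simp add: Im_divide cmod_power2)
  finally have "Im (- 1 / (4 * of_int q ^ 2 * w)) = Im w / (4 * of_int q ^ 2 * (cmod w)\<^sup>2)" by simp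
  moreover have "w \<noteq> 0" using assms(2) by auto
  ultimately show ?thesis using assms by simp
qed

lemma csqrt_argument:
  assumes "Im w > 0"
  shows "- 2 * \<i> * w \<notin> \<real>\<^sub>\<le>\<^sub>0"
  using assms by (auto simp: complex_nonpos_Reals_iff)

text \<open>
  On the imaginary axis this is \<open>theta_rational_shift\<close> with the terms for \<open>k\<close> and \<open>- k\<close> combined, at the heights
  where the inversion factor is known. Both sides are holomorphic in \<open>w\<close>.
\<close>

lemma theta_transformation:
  fixes p q :: int
  assumes q: "q > 0" and cop: "coprime p q" and w: "Im w > 0"
  defines "c \<equiv> (\<lambda>n. e2pi (of_int (p * int (Suc n) ^ 2) / of_int q))"
    and "g \<equiv> (\<lambda>n. gauss_sum p q (int (Suc n)) + gauss_sum p q (- int (Suc n)))"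
  shows "1 + 2 * square_series c w =
    (gauss_sum p q 0 + square_series g (- 1 / (4 * of_int q ^ 2 * w))) / (of_int q * csqrt (- 2 * \<i> * w))"
proof -
  let ?H = "{w. Im w > 0}"
  let ?u = "\<lambda>w. - 1 / (4 * of_int q ^ 2 * w)"
  have normc: "norm (c n) \<le> 1" for n unfolding c_def by (simp only: norm_e2pi_frac order_refl)
  have normg: "norm (g n) \<le> 2 * sqrt (2 * of_int q)" for n
    unfolding g_def by (rule gauss_sum_pair_norm_le [OF q cop])
  have u_im: "Im (?u w) > 0" if "Im w > 0" for w by (rule Im_inversion_pos [OF q that])
  define F where "F w = 1 + 2 * square_series c w -
    (gauss_sum p q 0 + square_series g (?u w)) / (of_int q * csqrt (- 2 * \<i> * w))" for w
  have "(square_series g \<circ> ?u) holomorphic_on ?H"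
  proof (rule holomorphic_on_compose_gen [OF _ square_series_holomorphic [of g, OF normg]])
    show "?u holomorphic_on ?H" using q by (intro holomorphic_intros) auto
    show "?u ` ?H \<subseteq> {u. Im u > 0}" using u_im by blast
  qed
  then have holF: "F holomorphic_on ?H"
    unfolding F_def o_def using q csqrt_argument
    by (intro holomorphic_intros square_series_holomorphic [OF normc]) (auto simp: csqrt_eq_0)
  \<comment> \<open>The points \<open>\<i> s / 2\<close> with \<open>s\<close> a rational square; they accumulate at \<open>\<i> / 2\<close>, which is
    inside the half-plane.\<close>
  define U where "U = {\<i> * of_real ((of_int a / of_int b)\<^sup>2 / 2) | a b :: int. a > 0 \<and> b > 0}"
  have "F w = 0"
  proof (rule analytic_continuation [OF holF])
    show "open ?H" by (rule open_halfspace_Im_gt)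
    show "connected ?H" by (intro convex_connected convex_halfspace_Im_gt)
    show "U \<subseteq> ?H"
    proof
      fix z assume "z \<in> U"
      then obtain a b :: int where "a > 0" "b > 0" "z = \<i> * of_real ((of_int a / of_int b)\<^sup>2 / 2)"
        unfolding U_def by blast
      then have "Im z = (of_int a / of_int b)\<^sup>2 / 2" by (simp only: Im_i_times Re_complex_of_real)
      moreover have "(real_of_int a / of_int b)\<^sup>2 > 0" using \<open>a > 0\<close> \<open>b > 0\<close> by simp
      ultimately show "z \<in> ?H" unfolding mem_Collect_eq by linarith
    qed
    show "\<i> / 2 \<in> ?H" by simp
    show "w \<in> ?H" using w by simp
    show "(\<i> / 2) islimpt U"
      unfolding islimpt_sequential
    proof (intro exI conjI allI)
      let ?x = "\<lambda>n::nat. \<i> * of_real ((of_int (int n + 2) / of_int (int n + 1))\<^sup>2 / 2)"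
      show "?x n \<in> U - {\<i> / 2}" for n
      proof -
        have "?x n \<in> U" unfolding U_def by (intro CollectI exI [of _ "int n + 2"] exI [of _ "int n + 1"]) auto
        moreover have "?x n \<noteq> \<i> / 2"
        proof
          assume "?x n = \<i> / 2"
          then have "Im (?x n) = 1 / 2" by simp
          then have "((real n + 2) / (real n + 1))\<^sup>2 = 1" by simp
          moreover have "1 < ((real n + 2) / (real n + 1))\<^sup>2" by (rule one_less_power) simp_all
          ultimately show False by simp
        qed
        ultimately show ?thesis by simp
      qed
      have "(\<lambda>n. (real_of_int (int n + 2) / of_int (int n + 1))\<^sup>2 / 2) \<longlonglongrightarrow> 1\<^sup>2 / 2"
      proof (intro tendsto_intros)
        have "(\<lambda>n. 1 + 1 / real (Suc n)) \<longlonglongrightarrow> 1 + 0"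
          by (intro tendsto_add tendsto_const LIMSEQ_Suc [OF lim_1_over_n])
        also have "(\<lambda>n. 1 + 1 / real (Suc n)) = (\<lambda>n. real_of_int (int n + 2) / of_int (int n + 1))"
          by (auto simp: field_simps)
        finally show "(\<lambda>n. real_of_int (int n + 2) / of_int (int n + 1)) \<longlonglongrightarrow> 1" by simp
      qed simp
      then have "?x \<longlonglongrightarrow> \<i> * of_real (1\<^sup>2 / 2)"
        by (intro tendsto_mult tendsto_const tendsto_of_real)
      then show "?x \<longlonglongrightarrow> \<i> / 2" by simp
    qed
    fix z assume "z \<in> U"
    then obtain a b :: int where ab: "a > 0" "b > 0" and z: "z = \<i> * of_real ((of_int a / of_int b)\<^sup>2 / 2)"
      unfolding U_def by blast
    define s where "s = (real_of_int a / of_int b)\<^sup>2"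
    have s: "s > 0" using ab by (simp add: s_def)
    have zs: "z = \<i> * of_real (s / 2)" by (simp add: z s_def)
    let ?f = "\<lambda>k::int. gauss_sum p q k * exp (- of_real (pi * (1 / (s * of_int q ^ 2)) * real_of_int k ^ 2))"
    let ?h = "\<lambda>n::int. e2pi (of_int (p * n\<^sup>2) / of_int q) * exp (- of_real (pi * s * real_of_int n ^ 2))"
    obtain S where S: "(?f has_sum S) UNIV" "(?h has_sum (theta_factor (s * of_int q ^ 2) * S)) UNIV"
      using theta_rational_shift [OF s q, of p] by blast
    have e_h: "exp (- of_real (pi * s * real (Suc n) ^ 2)) = e2pi (of_nat (Suc n) ^ 2 * z)" for n
      unfolding e2pi_def zs by (rule arg_cong [where f = exp]) (simp add: mult_ac)
    have e_f: "exp (- of_real (pi * (1 / (s * of_int q ^ 2)) * real (Suc n) ^ 2)) = e2pi (of_nat (Suc n) ^ 2 * ?u z)" for n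
      unfolding e2pi_def zs using s q by (intro arg_cong [where f = exp]) (simp add: field_simps del: of_nat_Suc)
    have "(\<lambda>n. ?h (int (Suc n)) + ?h (- int (Suc n))) sums (theta_factor (s * of_int q ^ 2) * S - ?h 0)"
      by (rule has_sum_int_imp_sums [OF S(2)])
    moreover have "?h (int (Suc n)) + ?h (- int (Suc n)) = 2 * (c n * e2pi (of_nat (Suc n) ^ 2 * z))" for n
      unfolding e_h [symmetric] c_def by (simp del: of_nat_Suc)
    ultimately have "(\<lambda>n. 2 * (c n * e2pi (of_nat (Suc n) ^ 2 * z))) sums (theta_factor (s * of_int q ^ 2) * S - 1)"
      by (simp del: of_nat_Suc)
    from sums_divide [OF this, of 2] have "square_series c z = (theta_factor (s * of_int q ^ 2) * S - 1) / 2"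
      unfolding square_series_def by (simp add: sums_iff del: of_nat_Suc)
    then have 1: "1 + 2 * square_series c z = theta_factor (s * of_int q ^ 2) * S"
      by (simp add: field_simps)
    have "(\<lambda>n. ?f (int (Suc n)) + ?f (- int (Suc n))) sums (S - ?f 0)"
      by (rule has_sum_int_imp_sums [OF S(1)])
    moreover have "?f (int (Suc n)) + ?f (- int (Suc n)) = g n * e2pi (of_nat (Suc n) ^ 2 * ?u z)" for n
      unfolding e_f [symmetric] g_def by (simp add: distrib_right del: of_nat_Suc)
    ultimately have "(\<lambda>n. g n * e2pi (of_nat (Suc n) ^ 2 * ?u z)) sums (S - gauss_sum p q 0)"
      by (simp del: of_nat_Suc)
    then have 2: "S = gauss_sum p q 0 + square_series g (?u z)"
      unfolding square_series_def by (simp add: sums_iff del: of_nat_Suc)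
    have "s * of_int q ^ 2 = (of_int (a * q) / of_int b)\<^sup>2"
      unfolding s_def by (simp add: power_mult_distrib power_divide)
    then have "theta_factor (s * of_int q ^ 2) = of_int b / of_int (a * q)"
      using theta_factor_rational_square [of "a * q" b] ab q by simp
    moreover have "csqrt (- 2 * \<i> * z) = of_int a / of_int b"
    proof -
      have "- 2 * \<i> * z = of_real s" unfolding zs by simp
      moreover have "csqrt (of_real s) = of_real (sqrt s)" using s by (subst csqrt_of_real_nonneg) auto
      moreover have "sqrt s = of_int a / of_int b" using ab by (simp add: s_def)
      ultimately show ?thesis by simp
    qed
    ultimately have 3: "theta_factor (s * of_int q ^ 2) = 1 / (of_int q * csqrt (- 2 * \<i> * z))"
      by (simp add: mult.commute)
    show "F z = 0" unfolding F_def 1 3 using 2 by simp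
  qed
  then show ?thesis unfolding F_def by simp
qed

section \<open>Expansion of the function at rational points\<close>

lemma phi_eq_square_series_int:
  "phi (r + h) = square_series_int (\<lambda>n. e2pi (of_real (r * real (Suc n) ^ 2))) (of_real h) / (2 * of_real pi * \<i>)"
proof -
  have "1 / (2 * of_real pi * \<i> * of_nat (Suc n) ^ 2) * exp (2 * of_real pi * \<i> * of_nat (Suc n) ^ 2 * of_real (r + h))
     = e2pi (of_real (r * real (Suc n) ^ 2)) / of_nat (Suc n) ^ 2 * e2pi (of_nat (Suc n) ^ 2 * of_real h) / (2 * of_real pi * \<i>)" for n
  proof -
    have "exp (2 * of_real pi * \<i> * of_nat (Suc n) ^ 2 * of_real (r + h)) =
       e2pi (of_real (r * real (Suc n) ^ 2)) * e2pi (of_nat (Suc n) ^ 2 * of_real h)"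
      unfolding e2pi_def exp_add [symmetric] by (rule arg_cong [where f = exp]) (simp add: algebra_simps)
    then show ?thesis by (simp only: times_divide_eq_left times_divide_eq_right mult_1 divide_divide_eq_left mult.commute)
  qed
  moreover have "summable (\<lambda>n. e2pi (of_real (r * real (Suc n) ^ 2)) / of_nat (Suc n) ^ 2 * e2pi (of_nat (Suc n) ^ 2 * of_real h))"
  proof (rule summable_comparison_test' [of "\<lambda>n. 1 * (1 / (real n + 1)\<^sup>2)" 0])
    show "summable (\<lambda>n. 1 * (1 / (real n + 1)\<^sup>2))"
      by (intro summable_mult sums_summable [OF sums_inverse_squares])
    show "norm (e2pi (of_real (r * real (Suc n) ^ 2)) / of_nat (Suc n) ^ 2 * e2pi (of_nat (Suc n) ^ 2 * of_real h))
        \<le> 1 * (1 / (real n + 1)\<^sup>2)" for n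
      by (rule norm_square_series_int_term [where c = "\<lambda>n. e2pi (of_real (r * real (Suc n) ^ 2))"])
         (simp only: norm_e2pi_of_real order_refl, simp)
  qed
  ultimately show ?thesis
    unfolding phi_def square_series_int_def by (simp only: suminf_divide)
qed

lemma phi_continuous: "continuous_on UNIV phi"
proof -
  have "continuous_on UNIV (\<lambda>h. square_series_int (\<lambda>n. e2pi (of_real (0 * real (Suc n) ^ 2))) (of_real h) / (2 * of_real pi * \<i>))"
    by (intro continuous_intros continuous_on_compose2 [OF square_series_int_continuous [where B = 1]])
       (auto simp del: of_real_mult)
  then show ?thesis using phi_eq_square_series_int [of 0] by simp
qed

text \<open>
  The expansion at height \<open>y\<close> above the real axis, where the series for the derivative converges. The bound
  stays finite as \<open>y\<close> tends to \<open>0\<close>, which yields the expansion on the real axis.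
\<close>

lemma phi_expansion_upper:
  fixes p q :: int
  assumes q: "q > 0" and cop: "coprime p q" and y: "y > 0"
  defines "c \<equiv> (\<lambda>n. e2pi (of_int (p * int (Suc n) ^ 2) / of_int q))"
  defines "A \<equiv> (\<lambda>w. square_series_int c w / (2 * of_real pi * \<i>))"
    and "S \<equiv> (\<lambda>w. csqrt (- 2 * \<i> * w))"
    and "z \<equiv> \<i> * of_real y"
  shows "norm (A (of_real h + z) - A z + of_real h / 2
           - \<i> * gauss_sum p q 0 / (2 * of_int q) * (S (of_real h + z) - S z))
         \<le> 2 * pi * sqrt (of_int q * (\<bar>h\<bar> + y)) ^ 3"
proof -
  define g where "g n = gauss_sum p q (int (Suc n)) + gauss_sum p q (- int (Suc n))" for n
  define u where "u w = - 1 / (4 * of_int q ^ 2 * w)" for w :: complex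
  \<comment> \<open>\<open>E\<close> is, up to sign, the boundary term of the integration by parts of the oscillating terms: its derivative
    contains \<open>- square_series g (u w) / (2 q S w)\<close>, which cancels them.\<close>
  define E where "E w = of_int q / (4 * of_real pi * \<i>) * (S w ^ 3 * square_series_int g (u w))" for w
  \<comment> \<open>Removing from \<open>A\<close> all that can be integrated in closed form leaves \<open>B\<close>, whose derivative is only
    of size \<open>q^(3/2) \<bar>w\<bar>^(1/2)\<close>.\<close>
  define B where "B w = A w + w / 2 - \<i> * gauss_sum p q 0 / (2 * of_int q) * S w + E w" for w
  define M where "M = \<bar>h\<bar> + y"
  define X where "X = sqrt (of_int q * M)"
  have M: "M > 0" using y by (simp add: M_def)
  have X: "X > 0" "X\<^sup>2 = of_int q * M" using M q by (auto simp: X_def)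
  have normc: "norm (c n) \<le> 1" for n unfolding c_def by (simp only: norm_e2pi_frac order_refl)
  have normg: "norm (g n) \<le> 2 * sqrt (2 * of_int q)" for n
    unfolding g_def by (rule gauss_sum_pair_norm_le [OF q cop])
  have u_im: "Im (u w) > 0" if "Im w > 0" for w unfolding u_def by (rule Im_inversion_pos [OF q that])
  have S_sq: "S w ^ 2 = - 2 * \<i> * w" for w by (simp add: S_def)
  have normS: "norm (S w) \<le> sqrt (2 * M)" if "norm w \<le> M" for w
    unfolding S_def norm_csqrt using that by (simp add: norm_mult)
  define D where "D = square_series_int g"
  have normD: "norm (D (u w)) \<le> 2 * sqrt (2 * of_int q) * (pi\<^sup>2 / 6)" if "Im w > 0" for w
    unfolding D_def by (rule norm_square_series_int_le [OF normg]) (use u_im [OF that] in simp)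
  have deriv: "(B has_field_derivative - (3 * of_int q / (4 * of_real pi)) * S w * D (u w)) (at w)"
    if w: "Im w > 0" for w
  proof -
    let ?T = "square_series g (u w)"
    have w0: "w \<noteq> 0" using w by auto
    have q0: "complex_of_int q \<noteq> 0" using q by simp
    have S0: "S w \<noteq> 0" using w0 S_sq [of w] by auto
    have dS: "(S has_field_derivative - \<i> / S w) (at w)"
      unfolding S_def [abs_def] using csqrt_argument [OF w]
      by (auto intro!: derivative_eq_intros)
    have du: "(u has_field_derivative 1 / (4 * of_int q ^ 2 * w\<^sup>2)) (at w)"
      unfolding u_def [abs_def] using w0 q0
      by (auto intro!: derivative_eq_intros simp: power2_eq_square field_simps)
    have dA: "(A has_field_derivative square_series c w) (at w)"
      using DERIV_cdivide [OF square_series_int_deriv [OF normc w], where c = "2 * of_real pi * \<i>"]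
      unfolding A_def by simp
    have dD: "((\<lambda>w. D (u w)) has_field_derivative 2 * of_real pi * \<i> * ?T * (1 / (4 * of_int q ^ 2 * w\<^sup>2))) (at w)"
      unfolding D_def by (rule DERIV_chain2 [OF square_series_int_deriv [OF normg u_im [OF w]] du])
    have d0: "(B has_field_derivative (square_series c w + 1 / 2 - \<i> * gauss_sum p q 0 / (2 * of_int q) * (- \<i> / S w)
       + of_int q / (4 * of_real pi * \<i>) * (3 * S w ^ 2 * (- \<i> / S w) * D (u w)
           + S w ^ 3 * (2 * of_real pi * \<i> * ?T * (1 / (4 * of_int q ^ 2 * w\<^sup>2)))))) (at w)"
      unfolding B_def [abs_def] E_def [abs_def] D_def [symmetric]
      by (rule DERIV_add [OF DERIV_diff [OF DERIV_add [OF dA DERIV_cdivide [OF DERIV_ident]] DERIV_cmult [OF dS]]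
            DERIV_cmult [OF DERIV_mult [OF DERIV_power [OF dS] dD]], THEN DERIV_cong])
         (simp add: mult_ac)
    have e1: "square_series c w = ((gauss_sum p q 0 + ?T) / (of_int q * S w) - 1) / 2"
    proof -
      have "1 + 2 * square_series c w = (gauss_sum p q 0 + ?T) / (of_int q * S w)"
        using theta_transformation [OF q cop w] unfolding c_def g_def [abs_def] u_def S_def .
      then show ?thesis by (simp add: eq_divide_eq algebra_simps)
    qed
    have e2: "S w ^ 3 * (2 * of_real pi * \<i> * ?T * (1 / (4 * of_int q ^ 2 * w\<^sup>2)))
        = - (2 * of_real pi * \<i> * ?T) / (of_int q ^ 2 * S w)"
    proof -
      have "S w ^ 4 = (S w ^ 2) ^ 2" by simp
      also have "\<dots> = - 4 * w\<^sup>2" unfolding S_sq by (simp add: power_mult_distrib)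
      finally have "S w ^ 3 * S w = - 4 * w\<^sup>2" by (simp add: power_numeral_reduce mult_ac)
      then have *: "S w ^ 3 * (1 / (4 * of_int q ^ 2 * w\<^sup>2)) = - 1 / (of_int q ^ 2 * S w)"
        using S0 w0 q0 by (simp add: field_simps)
      have "S w ^ 3 * (2 * of_real pi * \<i> * ?T * (1 / (4 * of_int q ^ 2 * w\<^sup>2)))
          = (2 * of_real pi * \<i> * ?T) * (S w ^ 3 * (1 / (4 * of_int q ^ 2 * w\<^sup>2)))" by (rule mult.left_commute)
      also have "\<dots> = (2 * of_real pi * \<i> * ?T) * (- 1 / (of_int q ^ 2 * S w))" by (simp only: *)
      finally show ?thesis by (simp only: times_divide_eq_right mult_minus_right mult_1_right)
    qed
    have e3: "3 * S w ^ 2 * (- \<i> / S w) = - 3 * \<i> * S w" using S0 by (simp add: power2_eq_square)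
    have e4: "((G + T) / (Q * s) - 1) / 2 + 1 / 2 - \<i> * G / (2 * Q) * (- \<i> / s)
       + Q / (4 * P * \<i>) * (- 3 * \<i> * s * d + - (2 * P * \<i> * T) / (Q ^ 2 * s)) = - (3 * Q / (4 * P)) * s * d"
      if "Q \<noteq> 0" "s \<noteq> 0" "P \<noteq> 0" for G T Q s P d :: complex
      using that by (simp add: field_simps power2_eq_square)
    show ?thesis
      by (rule DERIV_cong [OF d0 [unfolded e1 e2 e3]], rule e4) (use q0 S0 in auto)
  qed
  have in_strip: "Im w > 0 \<and> norm w \<le> M" if "w \<in> closed_segment z (of_real h + z)" for w
  proof -
    from that obtain t where t: "0 \<le> t" "t \<le> 1" "w = (1 - t) *\<^sub>R z + t *\<^sub>R (of_real h + z)"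
      unfolding in_segment(1) by (elim exE conjE)
    have w: "w = of_real (t * h) + \<i> * of_real y"
      unfolding t(3) z_def scaleR_conv_of_real by (simp add: ring_distribs)
    have "norm w \<le> norm (complex_of_real (t * h)) + norm (\<i> * complex_of_real y)"
      unfolding w by (rule norm_triangle_ineq)
    also have "\<dots> = t * \<bar>h\<bar> + y" using t(1) y by (simp add: abs_mult norm_mult)
    also have "t * \<bar>h\<bar> \<le> 1 * \<bar>h\<bar>" using t(2) by (rule mult_right_mono) simp
    finally have "norm w \<le> M" by (simp add: M_def)
    moreover have "Im w = y" unfolding w by simp
    ultimately show ?thesis using y by simp
  qed
  have sM: "sqrt (2 * M) * sqrt (2 * of_int q) = 2 * X"
  proof -
    have "sqrt (2 * M) * sqrt (2 * of_int q) = sqrt (2\<^sup>2 * (of_int q * M))"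
      unfolding real_sqrt_mult [symmetric] by (rule arg_cong [where f = sqrt]) simp
    also have "\<dots> = 2 * X" unfolding X_def real_sqrt_mult [of "2\<^sup>2"] by simp
    finally show ?thesis .
  qed
  have bound: "norm (B (of_real h + z) - B z) \<le> pi / 2 * X ^ 3"
  proof -
    have "norm (B (of_real h + z) - B z) \<le> (pi / 2 * (of_int q * X)) * norm (of_real h + z - z)"
    proof (rule field_differentiable_bound)
      show "convex (closed_segment z (of_real h + z))" by simp
      fix w assume w: "w \<in> closed_segment z (of_real h + z)"
      show "(B has_field_derivative - (3 * of_int q / (4 * of_real pi)) * S w * D (u w)) (at w within closed_segment z (of_real h + z))"
        using deriv in_strip [OF w] has_field_derivative_at_within by blast
      have "norm (- (3 * of_int q / (4 * of_real pi)) * S w * D (u w))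
          = 3 * of_int q / (4 * pi) * (norm (S w) * norm (D (u w)))"
        using q by (simp add: norm_mult norm_divide)
      also have "\<dots> \<le> 3 * of_int q / (4 * pi) * (sqrt (2 * M) * (2 * sqrt (2 * of_int q) * (pi\<^sup>2 / 6)))"
        using in_strip [OF w] q M by (intro mult_left_mono mult_mono normS normD) auto
      also have "\<dots> = of_int q * pi / 4 * (sqrt (2 * M) * sqrt (2 * of_int q))"
        by (simp add: power2_eq_square)
      also have "\<dots> = pi / 2 * (of_int q * X)" unfolding sM by simp
      finally show "norm (- (3 * of_int q / (4 * of_real pi)) * S w * D (u w)) \<le> pi / 2 * (of_int q * X)" .
    qed auto
    also have "\<dots> \<le> (pi / 2 * (of_int q * X)) * M"
      using q X y unfolding M_def by (intro mult_left_mono) auto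
    also have "\<dots> = pi / 2 * X ^ 3"
    proof -
      have "X ^ 3 = X * X\<^sup>2" by (simp add: power3_eq_cube power2_eq_square)
      then show ?thesis unfolding X(2) by simp
    qed
    finally show ?thesis .
  qed
  have E_le: "norm (E w) \<le> pi / 3 * X ^ 3" if "Im w > 0" "norm w \<le> M" for w
  proof -
    have "norm (E w) = of_int q / (4 * pi) * (norm (S w) ^ 3 * norm (D (u w)))"
      unfolding E_def D_def using q by (simp add: norm_mult norm_divide norm_power)
    also have "\<dots> \<le> of_int q / (4 * pi) * (sqrt (2 * M) ^ 3 * (2 * sqrt (2 * of_int q) * (pi\<^sup>2 / 6)))"
      using that q M by (intro mult_left_mono mult_mono power_mono normS normD) auto
    also have "\<dots> = pi / 3 * X ^ 3"
    proof -
      have "sqrt (2 * M) ^ 3 = (sqrt (2 * M))\<^sup>2 * sqrt (2 * M)" by (simp add: power3_eq_cube power2_eq_square)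
      also have "(sqrt (2 * M))\<^sup>2 = 2 * M" using M by simp
      finally have "of_int q / (4 * pi) * (sqrt (2 * M) ^ 3 * (2 * sqrt (2 * of_int q) * (pi\<^sup>2 / 6)))
         = pi / 6 * (of_int q * M) * (sqrt (2 * M) * sqrt (2 * of_int q))"
        by (simp add: power2_eq_square)
      also have "\<dots> = pi / 3 * (X\<^sup>2 * X)" unfolding sM X(2) by simp
      finally show ?thesis by (simp add: power3_eq_cube power2_eq_square)
    qed
    finally show ?thesis .
  qed
  have ends: "z \<in> closed_segment z (of_real h + z)" "of_real h + z \<in> closed_segment z (of_real h + z)" by auto
  have "A (of_real h + z) - A z + of_real h / 2
           - \<i> * gauss_sum p q 0 / (2 * of_int q) * (S (of_real h + z) - S z)
       = (B (of_real h + z) - B z) - E (of_real h + z) + E z"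
    unfolding B_def by (simp add: algebra_simps add_divide_distrib diff_divide_distrib)
  also have "norm \<dots> \<le> pi / 2 * X ^ 3 + pi / 3 * X ^ 3 + pi / 3 * X ^ 3"
  proof -
    have "norm (a - b + c) \<le> norm a + norm b + norm c" for a b c :: complex
      using norm_triangle_ineq [of "a - b" c] norm_triangle_ineq4 [of a b] by linarith
    then show ?thesis
      using bound E_le [of z] E_le [of "of_real h + z"] in_strip [OF ends(1)] in_strip [OF ends(2)]
      by (meson add_mono order_trans)
  qed
  also have "\<dots> \<le> 2 * pi * X ^ 3"
  proof -
    have "pi / 2 * X ^ 3 + pi / 3 * X ^ 3 + pi / 3 * X ^ 3 = 7 / 6 * (pi * X ^ 3)" by simp
    also have "\<dots> \<le> 2 * (pi * X ^ 3)" using X by (intro mult_right_mono) auto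
    finally show ?thesis by simp
  qed
  finally show ?thesis unfolding X_def M_def .
qed

text \<open>
  Let the height \<open>y\<close> tend to \<open>0\<close>. The point \<open>h = 0\<close> is set aside because there the argument of the square
  root tends to the branch point.
\<close>

lemma phi_expansion_rational:
  fixes p q :: int
  assumes q: "q > 0" and cop: "coprime p q"
  shows "norm (phi (of_int p / of_int q + h) - phi (of_int p / of_int q) + of_real h / 2
           - \<i> * gauss_sum p q 0 / (2 * of_int q) * csqrt (- 2 * \<i> * of_real h))
         \<le> 2 * pi * sqrt (of_int q * \<bar>h\<bar>) ^ 3"
proof (cases "h = 0")
  case False
  define c where "c = (\<lambda>n. e2pi (of_int (p * int (Suc n) ^ 2) / of_int q))"
  define A where "A = (\<lambda>w. square_series_int c w / (2 * of_real pi * \<i>))"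
  define S where "S = (\<lambda>w. csqrt (- 2 * \<i> * w))"
  define C where "C = \<i> * gauss_sum p q 0 / (2 * of_int q)"
  define L where "L y = norm (A (of_real h + \<i> * of_real y) - A (\<i> * of_real y) + of_real h / 2
           - C * (S (of_real h + \<i> * of_real y) - of_real (sqrt (2 * y))))" for y
  define U where "U y = 2 * pi * sqrt (of_int q * (\<bar>h\<bar> + y)) ^ 3" for y
  have c_eq: "c = (\<lambda>n. e2pi (of_real (of_int p / of_int q * real (Suc n) ^ 2)))"
    unfolding c_def by simp
  have normc: "norm (c n) \<le> 1" for n unfolding c_eq by (simp only: norm_e2pi_of_real)
  have A_phi: "A (of_real h) = phi (of_int p / of_int q + h)" for h
    unfolding A_def c_eq phi_eq_square_series_int ..
  have contA: "continuous_on {u. Im u \<ge> 0} A"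
    unfolding A_def using square_series_int_continuous [of c 1, OF normc]
    by (intro continuous_intros) auto
  have "continuous_on {0..} L"
    unfolding L_def S_def
  proof (intro continuous_intros)
    show "continuous_on {0..} (\<lambda>y. A (of_real h + \<i> * of_real y))"
      by (rule continuous_on_compose2 [OF contA]) (auto intro!: continuous_intros)
    show "continuous_on {0..} (\<lambda>y. A (\<i> * of_real y))"
      by (rule continuous_on_compose2 [OF contA]) (auto intro!: continuous_intros)
    show "continuous_on {0..} (\<lambda>y. csqrt (- 2 * \<i> * (of_real h + \<i> * of_real y)))"
      by (rule continuous_on_compose2 [OF continuous_on_csqrt])
         (use False in \<open>auto intro!: continuous_intros simp: complex_nonpos_Reals_iff\<close>)
  qed
  then have "(L \<longlongrightarrow> L 0) (at 0 within {0..})"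
    unfolding continuous_on_def by (rule bspec) simp
  then have limL: "(L \<longlongrightarrow> L 0) (at_right 0)" by (rule tendsto_within_subset) auto
  have "continuous_on {0..} U" unfolding U_def by (intro continuous_intros)
  then have "(U \<longlongrightarrow> U 0) (at 0 within {0..})"
    unfolding continuous_on_def by (rule bspec) simp
  then have limU: "(U \<longlongrightarrow> U 0) (at_right 0)" by (rule tendsto_within_subset) auto
  have "L y \<le> U y" if "y > 0" for y
  proof -
    have "S (\<i> * of_real y) = of_real (sqrt (2 * y))"
    proof -
      have "- 2 * \<i> * (\<i> * complex_of_real y) = of_real (2 * y)" by simp
      then show ?thesis
        unfolding S_def using that by (simp only: csqrt_of_real_nonneg Im_complex_of_real Re_complex_of_real)
    qed
    moreover have "norm (A (of_real h + \<i> * of_real y) - A (\<i> * of_real y) + of_real h / 2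
           - C * (S (of_real h + \<i> * of_real y) - S (\<i> * of_real y))) \<le> U y"
      using phi_expansion_upper [OF q cop that, of h] unfolding U_def A_def c_def S_def C_def .
    ultimately show ?thesis unfolding L_def by (simp only:)
  qed
  then have "\<forall>\<^sub>F y in at_right 0. L y \<le> U y"
    unfolding eventually_at_right_field by (intro exI [of _ 1]) auto
  from tendsto_le [OF trivial_limit_at_right_real limU limL this] have "L 0 \<le> U 0" .
  then show ?thesis
    using A_phi [of h] A_phi [of 0] unfolding L_def U_def S_def C_def by simp
qed simp

section \<open>Approximation by convergents\<close>

lemma cf_den_mono:
  assumes "x \<notin> \<rat>"
  shows "cf_den x n \<le> cf_den x (Suc n)"
proof (cases n)
  case 0
  then show ?thesis using cf_coeff_pos [OF assms, of 0] by simp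
next
  case (Suc m)
  have "1 * cf_den x (Suc m) \<le> cf_coeff x (Suc (Suc m)) * cf_den x (Suc m)"
    using cf_coeff_pos [OF assms, of "Suc m"] cf_den_pos [OF assms, of "Suc m"] by (intro mult_right_mono) auto
  then show ?thesis using Suc cf_den_pos [OF assms, of m] by simp
qed

lemma cf_quot_gt_1:
  assumes "x \<notin> \<rat>"
  shows "cf_quot x (Suc n) > 1"
proof -
  have "cf_quot x n \<notin> \<int>" using cf_quot_irrational [OF assms] Ints_subset_Rats by blast
  then have "frac (cf_quot x n) > 0" by (simp add: frac_gt_0_iff)
  then show ?thesis using frac_lt_1 [of "cf_quot x n"] by simp
qed

lemma cf_quot_rec:
  assumes "x \<notin> \<rat>"
  shows "cf_quot x (Suc n) * cf_quot x n = cf_quot x (Suc n) * of_int (cf_coeff x n) + 1"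
proof -
  have "frac (cf_quot x n) \<noteq> 0"
  proof
    assume "frac (cf_quot x n) = 0"
    then have "cf_quot x (Suc n) = 0" by (simp only: cf_quot.simps div_by_0)
    then show False using cf_quot_gt_1 [OF assms, of n] by linarith
  qed
  moreover have "cf_quot x n = of_int (cf_coeff x n) + frac (cf_quot x n)"
    by (simp add: frac_def cf_coeff_def)
  ultimately show ?thesis by (simp add: field_simps)
qed

text \<open>
  The usual representation of \<open>x\<close> by a complete quotient and two convergents, cleared of denominators.
\<close>

lemma cf_quot_identity:
  assumes "x \<notin> \<rat>"
  shows "x * (cf_quot x (n + 2) * of_int (cf_den x (Suc n)) + of_int (cf_den x n))
    = cf_quot x (n + 2) * of_int (cf_num x (Suc n)) + of_int (cf_num x n)"
proof (induction n)
  case 0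
  define a where "a = real_of_int (cf_coeff x 0)"
  define b where "b = real_of_int (cf_coeff x 1)"
  define X where "X = cf_quot x 1"
  define Y where "Y = cf_quot x 2"
  have 1: "X * x = X * a + 1" using cf_quot_rec [OF assms, of 0] by (simp add: X_def a_def)
  have 2: "Y * X = Y * b + 1"
    using cf_quot_rec [OF assms, of 1] unfolding X_def Y_def b_def by (simp add: numeral_2_eq_2)
  have "x * (Y * b + 1) = Y * (X * x)" unfolding 2 [symmetric] by simp
  also have "\<dots> = a * (Y * X) + Y" unfolding 1 by (simp add: algebra_simps)
  also have "\<dots> = Y * (b * a + 1) + a" unfolding 2 by (simp add: algebra_simps)
  finally show ?case unfolding Y_def a_def b_def by (simp add: numeral_2_eq_2)
next
  case (Suc n)
  define c where "c = real_of_int (cf_coeff x (Suc (Suc n)))"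
  define X where "X = cf_quot x (n + 2)"
  define Y where "Y = cf_quot x (n + 3)"
  define q0 where "q0 = real_of_int (cf_den x n)"
  define q1 where "q1 = real_of_int (cf_den x (Suc n))"
  define p0 where "p0 = real_of_int (cf_num x n)"
  define p1 where "p1 = real_of_int (cf_num x (Suc n))"
  have rec: "Y * X = Y * c + 1"
    using cf_quot_rec [OF assms, of "n + 2"] unfolding X_def Y_def c_def by (simp add: numeral_3_eq_3 numeral_2_eq_2)
  have IH: "x * (X * q1 + q0) = X * p1 + p0"
    using Suc.IH unfolding X_def q0_def q1_def p0_def p1_def .
  have "x * (Y * (c * q1 + q0) + q1) = x * (q1 * (Y * c + 1) + Y * q0)" by (simp add: algebra_simps)
  also have "\<dots> = Y * (x * (X * q1 + q0))" unfolding rec [symmetric] by (simp add: algebra_simps)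
  also have "\<dots> = p1 * (Y * X) + Y * p0" unfolding IH by (simp add: algebra_simps)
  also have "\<dots> = Y * (c * p1 + p0) + p1" unfolding rec by (simp add: algebra_simps)
  finally show ?case
    unfolding Y_def c_def q0_def q1_def p0_def p1_def by (simp add: numeral_3_eq_3)
qed

text \<open>
  Combining the determinant formula with the previous identity gives
  \<open>\<bar>x q\<^sub>n - p\<^sub>n\<bar> (X q\<^sub>n\<^sub>+\<^sub>1 + q\<^sub>n) = X\<close>, where \<open>X\<close> is the complete quotient.
\<close>

lemma cf_conv_error:
  assumes "x \<notin> \<rat>"
  shows "\<bar>x - cf_conv x n\<bar> \<le> 1 / (of_int (cf_den x n) * of_int (cf_den x (Suc n)))"
proof -
  define q0 where "q0 = real_of_int (cf_den x n)"
  define q1 where "q1 = real_of_int (cf_den x (Suc n))"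
  define p0 where "p0 = real_of_int (cf_num x n)"
  define p1 where "p1 = real_of_int (cf_num x (Suc n))"
  define X where "X = cf_quot x (n + 2)"
  have X: "X > 1" using cf_quot_gt_1 [OF assms, of "Suc n"] by (simp add: X_def numeral_2_eq_2)
  have q: "q0 \<ge> 1" "q1 \<ge> 1" using cf_den_pos [OF assms] by (auto simp: q0_def q1_def)
  have id: "x * (X * q1 + q0) = X * p1 + p0"
    using cf_quot_identity [OF assms, of n] unfolding X_def q0_def q1_def p0_def p1_def .
  have "real_of_int (cf_num x (Suc n) * cf_den x n - cf_num x n * cf_den x (Suc n)) = (-1) ^ n"
    unfolding cf_determinant by simp
  then have det: "p1 * q0 - p0 * q1 = (-1) ^ n" by (simp add: q0_def q1_def p0_def p1_def)
  have "(x * q0 - p0) * (X * q1 + q0) = q0 * (x * (X * q1 + q0)) - p0 * (X * q1 + q0)"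
    by (simp add: algebra_simps)
  also have "\<dots> = X * (p1 * q0 - p0 * q1)" unfolding id by (simp add: algebra_simps)
  finally have "\<bar>(x * q0 - p0) * (X * q1 + q0)\<bar> = \<bar>X * (-1) ^ n\<bar>" unfolding det by simp
  then have eq: "\<bar>x * q0 - p0\<bar> * (X * q1 + q0) = X" using X q by (simp add: abs_mult)
  have "\<bar>x * q0 - p0\<bar> * (X * q1) \<le> \<bar>x * q0 - p0\<bar> * (X * q1 + q0)"
    using q by (intro mult_left_mono) auto
  then have "X * (\<bar>x * q0 - p0\<bar> * q1) \<le> X * 1" unfolding eq by (simp add: mult_ac)
  then have e: "\<bar>x * q0 - p0\<bar> * q1 \<le> 1" using X by simp
  have "\<bar>x - cf_conv x n\<bar> = \<bar>x * q0 - p0\<bar> / q0"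
  proof -
    have "x - cf_conv x n = (x * q0 - p0) / q0"
      using q unfolding cf_conv_def q0_def p0_def by (simp add: field_simps)
    then show ?thesis using q by (simp add: abs_divide)
  qed
  also have "\<dots> \<le> (1 / q1) / q0"
    using e q by (intro divide_right_mono) (auto simp: field_simps)
  finally show ?thesis by (simp add: q0_def q1_def mult.commute)
qed

lemma cf_conv_nonzero:
  assumes "x \<notin> \<rat>"
  shows "x - cf_conv x n \<noteq> 0"
proof -
  have "cf_conv x n \<in> \<rat>" by (simp add: cf_conv_def)
  then show ?thesis using assms by auto
qed

lemma cf_conv_error_square:
  assumes "x \<notin> \<rat>"
  shows "\<bar>x - cf_conv x n\<bar> * of_int (cf_den x n) ^ 2 \<le> 1"
proof -
  define q0 where "q0 = real_of_int (cf_den x n)"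
  define q1 where "q1 = real_of_int (cf_den x (Suc n))"
  have q: "1 \<le> q0" "q0 \<le> q1" using cf_den_pos [OF assms] cf_den_mono [OF assms] by (auto simp: q0_def q1_def)
  have "\<bar>x - cf_conv x n\<bar> * (q0 * q0) \<le> 1 / (q0 * q1) * (q0 * q1)"
    using cf_conv_error [OF assms, of n] q unfolding q0_def [symmetric] q1_def [symmetric]
    by (intro mult_mono) auto
  also have "\<dots> = 1" using q by simp
  finally show ?thesis by (simp add: q0_def power2_eq_square)
qed

lemma cf_conv_tendsto:
  assumes "x \<notin> \<rat>"
  shows "(\<lambda>n. \<bar>x - cf_conv x n\<bar>) \<longlonglongrightarrow> 0"
proof (rule tendsto_sandwich [OF _ _ tendsto_const LIMSEQ_Suc [OF lim_1_over_n]])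
  show "\<forall>\<^sub>F n in sequentially. \<bar>x - cf_conv x n\<bar> \<le> 1 / real (Suc n)"
  proof (intro always_eventually allI)
    fix n
    have "1 \<le> real_of_int (cf_den x n)" using cf_den_pos [OF assms, of n] by simp
    moreover have "real (Suc n) \<le> real_of_int (cf_den x (Suc n))"
      using cf_den_ge [OF assms, of "Suc n"] by (metis of_int_le_iff of_int_of_nat_eq)
    ultimately have "1 * real (Suc n) \<le> real_of_int (cf_den x n) * real_of_int (cf_den x (Suc n))"
      by (intro mult_mono) auto
    then have "1 / (real_of_int (cf_den x n) * real_of_int (cf_den x (Suc n))) \<le> 1 / real (Suc n)"
      by (intro divide_left_mono) auto
    then show "\<bar>x - cf_conv x n\<bar> \<le> 1 / real (Suc n)"
      using cf_conv_error [OF assms, of n] by linarith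
  qed
qed auto

text \<open>
  The shape of \<open>phi\<close> at a rational point, as a function of the signed distance: a square root whose two branches
  point in perpendicular directions.
\<close>

definition sqrt_cusp :: "real \<Rightarrow> complex" where
  "sqrt_cusp h = csqrt (- 2 * \<i> * of_real h)"

lemma sqrt_cusp_eq:
  "sqrt_cusp h = of_real (sqrt \<bar>h\<bar>) * (if h \<ge> 0 then 1 - \<i> else 1 + \<i>)"
proof (cases "h = 0")
  case False
  have sq: "(sqrt \<bar>h\<bar>)\<^sup>2 = \<bar>h\<bar>" by simp
  show ?thesis
    unfolding sqrt_cusp_def
  proof (rule csqrt_unique)
    have "(1 - \<i>)\<^sup>2 = - 2 * \<i>" "(1 + \<i>)\<^sup>2 = 2 * \<i>" by (auto simp: power2_eq_square algebra_simps)
    then show "(of_real (sqrt \<bar>h\<bar>) * (if h \<ge> 0 then 1 - \<i> else 1 + \<i>))\<^sup>2 = - 2 * \<i> * of_real h"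
      unfolding power_mult_distrib of_real_power [symmetric] sq by auto
  qed (use False in auto)
qed (simp add: sqrt_cusp_def)

lemma norm_sqrt_cusp: "norm (sqrt_cusp h) = sqrt (2 * \<bar>h\<bar>)"
  unfolding sqrt_cusp_def norm_csqrt by (simp add: norm_mult)

lemma sqrt_cusp_minus:
  assumes "h > 0"
  shows "sqrt_cusp (- h) = \<i> * sqrt_cusp h"
  using assms unfolding sqrt_cusp_eq by (simp add: algebra_simps)

text \<open>
  The increment does not leave the side of \<open>0\<close> on which \<open>x\<close> lies, so it is an increment of \<open>sqrt\<close>.
\<close>

lemma sqrt_cusp_diff:
  assumes "\<bar>h\<bar> \<le> \<bar>x\<bar>"
  shows "norm (sqrt_cusp (x + h) - sqrt_cusp x) * sqrt \<bar>x\<bar> \<le> 2 * \<bar>h\<bar>"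
proof (cases "x = 0")
  case False
  obtain e :: complex where e: "sqrt_cusp (x + h) = of_real (sqrt \<bar>x + h\<bar>) * e"
    "sqrt_cusp x = of_real (sqrt \<bar>x\<bar>) * e" "norm e \<le> 2"
  proof (cases "x \<ge> 0")
    case True
    then have "x + h \<ge> 0" using assms by linarith
    then show ?thesis
      using that [of "1 - \<i>"] True norm_triangle_ineq4 [of 1 \<i>] unfolding sqrt_cusp_eq by simp
  next
    case False
    then have "x + h < 0 \<or> x + h = 0" using assms by linarith
    then show ?thesis
      using that [of "1 + \<i>"] False norm_triangle_ineq [of 1 \<i>] unfolding sqrt_cusp_eq by auto
  qed
  have x: "sqrt \<bar>x\<bar> > 0" using False by simp
  have "sqrt_cusp (x + h) - sqrt_cusp x = of_real (sqrt \<bar>x + h\<bar> - sqrt \<bar>x\<bar>) * e"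
    unfolding e by (simp add: algebra_simps)
  then have "norm (sqrt_cusp (x + h) - sqrt_cusp x) = \<bar>sqrt \<bar>x + h\<bar> - sqrt \<bar>x\<bar>\<bar> * norm e"
    by (simp only: norm_mult norm_of_real)
  also have "\<dots> \<le> \<bar>sqrt \<bar>x + h\<bar> - sqrt \<bar>x\<bar>\<bar> * 2" by (intro mult_left_mono e) auto
  finally have "norm (sqrt_cusp (x + h) - sqrt_cusp x) * sqrt \<bar>x\<bar> \<le> \<bar>sqrt \<bar>x + h\<bar> - sqrt \<bar>x\<bar>\<bar> * 2 * sqrt \<bar>x\<bar>"
    using x by (intro mult_right_mono) auto
  moreover have "\<bar>sqrt \<bar>x + h\<bar> - sqrt \<bar>x\<bar>\<bar> * sqrt \<bar>x\<bar> \<le> \<bar>h\<bar>"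
  proof -
    have "\<bar>sqrt \<bar>x + h\<bar> - sqrt \<bar>x\<bar>\<bar> * sqrt \<bar>x\<bar> \<le> \<bar>sqrt \<bar>x + h\<bar> - sqrt \<bar>x\<bar>\<bar> * (sqrt \<bar>x + h\<bar> + sqrt \<bar>x\<bar>)"
      by (intro mult_left_mono) auto
    also have "\<dots> = \<bar>(sqrt \<bar>x + h\<bar> - sqrt \<bar>x\<bar>) * (sqrt \<bar>x + h\<bar> + sqrt \<bar>x\<bar>)\<bar>" by (simp add: abs_mult)
    also have "(sqrt \<bar>x + h\<bar> - sqrt \<bar>x\<bar>) * (sqrt \<bar>x + h\<bar> + sqrt \<bar>x\<bar>) = (sqrt \<bar>x + h\<bar>)\<^sup>2 - (sqrt \<bar>x\<bar>)\<^sup>2"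
      by (simp add: power2_eq_square algebra_simps)
    also have "\<dots> = \<bar>x + h\<bar> - \<bar>x\<bar>" by simp
    also have "\<bar>\<bar>x + h\<bar> - \<bar>x\<bar>\<bar> \<le> \<bar>h\<bar>" by linarith
    finally show ?thesis .
  qed
  ultimately show ?thesis by linarith
qed (use assms in simp)

text \<open>
  Of the cusp coefficient \<open>G\<close> only its size \<open>q^(-1/2)\<close> matters, and whether it vanishes.
\<close>

lemma phi_expansion_conv:
  fixes x :: real and n :: nat
  assumes "x \<notin> \<rat>"
  defines "q \<equiv> cf_den x n"
  obtains G where
    "\<And>h. norm (phi (cf_conv x n + h) - phi (cf_conv x n) + of_real h / 2 - G * sqrt_cusp h)
        \<le> 2 * pi * sqrt (of_int q * \<bar>h\<bar>) ^ 3"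
    "norm G * sqrt (of_int q) \<le> 1"
    "q mod 4 \<noteq> 2 \<Longrightarrow> norm G * sqrt (of_int q) \<ge> 1 / 2"
    "q mod 4 = 2 \<Longrightarrow> G = 0"
proof
  have q: "q > 0" using cf_den_pos [OF assms(1), of n] by (simp add: q_def)
  have cop: "coprime (cf_num x n) q" unfolding q_def by (rule cf_coprime)
  let ?G = "\<i> * gauss_sum (cf_num x n) q 0 / (2 * of_int q)"
  have norm_eq: "norm ?G * sqrt (of_int q) = norm (gauss_sum (cf_num x n) q 0) / (2 * sqrt (of_int q))"
  proof -
    have "real_of_int q = sqrt (of_int q) * sqrt (of_int q)" using q by simp
    moreover have "norm ?G * sqrt (of_int q) = norm (gauss_sum (cf_num x n) q 0) * sqrt (of_int q) / (2 * of_int q)"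
      using q by (simp add: norm_mult norm_divide)
    moreover have "N * s / (2 * (s * s)) = N / (2 * s)" if "s > 0" for N s :: real
      using that by (simp add: field_simps)
    ultimately show ?thesis using q by (metis of_int_0_less_iff real_sqrt_gt_0_iff)
  qed
  have s: "sqrt (real_of_int q) > 0" using q by simp
  show "norm (phi (cf_conv x n + h) - phi (cf_conv x n) + of_real h / 2 - ?G * sqrt_cusp h)
        \<le> 2 * pi * sqrt (of_int q * \<bar>h\<bar>) ^ 3" for h
    using phi_expansion_rational [OF q cop, of h] unfolding cf_conv_def sqrt_cusp_def q_def .
  show "norm ?G * sqrt (of_int q) \<le> 1"
  proof -
    have "norm (gauss_sum (cf_num x n) q 0) \<le> sqrt 2 * sqrt (of_int q)"
      using gauss_sum_norm_le [OF q cop, of 0] by (simp add: real_sqrt_mult)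
    also have "\<dots> \<le> 2 * sqrt (of_int q)"
      using s sqrt2_less_2 by (intro mult_right_mono) auto
    finally show ?thesis unfolding norm_eq using s by (simp add: divide_le_eq)
  qed
  show "norm ?G * sqrt (of_int q) \<ge> 1 / 2" if "q mod 4 \<noteq> 2"
    using gauss_sum_0_norm_ge [OF q cop that] s unfolding norm_eq by (simp add: le_divide_eq)
  show "?G = 0" if "q mod 4 = 2"
    using gauss_sum_0_eq_0 [OF q cop that] by simp
qed

section \<open>Hoelder exponents, and cusps at the convergents\<close>

lemma cf_tau_powr:
  assumes "x \<notin> \<rat>" "n \<in> tau_indices x"
  shows "\<bar>x - cf_conv x n\<bar> = of_int (cf_den x n) powr (- cf_tau x n)"
proof -
  have q: "cf_den x n \<ge> 2" using assms(2) by (simp add: tau_indices_def)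
  have "\<bar>x - cf_conv x n\<bar> = (1 / of_int (cf_den x n)) powr cf_tau x n"
    using cf_tau_characterization [OF assms(1) q] by blast
  also have "\<dots> = of_int (cf_den x n) powr (- cf_tau x n)"
    using q by (simp add: powr_divide powr_minus_divide)
  finally show ?thesis .
qed

lemma cf_tau_ge_2:
  assumes "x \<notin> \<rat>" "n \<in> tau_indices x"
  shows "cf_tau x n \<ge> 2"
proof -
  let ?q = "real_of_int (cf_den x n)"
  have q: "?q \<ge> 2" using assms(2) by (simp add: tau_indices_def)
  have "?q powr (2 - cf_tau x n) = ?q powr (- cf_tau x n) * ?q powr 2" by (simp flip: powr_add)
  also have "\<dots> \<le> ?q powr 0"
    using cf_conv_error_square [OF assms(1), of n] q unfolding cf_tau_powr [OF assms] by (simp add: powr_numeral)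
  finally have "?q powr (2 - cf_tau x n) \<le> ?q powr 0" .
  then show ?thesis using q by (subst (asm) powr_le_cancel_iff) auto
qed

lemma tau_ge_2:
  assumes "x \<notin> \<rat>"
  shows "tau x \<ge> 2"
  unfolding tau_def
proof (rule le_Limsup)
  have "2 \<le> cf_tau x (enumerate (tau_indices x) k)" for k
    by (intro cf_tau_ge_2 assms enumerate_in_set infinite_tau_indices)
  then show "\<forall>\<^sub>F k in sequentially. 2 \<le> ereal (cf_tau x (enumerate (tau_indices x) k))"
    by (intro always_eventually allI) (metis ereal_less_eq(3) numeral_eq_ereal)
qed simp

lemma tau_less_imp:
  assumes "x \<notin> \<rat>" "tau x < ereal c"
  obtains N where "\<And>n. n \<in> tau_indices x \<Longrightarrow> n \<ge> N \<Longrightarrow> cf_tau x n < c"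
proof -
  let ?e = "enumerate (tau_indices x)"
  have inf: "infinite (tau_indices x)" by (rule infinite_tau_indices [OF assms(1)])
  have "\<forall>\<^sub>F k in sequentially. ereal (cf_tau x (?e k)) < ereal c"
    using assms(2) unfolding tau_def by (rule Limsup_lessD)
  then obtain M where M: "\<And>k. k \<ge> M \<Longrightarrow> cf_tau x (?e k) < c"
    by (auto simp: eventually_sequentially)
  show ?thesis
  proof (rule that [of "?e M"])
    fix n assume n: "n \<in> tau_indices x" "n \<ge> ?e M"
    then obtain k where k: "n = ?e k" using enumerate_Ex [OF inf] by metis
    have "M \<le> k"
      using n(2) unfolding k by (simp add: enumerate_mono_le_iff [OF inf])
    then show "cf_tau x n < c" using M k by simp
  qed
qed

lemma less_tau_imp:
  assumes "x \<notin> \<rat>" "ereal c < tau x"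
  shows "\<exists>n\<ge>N. n \<in> tau_indices x \<and> cf_tau x n > c"
proof (rule ccontr)
  assume *: "\<not> ?thesis"
  let ?e = "enumerate (tau_indices x)"
  have inf: "infinite (tau_indices x)" by (rule infinite_tau_indices [OF assms(1)])
  have "tau x \<le> ereal c"
    unfolding tau_def
  proof (rule Limsup_bounded)
    show "\<forall>\<^sub>F k in sequentially. ereal (cf_tau x (?e k)) \<le> ereal c"
      unfolding eventually_sequentially
    proof (intro exI [of _ N] allI impI)
      fix k assume "N \<le> k"
      also have "k \<le> ?e k" by (rule le_enumerate [OF inf])
      finally have "N \<le> ?e k" .
      moreover have "?e k \<in> tau_indices x" by (rule enumerate_in_set [OF inf])
      ultimately have "\<not> cf_tau x (?e k) > c" using * by blast
      then show "ereal (cf_tau x (?e k)) \<le> ereal c" by simp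
    qed
  qed
  then show False using assms(2) by simp
qed

lemma le_holder_exponent:
  fixes F :: "real \<Rightarrow> 'a::real_normed_field"
  assumes "\<alpha> > 0" "\<eta> > 0" and bound: "\<And>h. \<bar>h\<bar> < \<eta> \<Longrightarrow> norm (F (x + h) - F x) \<le> K * \<bar>h\<bar> powr \<alpha>"
  shows "ereal \<alpha> \<le> holder_exponent F x"
  unfolding holder_exponent_def
proof (rule Sup_upper, rule CollectI, intro exI conjI)
  show "(\<lambda>h. F (x + h) - poly [:F x:] (of_real h)) \<in> O[at 0](\<lambda>h. of_real (\<bar>h\<bar> powr \<alpha>))"
  proof (rule bigoI)
    show "\<forall>\<^sub>F h in at 0. norm (F (x + h) - poly [:F x:] (of_real h)) \<le> K * norm (of_real (\<bar>h\<bar> powr \<alpha>) :: 'a)"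
      unfolding eventually_at by (intro exI [of _ \<eta>]) (use assms in auto)
  qed
qed (use assms in auto)

text \<open>
  For exponents at most 1 the polynomial may be replaced by the value of \<open>F\<close>: its constant term is \<open>F x\<close> by
  continuity, and its other terms are \<open>O(\<bar>h\<bar>)\<close>.
\<close>

lemma less_holder_exponent_imp:
  fixes F :: "real \<Rightarrow> 'a::real_normed_field"
  assumes cont: "isCont F x" and \<alpha>: "0 < \<alpha>" "\<alpha> \<le> 1" and less: "ereal \<alpha> < holder_exponent F x"
  obtains K \<eta> where "\<eta> > 0" "\<And>h. \<bar>h\<bar> < \<eta> \<Longrightarrow> norm (F (x + h) - F x) \<le> K * \<bar>h\<bar> powr \<alpha>"
proof -
  obtain \<alpha>' and P :: "'a poly" where \<alpha>': "\<alpha> < \<alpha>'"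
    and P: "(\<lambda>h. F (x + h) - poly P (of_real h)) \<in> O[at 0](\<lambda>h. of_real (\<bar>h\<bar> powr \<alpha>'))"
    using less unfolding holder_exponent_def less_Sup_iff by auto
  obtain a Q where PQ: "P = pCons a Q" by (rule pCons_cases)
  from P obtain c where c: "\<forall>\<^sub>F h in at 0. norm (F (x + h) - poly P (of_real h)) \<le> c * norm (of_real (\<bar>h\<bar> powr \<alpha>') :: 'a)"
    by (elim landau_o.bigE)
  have "((\<lambda>h. F (x + h) - poly P (of_real h)) \<longlongrightarrow> 0) (at 0)"
  proof (rule Lim_null_comparison [OF c])
    have "((\<lambda>h::real. \<bar>h\<bar> powr \<alpha>') \<longlongrightarrow> 0 powr \<alpha>') (at 0)"
      using \<alpha> \<alpha>' by (intro tendsto_powr') (auto intro!: tendsto_rabs_zero tendsto_ident_at)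
    then show "((\<lambda>h::real. c * norm (of_real (\<bar>h\<bar> powr \<alpha>') :: 'a)) \<longlongrightarrow> 0) (at 0)"
      by (intro tendsto_mult_right_zero) (simp add: \<alpha>)
  qed
  moreover have "((\<lambda>h. F (x + h) - poly P (of_real h)) \<longlongrightarrow> F x - a) (at 0)"
  proof (intro tendsto_diff)
    show "((\<lambda>h. F (x + h)) \<longlongrightarrow> F x) (at 0)" using cont by (simp add: isCont_iff)
    have "isCont (\<lambda>h::real. poly P (of_real h)) 0" by (intro continuous_intros)
    then show "((\<lambda>h::real. poly P (of_real h)) \<longlongrightarrow> a) (at 0)" by (simp add: isCont_def PQ)
  qed
  ultimately have a: "a = F x" using tendsto_unique [OF trivial_limit_at] by fastforce
  have "bounded ((\<lambda>h::real. poly Q (of_real h)) ` {-1..1})"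
    by (intro compact_imp_bounded compact_continuous_image continuous_intros) auto
  then obtain B where "\<forall>z\<in>(\<lambda>h::real. poly Q (of_real h)) ` {-1..1}. norm z \<le> B"
    unfolding bounded_iff by blast
  then have B: "norm (poly Q (of_real h)) \<le> B" if "\<bar>h\<bar> \<le> 1" for h :: real
    using that by (auto simp: abs_le_iff)
  from c obtain d where d: "d > 0" "\<And>h. h \<noteq> 0 \<Longrightarrow> \<bar>h\<bar> < d \<Longrightarrow>
      norm (F (x + h) - poly P (of_real h)) \<le> c * norm (of_real (\<bar>h\<bar> powr \<alpha>') :: 'a)"
    unfolding eventually_at by (auto simp: dist_real_def)
  show ?thesis
  proof (rule that [of "min d 1" "\<bar>c\<bar> + B"])
    fix h :: real assume h: "\<bar>h\<bar> < min d 1"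
    show "norm (F (x + h) - F x) \<le> (\<bar>c\<bar> + B) * \<bar>h\<bar> powr \<alpha>"
    proof (cases "h = 0")
      case False
      have "F (x + h) - F x = (F (x + h) - poly P (of_real h)) + of_real h * poly Q (of_real h)"
        unfolding PQ a by simp
      then have "norm (F (x + h) - F x) \<le> norm (F (x + h) - poly P (of_real h)) + \<bar>h\<bar> * norm (poly Q (of_real h :: 'a))"
        by (metis norm_triangle_ineq norm_mult norm_of_real)
      also have "\<dots> \<le> \<bar>c\<bar> * \<bar>h\<bar> powr \<alpha> + \<bar>h\<bar> powr \<alpha> * B"
      proof (intro add_mono mult_mono B)
        have "norm (F (x + h) - poly P (of_real h)) \<le> c * \<bar>h\<bar> powr \<alpha>'"
          using d(2) [OF False] h by simp
        also have "\<dots> \<le> \<bar>c\<bar> * \<bar>h\<bar> powr \<alpha>"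
          using h \<alpha>' by (intro mult_mono powr_mono') auto
        finally show "norm (F (x + h) - poly P (of_real h)) \<le> \<bar>c\<bar> * \<bar>h\<bar> powr \<alpha>" .
        have "\<bar>h\<bar> powr 1 \<le> \<bar>h\<bar> powr \<alpha>" using h \<alpha> by (intro powr_mono') auto
        then show "\<bar>h\<bar> \<le> \<bar>h\<bar> powr \<alpha>" by simp
      qed (use h in auto)
      finally show ?thesis by (simp add: algebra_simps)
    qed simp
  qed (use d in auto)
qed

text \<open>
  The map \<open>L\<close> stands for the identity, the real part or the imaginary part. A convergent \<open>r\<close> and the two
  points \<open>r + t\<close> and \<open>r - t\<close> with \<open>t = d / 64\<close> all lie within \<open>2 d\<close> of \<open>x\<close>, so the hypothesis bounds
  \<open>L\<close> of the cusp on both sides of \<open>r\<close> by a multiple of \<open>d powr \<alpha>\<close>. One side would not be enough: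
  \<open>L\<close> may annihilate the cusp there. On the other side the cusp is multiplied by
  \<open>\<i>\<close>, and \<open>L\<close> cannot annihilate both.
\<close>

lemma holder_bound_at_convergents:
  fixes L :: "complex \<Rightarrow> 'a::real_normed_field"
  assumes x: "x \<notin> \<rat>" and lin: "bounded_linear L"
    and le: "\<And>z. norm (L z) \<le> norm z" and ge: "\<And>z. norm z \<le> norm (L z) + norm (L (\<i> * z))"
    and \<alpha>: "0 < \<alpha>" "\<alpha> \<le> 1" and \<eta>: "\<eta> > 0"
    and bound: "\<And>h. \<bar>h\<bar> < \<eta> \<Longrightarrow> norm (L (phi (x + h)) - L (phi x)) \<le> K * \<bar>h\<bar> powr \<alpha>"
  shows "\<exists>K' N. K' > 0 \<and> (\<forall>n\<ge>N. n \<in> tau_indices x \<longrightarrow>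
      sqrt \<bar>x - cf_conv x n\<bar> \<le> K' * \<bar>x - cf_conv x n\<bar> powr \<alpha> * sqrt (of_int (cf_den x n)))"
proof -
  interpret bounded_linear L by (rule lin)
  define K0 where "K0 = \<bar>K\<bar>"
  have K0: "K0 \<ge> 0" by (simp add: K0_def)
  have bound0: "norm (L (phi (x + h)) - L (phi x)) \<le> K0 * \<bar>h\<bar> powr \<alpha>" if "\<bar>h\<bar> < \<eta>" for h
    by (rule order_trans [OF bound [OF that]]) (simp add: K0_def mult_right_mono)
  have "\<forall>\<^sub>F n in sequentially. \<bar>x - cf_conv x n\<bar> < min (\<eta> / 2) 1"
    using order_tendstoD(2) [OF cf_conv_tendsto [OF x], of "min (\<eta> / 2) 1"] \<eta> by simp
  then obtain N where N: "\<And>n. n \<ge> N \<Longrightarrow> \<bar>x - cf_conv x n\<bar> < min (\<eta> / 2) 1"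
    by (auto simp: eventually_sequentially)
  have "sqrt \<bar>x - cf_conv x n\<bar> \<le> (32 * (6 * K0 + 1)) * \<bar>x - cf_conv x n\<bar> powr \<alpha> * sqrt (of_int (cf_den x n))"
    if n: "n \<ge> N" "n \<in> tau_indices x" for n
  proof -
    define \<delta> where "\<delta> = x - cf_conv x n"
    define d where "d = \<bar>\<delta>\<bar>"
    define q where "q = real_of_int (cf_den x n)"
    define r where "r = cf_conv x n"
    \<comment> \<open>The factor 64 makes the error term at most half as large as the cusp, see \<open>cube\<close> below.\<close>
    define t where "t = d / 64"
    have d: "0 < d" "2 * d < \<eta>" "d < 1"
      using N [OF n(1)] cf_conv_nonzero [OF x, of n] by (auto simp: d_def \<delta>_def)
    have q: "q \<ge> 1" using cf_den_pos [OF x, of n] by (simp add: q_def)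
    have qd: "d * q\<^sup>2 \<le> 1" using cf_conv_error_square [OF x, of n] by (simp add: d_def \<delta>_def q_def)
    have t: "0 < t" using d by (simp add: t_def)
    obtain G where G: "\<And>h. norm (phi (r + h) - phi r + of_real h / 2 - G * sqrt_cusp h) \<le> 2 * pi * sqrt (q * \<bar>h\<bar>) ^ 3"
      "norm G * sqrt q \<ge> 1 / 2"
      using phi_expansion_conv [OF x, of n] n(2) unfolding r_def q_def tau_indices_def by blast
    define B where "B = 3 * K0 * d powr \<alpha> + 2 * pi * sqrt (q * t) ^ 3 + t / 2"
    have one_side: "norm (L (G * sqrt_cusp \<sigma>)) \<le> B" if \<sigma>: "\<bar>\<sigma>\<bar> = t" for \<sigma>
    proof -
      have "norm (L (phi (x + (\<sigma> - \<delta>))) - L (phi x)) \<le> K0 * \<bar>\<sigma> - \<delta>\<bar> powr \<alpha>"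
        using \<sigma> d by (intro bound0) (auto simp: t_def d_def)
      also have "\<dots> \<le> K0 * (2 * d) powr \<alpha>"
        using \<sigma> d K0 \<alpha> by (intro mult_left_mono powr_mono2) (auto simp: t_def d_def)
      also have "\<dots> = K0 * (2 powr \<alpha> * d powr \<alpha>)" using d by (simp add: powr_mult)
      also have "\<dots> \<le> K0 * (2 powr 1 * d powr \<alpha>)"
        using K0 \<alpha> by (intro mult_left_mono mult_right_mono powr_mono) auto
      finally have 1: "norm (L (phi (r + \<sigma>)) - L (phi x)) \<le> 2 * K0 * d powr \<alpha>"
        by (simp add: r_def \<delta>_def algebra_simps)
      have "norm (L (phi (x + (- \<delta>))) - L (phi x)) \<le> K0 * \<bar>- \<delta>\<bar> powr \<alpha>"
        using d by (intro bound0) (auto simp: d_def)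
      then have 2: "norm (L (phi r) - L (phi x)) \<le> K0 * d powr \<alpha>"
        by (simp add: r_def \<delta>_def d_def abs_minus_commute)
      have 3: "norm (L (phi (r + \<sigma>)) - L (phi r)) \<le> 3 * K0 * d powr \<alpha>"
        using norm_triangle_ineq4 [of "L (phi (r + \<sigma>)) - L (phi x)" "L (phi r) - L (phi x)"] 1 2 by simp
      define Er where "Er = phi (r + \<sigma>) - phi r + of_real \<sigma> / 2 - G * sqrt_cusp \<sigma>"
      have Er: "norm Er \<le> 2 * pi * sqrt (q * t) ^ 3" using G(1) [of \<sigma>] \<sigma> by (simp add: Er_def)
      have "G * sqrt_cusp \<sigma> = (phi (r + \<sigma>) - phi r) - (Er - of_real \<sigma> / 2)"
        by (simp add: Er_def)
      then have "L (G * sqrt_cusp \<sigma>) = (L (phi (r + \<sigma>)) - L (phi r)) - L (Er - of_real \<sigma> / 2)"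
        by (simp only: diff)
      then have "norm (L (G * sqrt_cusp \<sigma>)) \<le> norm (L (phi (r + \<sigma>)) - L (phi r)) + norm (L (Er - of_real \<sigma> / 2))"
        using norm_triangle_ineq4 by metis
      moreover have "norm (L (Er - of_real \<sigma> / 2)) \<le> norm Er + t / 2"
        using le [of "Er - of_real \<sigma> / 2"] norm_triangle_ineq4 [of Er "of_real \<sigma> / 2"] \<sigma>
        by (simp add: norm_divide)
      ultimately show ?thesis using 3 Er unfolding B_def by linarith
    qed
    have "norm (G * sqrt_cusp t) \<le> norm (L (G * sqrt_cusp t)) + norm (L (\<i> * (G * sqrt_cusp t)))" by (rule ge)
    also have "\<i> * (G * sqrt_cusp t) = G * sqrt_cusp (- t)" using sqrt_cusp_minus [OF t] by simp
    also have "norm (L (G * sqrt_cusp t)) + norm (L (G * sqrt_cusp (- t))) \<le> 2 * B"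
      using one_side [of t] one_side [of "- t"] t by simp
    finally have "norm G * sqrt (2 * t) \<le> 2 * B" using t by (simp add: norm_mult norm_sqrt_cusp)
    then have "(norm G * sqrt q) * sqrt (2 * t) \<le> 2 * B * sqrt q"
      using q mult_right_mono [of "norm G * sqrt (2 * t)" "2 * B" "sqrt q"] by (simp add: mult_ac)
    moreover have "1 / 2 * sqrt (2 * t) \<le> (norm G * sqrt q) * sqrt (2 * t)"
      using G(2) t by (intro mult_right_mono) auto
    moreover have "sqrt d / 8 \<le> sqrt (2 * t)"
    proof -
      have "sqrt d / 8 = sqrt (d / 64)" by (simp add: real_sqrt_divide)
      also have "\<dots> \<le> sqrt (2 * t)" using t unfolding t_def by (intro real_sqrt_le_mono) simp
      finally show ?thesis .
    qed
    ultimately have main: "sqrt d / 16 \<le> 2 * B * sqrt q" by linarith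
    \<comment> \<open>Here \<open>d q^2 \<le> 1\<close> is used: it makes the error comparable to the cusp.\<close>
    have cube: "sqrt (q * t) ^ 3 * sqrt q \<le> sqrt d / 512"
    proof -
      have "sqrt (q * t) = sqrt q * sqrt d / 8" by (simp add: t_def real_sqrt_mult real_sqrt_divide)
      moreover have "(u * v / 8) ^ 3 * u = (u * u) * (u * u) * (v * v) * v / 512" for u v :: real
        by (simp add: power3_eq_cube)
      ultimately have "sqrt (q * t) ^ 3 * sqrt q = (sqrt q * sqrt q) * (sqrt q * sqrt q) * (sqrt d * sqrt d) * sqrt d / 512"
        by (simp only:)
      also have "\<dots> = (d * q\<^sup>2) * sqrt d / 512" using q d by (simp add: power2_eq_square)
      also have "\<dots> \<le> 1 * sqrt d / 512" using qd d by (intro divide_right_mono mult_right_mono) auto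
      finally show ?thesis by simp
    qed
    have "pi * (sqrt (q * t) ^ 3 * sqrt q) \<le> 4 * (sqrt d / 512)"
      using cube pi_less_4 q t by (intro mult_mono) auto
    moreover have "t * sqrt q \<le> d powr \<alpha> * sqrt q"
    proof (rule mult_right_mono)
      have "t \<le> d powr 1" using d by (simp add: t_def)
      also have "\<dots> \<le> d powr \<alpha>" using d \<alpha> by (intro powr_mono') auto
      finally show "t \<le> d powr \<alpha>" .
    qed (use q in simp)
    moreover have "2 * B * sqrt q = 6 * K0 * (d powr \<alpha> * sqrt q) + 4 * (pi * (sqrt (q * t) ^ 3 * sqrt q)) + t * sqrt q"
      unfolding B_def by (simp add: algebra_simps)
    ultimately have "sqrt d / 32 \<le> 6 * K0 * (d powr \<alpha> * sqrt q) + d powr \<alpha> * sqrt q"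
      using main by linarith
    then have "sqrt d \<le> (32 * (6 * K0 + 1)) * d powr \<alpha> * sqrt q" by (simp add: algebra_simps)
    then show ?thesis by (simp add: d_def \<delta>_def q_def)
  qed
  then show ?thesis using K0 by (intro exI [of _ "32 * (6 * K0 + 1)"] exI [of _ N]) auto
qed

section \<open>Regularity at an irrational point\<close>

text \<open>
  Subtract the expansions at the convergent for the increments \<open>x + h - r\<close> and \<open>x - r\<close>. The hypothesis on
  \<open>n\<close> says that the cusp coefficient, of size \<open>q^(-1/2)\<close>, is at most \<open>\<bar>x - r\<bar> powr \<beta>\<close>; for
  \<open>q mod 4 = 2\<close> the coefficient is 0.
\<close>

lemma phi_increment_le:
  assumes x: "x \<notin> \<rat>" and \<beta>: "0 \<le> \<beta>"
    and n: "n \<ge> 2" "n \<in> tau_indices x \<Longrightarrow> 1 / sqrt (of_int (cf_den x n)) \<le> \<bar>x - cf_conv x n\<bar> powr \<beta>"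
    and M: "\<bar>h\<bar> \<le> M" "\<bar>x - cf_conv x n\<bar> \<le> M"
  shows "norm (phi (x + h) - phi x) \<le>
     \<bar>x - cf_conv x n\<bar> powr \<beta> * norm (sqrt_cusp (x - cf_conv x n + h) - sqrt_cusp (x - cf_conv x n))
     + \<bar>h\<bar> / 2 + 8 * pi * sqrt (of_int (cf_den x n) * M) ^ 3"
proof -
  define \<delta> where "\<delta> = x - cf_conv x n"
  define q where "q = real_of_int (cf_den x n)"
  define r where "r = cf_conv x n"
  have q: "q \<ge> 1" using cf_den_pos [OF x, of n] by (simp add: q_def)
  have "cf_den x n \<ge> 2" using cf_den_ge [OF x, of n] n(1) by linarith
  obtain G where G: "\<And>h. norm (phi (r + h) - phi r + of_real h / 2 - G * sqrt_cusp h) \<le> 2 * pi * sqrt (q * \<bar>h\<bar>) ^ 3"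
      "norm G * sqrt q \<le> 1" "cf_den x n mod 4 = 2 \<Longrightarrow> G = 0"
    using phi_expansion_conv [OF x, of n] unfolding r_def q_def by blast
  have normG: "norm G \<le> \<bar>\<delta>\<bar> powr \<beta>"
  proof (cases "cf_den x n mod 4 = 2")
    case False
    then have "n \<in> tau_indices x" using \<open>cf_den x n \<ge> 2\<close> by (simp add: tau_indices_def)
    moreover have "norm G \<le> 1 / sqrt q" using G(2) q by (simp add: field_simps)
    ultimately show ?thesis using n(2) unfolding \<delta>_def q_def by linarith
  qed (use G(3) in simp)
  define E where "E h = phi (r + h) - phi r + of_real h / 2 - G * sqrt_cusp h" for h
  have M0: "0 \<le> q * M" using M q by auto
  have E_le: "norm (E h') \<le> 2 * pi * (2 * sqrt 2 * sqrt (q * M) ^ 3)" if "\<bar>h'\<bar> \<le> 2 * M" for h'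
  proof -
    have "norm (E h') \<le> 2 * pi * sqrt (q * \<bar>h'\<bar>) ^ 3" unfolding E_def by (rule G(1))
    also have "\<dots> \<le> 2 * pi * sqrt (2 * (q * M)) ^ 3"
    proof (intro mult_left_mono power_mono real_sqrt_le_mono)
      have "q * \<bar>h'\<bar> \<le> q * (2 * M)" using that q by (intro mult_left_mono) auto
      then show "q * \<bar>h'\<bar> \<le> 2 * (q * M)" by simp
    qed (use q in auto)
    also have "sqrt (2 * (q * M)) ^ 3 = 2 * sqrt 2 * sqrt (q * M) ^ 3"
      unfolding real_sqrt_mult [of 2] power_mult_distrib by (simp add: power3_eq_cube)
    finally show ?thesis .
  qed
  have "norm (E \<delta>) \<le> 2 * pi * sqrt (q * \<bar>\<delta>\<bar>) ^ 3" unfolding E_def by (rule G(1))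
  also have "\<dots> \<le> 2 * pi * sqrt (q * M) ^ 3"
    using q M unfolding \<delta>_def by (intro mult_left_mono power_mono real_sqrt_le_mono) auto
  finally have E2: "norm (E \<delta>) \<le> 2 * pi * sqrt (q * M) ^ 3" .
  have "\<bar>\<delta> + h\<bar> \<le> 2 * M" using M unfolding \<delta>_def by linarith
  from E_le [OF this] have E1: "norm (E (\<delta> + h)) \<le> 2 * pi * (2 * sqrt 2 * sqrt (q * M) ^ 3)" .
  have split: "phi (x + h) - phi x = G * (sqrt_cusp (\<delta> + h) - sqrt_cusp \<delta>) - of_real h / 2 + (E (\<delta> + h) - E \<delta>)"
    unfolding E_def r_def \<delta>_def by (simp add: algebra_simps add_divide_distrib diff_divide_distrib)
  have tri: "norm (u - v + (w - z)) \<le> norm u + norm v + (norm w + norm z)" for u v w z :: complex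
    using norm_triangle_ineq [of "u - v" "w - z"] norm_triangle_ineq4 [of u v] norm_triangle_ineq4 [of w z]
    by linarith
  have "norm (complex_of_real h / 2) = \<bar>h\<bar> / 2" by (simp add: norm_divide)
  with tri [of "G * (sqrt_cusp (\<delta> + h) - sqrt_cusp \<delta>)" "of_real h / 2" "E (\<delta> + h)" "E \<delta>"]
  have "norm (phi (x + h) - phi x) \<le> norm (G * (sqrt_cusp (\<delta> + h) - sqrt_cusp \<delta>)) + \<bar>h\<bar> / 2
      + (norm (E (\<delta> + h)) + norm (E \<delta>))"
    unfolding split by (simp only:)
  moreover have "norm (G * (sqrt_cusp (\<delta> + h) - sqrt_cusp \<delta>)) \<le> \<bar>\<delta>\<bar> powr \<beta> * norm (sqrt_cusp (\<delta> + h) - sqrt_cusp \<delta>)"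
    unfolding norm_mult by (intro mult_right_mono normG) auto
  moreover have "norm (E (\<delta> + h)) + norm (E \<delta>) \<le> 8 * pi * sqrt (q * M) ^ 3"
  proof -
    have "2 * sqrt 2 \<le> (3::real)" by (rule power2_le_imp_le) (simp_all add: power_mult_distrib)
    then have "(2 * sqrt 2) * (2 * pi * sqrt (q * M) ^ 3) \<le> 3 * (2 * pi * sqrt (q * M) ^ 3)"
      using M0 by (intro mult_right_mono) auto
    moreover have "2 * pi * (2 * sqrt 2 * sqrt (q * M) ^ 3) = (2 * sqrt 2) * (2 * pi * sqrt (q * M) ^ 3)"
      by (simp only: mult_ac)
    ultimately show ?thesis using E1 E2 by linarith
  qed
  ultimately show ?thesis unfolding \<delta>_def q_def by linarith
qed

text \<open>
  Let \<open>n\<close> be the first index from \<open>N\<close> on with \<open>d n \<le> \<bar>h\<bar>\<close>, where \<open>d n\<close> is the distance of the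
  convergent, and let \<open>m = n - 1\<close>. If \<open>\<bar>h\<bar> q\<^sub>n^2 \<le> 1\<close>, the expansion at the \<open>n\<close>-th convergent serves:
  its cusp is seen from within distance \<open>\<bar>h\<bar>\<close>. Otherwise the \<open>m\<close>-th one serves: \<open>\<bar>h\<bar> < d m\<close>, so
  \<open>x\<close> and \<open>x + h\<close> lie on the same side of its cusp, which is smooth there, and
  \<open>q\<^sub>m d m \<le> 1 / q\<^sub>n\<close> keeps the error small. In both cases the error is at most a constant times
  \<open>\<bar>h\<bar> powr (3/4)\<close>.
\<close>

lemma phi_holder_bound:
  assumes x: "x \<notin> \<rat>" and \<beta>: "0 \<le> \<beta>" "\<beta> \<le> 1 / 4"
    and N: "\<And>n. n \<ge> N \<Longrightarrow> n \<in> tau_indices x \<Longrightarrow> 1 / sqrt (of_int (cf_den x n)) \<le> \<bar>x - cf_conv x n\<bar> powr \<beta>"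
  shows "\<exists>\<eta>>0. \<forall>h. \<bar>h\<bar> < \<eta> \<longrightarrow> norm (phi (x + h) - phi x) \<le> (5 + 8 * pi) * \<bar>h\<bar> powr (1 / 2 + \<beta>)"
proof (intro exI conjI allI impI)
  define N' where "N' = max N 2"
  define d where "d n = \<bar>x - cf_conv x n\<bar>" for n
  define q where "q n = real_of_int (cf_den x n)" for n
  have d_pos: "d n > 0" for n using cf_conv_nonzero [OF x, of n] by (simp add: d_def)
  have q_ge: "q n \<ge> 1" for n using cf_den_pos [OF x, of n] by (simp add: q_def)
  show "min (d N') 1 > 0" using d_pos by simp
  fix h :: real assume h: "\<bar>h\<bar> < min (d N') 1"
  define a where "a = \<bar>h\<bar>"
  show "norm (phi (x + h) - phi x) \<le> (5 + 8 * pi) * \<bar>h\<bar> powr (1 / 2 + \<beta>)"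
  proof (cases "h = 0")
    case False
    have a: "0 < a" "a < 1" "a < d N'" using h False by (auto simp: a_def)
    have half: "a powr (1 / 2) = sqrt a" using a by (simp add: powr_half_sqrt)
    have "\<exists>n. n \<ge> N' \<and> d n \<le> a"
    proof -
      have "\<forall>\<^sub>F n in sequentially. d n < a"
        unfolding d_def using order_tendstoD(2) [OF cf_conv_tendsto [OF x] a(1)] .
      then have "\<forall>\<^sub>F n in sequentially. d n < a \<and> n \<ge> N'"
        using eventually_ge_at_top by (rule eventually_conj)
      then show ?thesis by (auto simp: eventually_sequentially intro: less_imp_le)
    qed
    define n where "n = (LEAST n. n \<ge> N' \<and> d n \<le> a)"
    have n: "n \<ge> N'" "d n \<le> a"
      unfolding n_def using LeastI_ex [OF \<open>\<exists>n. n \<ge> N' \<and> d n \<le> a\<close>] by auto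
    have "n \<noteq> N'" using n a by auto
    then obtain m where m: "n = Suc m" "m \<ge> N'" using n by (cases n) auto
    have dm: "a < d m"
    proof (rule ccontr)
      assume "\<not> ?thesis"
      then have "n \<le> m" unfolding n_def using m by (intro Least_le) auto
      then show False using m by simp
    qed
    have "\<exists>j M. j \<ge> N' \<and> a \<le> M \<and> d j \<le> M \<and> q j * M \<le> sqrt a \<and>
        d j powr \<beta> * norm (sqrt_cusp (x - cf_conv x j + h) - sqrt_cusp (x - cf_conv x j)) \<le> 4 * a powr (1 / 2 + \<beta>)"
    proof (cases "a * (q n)\<^sup>2 \<le> 1")
      case True
      have "q n * a \<le> sqrt a"
      proof -
        have "(q n * sqrt a)\<^sup>2 \<le> 1" using True a by (simp add: power_mult_distrib mult.commute)
        then have "q n * sqrt a \<le> 1" using power2_le_imp_le [of "q n * sqrt a" 1] by simp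
        then have "(q n * sqrt a) * sqrt a \<le> 1 * sqrt a" using a by (intro mult_right_mono) auto
        then show ?thesis using a by (simp add: mult.assoc)
      qed
      moreover have "d n powr \<beta> * norm (sqrt_cusp (x - cf_conv x n + h) - sqrt_cusp (x - cf_conv x n)) \<le> 4 * a powr (1 / 2 + \<beta>)"
      proof -
        have "norm (sqrt_cusp (x - cf_conv x n + h) - sqrt_cusp (x - cf_conv x n))
            \<le> sqrt (2 * \<bar>x - cf_conv x n + h\<bar>) + sqrt (2 * \<bar>x - cf_conv x n\<bar>)"
          using norm_triangle_ineq4 [of "sqrt_cusp (x - cf_conv x n + h)" "sqrt_cusp (x - cf_conv x n)"]
          unfolding norm_sqrt_cusp .
        also have "\<dots> \<le> sqrt (4 * a) + sqrt (4 * a)"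
        proof (intro add_mono real_sqrt_le_mono)
          have "\<bar>x - cf_conv x n + h\<bar> \<le> d n + a" unfolding d_def a_def by (rule abs_triangle_ineq)
          also have "\<dots> \<le> 2 * a" using n(2) by simp
          finally show "2 * \<bar>x - cf_conv x n + h\<bar> \<le> 4 * a" by simp
          have "\<bar>x - cf_conv x n\<bar> \<le> 2 * a" using n(2) a(1) unfolding d_def by simp
          then show "2 * \<bar>x - cf_conv x n\<bar> \<le> 4 * a" by simp
        qed
        also have "\<dots> = 4 * a powr (1 / 2)" unfolding half by (simp add: real_sqrt_mult)
        finally have "d n powr \<beta> * norm (sqrt_cusp (x - cf_conv x n + h) - sqrt_cusp (x - cf_conv x n))
            \<le> a powr \<beta> * (4 * a powr (1 / 2))"
          using n(2) d_pos [of n] \<beta> by (intro mult_mono powr_mono2) auto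
        then show ?thesis by (simp add: powr_add mult_ac)
      qed
      ultimately show ?thesis using n by (intro exI [of _ n] exI [of _ a]) auto
    next
      case False
      have "1 / q n \<le> sqrt a"
      proof -
        have "1 \<le> (q n * sqrt a)\<^sup>2" using False a by (simp add: power_mult_distrib mult.commute)
        then have "1 \<le> q n * sqrt a" using power2_le_imp_le [of 1 "q n * sqrt a"] a q_ge [of n] by simp
        then show ?thesis using q_ge [of n] by (simp add: field_simps)
      qed
      moreover have "q m * d m \<le> 1 / q n"
      proof -
        have "q m * d m \<le> q m * (1 / (q m * q n))"
          using cf_conv_error [OF x, of m] q_ge [of m] unfolding d_def q_def m(1) by (intro mult_left_mono) auto
        also have "\<dots> = 1 / q n" using q_ge [of m] by simp
        finally show ?thesis .
      qed
      moreover have "d m powr \<beta> * norm (sqrt_cusp (x - cf_conv x m + h) - sqrt_cusp (x - cf_conv x m)) \<le> 4 * a powr (1 / 2 + \<beta>)"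
      proof -
        let ?D = "norm (sqrt_cusp (x - cf_conv x m + h) - sqrt_cusp (x - cf_conv x m))"
        have "?D * sqrt (d m) \<le> 2 * a"
          using sqrt_cusp_diff [of h "x - cf_conv x m"] dm unfolding d_def a_def by simp
        then have D: "?D \<le> 2 * a * d m powr (- (1 / 2))"
          using d_pos [of m] by (simp add: powr_minus powr_half_sqrt field_simps)
        have "d m powr \<beta> * ?D \<le> d m powr \<beta> * (2 * a * d m powr (- (1 / 2)))"
          by (intro mult_left_mono D) auto
        also have "\<dots> = 2 * a * d m powr (\<beta> - 1 / 2)" by (simp add: powr_add [symmetric] mult_ac)
        also have "\<dots> \<le> 2 * a * a powr (\<beta> - 1 / 2)"
          using dm a \<beta> by (intro mult_left_mono powr_mono2') auto
        also have "\<dots> = 2 * (a powr 1 * a powr (\<beta> - 1 / 2))" using a by simp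
        also have "\<dots> = 2 * a powr (1 / 2 + \<beta>)" unfolding powr_add [symmetric] by simp
        also have "\<dots> \<le> 4 * a powr (1 / 2 + \<beta>)" by simp
        finally show ?thesis .
      qed
      ultimately show ?thesis using m(2) dm by (intro exI [of _ m] exI [of _ "d m"]) auto
    qed
    then obtain j M where j: "j \<ge> N'" "a \<le> M" "d j \<le> M" "q j * M \<le> sqrt a"
      "d j powr \<beta> * norm (sqrt_cusp (x - cf_conv x j + h) - sqrt_cusp (x - cf_conv x j)) \<le> 4 * a powr (1 / 2 + \<beta>)"
      by blast
    have "norm (phi (x + h) - phi x) \<le>
       d j powr \<beta> * norm (sqrt_cusp (x - cf_conv x j + h) - sqrt_cusp (x - cf_conv x j))
       + a / 2 + 8 * pi * sqrt (q j * M) ^ 3"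
      unfolding d_def q_def a_def
    proof (rule phi_increment_le [OF x \<beta>(1)])
      show "j \<ge> 2" using j(1) by (simp add: N'_def)
      show "1 / sqrt (of_int (cf_den x j)) \<le> \<bar>x - cf_conv x j\<bar> powr \<beta>" if "j \<in> tau_indices x"
        using N [OF _ that] j(1) by (simp add: N'_def)
    qed (use j in \<open>auto simp: a_def d_def\<close>)
    moreover have "a / 2 \<le> a powr (1 / 2 + \<beta>)"
    proof -
      have "a / 2 \<le> a powr 1" using a by simp
      also have "\<dots> \<le> a powr (1 / 2 + \<beta>)" using a \<beta> by (intro powr_mono') auto
      finally show ?thesis .
    qed
    moreover have "8 * pi * sqrt (q j * M) ^ 3 \<le> 8 * pi * a powr (1 / 2 + \<beta>)"
    proof (rule mult_left_mono)
      have "sqrt (q j * M) \<le> sqrt (sqrt a)" using j(4) by simp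
      also have "\<dots> = a powr (1 / 4)" using a by (simp add: powr_half_sqrt [symmetric] powr_powr)
      finally have "sqrt (q j * M) ^ 3 \<le> (a powr (1 / 4)) ^ 3"
        using q_ge [of j] a j(2) by (intro power_mono) auto
      also have "\<dots> = a powr (3 / 4)" using a by (simp add: powr_power)
      also have "\<dots> \<le> a powr (1 / 2 + \<beta>)" using a \<beta> by (intro powr_mono') auto
      finally show "sqrt (q j * M) ^ 3 \<le> a powr (1 / 2 + \<beta>)" .
    qed simp
    ultimately have "norm (phi (x + h) - phi x) \<le> (4 + 1 + 8 * pi) * a powr (1 / 2 + \<beta>)"
      using j(5) unfolding distrib_right by linarith
    then show ?thesis by (simp add: a_def)
  qed simp
qed

section \<open>The Hoelder exponent\<close>

text \<open>
  Reduces the extended-real arithmetic with the claimed exponent to real arithmetic.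
\<close>

lemma exponent_cases:
  assumes "x \<notin> \<rat>"
  obtains (finite) t where "t \<ge> 2" "tau x = ereal t" "1 / 2 + 1 / (2 * tau x) = ereal (1 / 2 + 1 / (2 * t))"
    | (infinite) "tau x = \<infinity>" "1 / 2 + 1 / (2 * tau x) = ereal (1 / 2)"
proof (cases "tau x")
  case (real t)
  have t: "t \<ge> 2" using tau_ge_2 [OF assms] unfolding real by (metis ereal_less_eq(3) numeral_eq_ereal)
  have "1 / 2 + 1 / (2 * tau x) = ereal (1 / 2 + 1 / (2 * t))"
    unfolding real using t by (simp add: numeral_eq_ereal one_ereal_def)
  then show ?thesis using finite [OF t real] by blast
next
  case PInf
  then show ?thesis using infinite by (simp add: numeral_eq_ereal one_ereal_def)
next
  case MInf
  then show ?thesis using tau_ge_2 [OF assms] by simp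
qed

lemma holder_exponent_ge:
  fixes L :: "complex \<Rightarrow> 'a::real_normed_field"
  assumes x: "x \<notin> \<rat>" and lin: "bounded_linear L" and le: "\<And>z. norm (L z) \<le> norm z"
    and b: "b > 0" "ereal b < 1 / 2 + 1 / (2 * tau x)"
  shows "ereal b \<le> holder_exponent (\<lambda>y. L (phi y)) x"
proof -
  interpret bounded_linear L by (rule lin)
  \<comment> \<open>For \<open>b \<le> 1/2\<close> the trivial bound \<open>q^(-1/2) \<le> 1\<close> on the cusps suffices, which is \<open>\<beta> = 0\<close>.\<close>
  define \<beta> where "\<beta> = max 0 (b - 1 / 2)"
  have b34: "b < 3 / 4" and b_tau: "b > 1 / 2 \<Longrightarrow> tau x < ereal (1 / (2 * b - 1))"
  proof -
    have "b < 3 / 4 \<and> (b > 1 / 2 \<longrightarrow> tau x < ereal (1 / (2 * b - 1)))"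
      using x
    proof (cases rule: exponent_cases)
      case (finite t)
      have t: "t \<ge> 2" by (rule finite(1))
      have "ereal b < ereal (1 / 2 + 1 / (2 * t))" using b(2) unfolding finite(3) .
      then have bt: "b < 1 / 2 + 1 / (2 * t)" by simp
      have "1 / (2 * t) \<le> 1 / 4" using t by simp
      with bt have "b < 3 / 4" by linarith
      have "(2 * b - 1) * t < 1" using bt t by (simp add: field_simps)
      moreover have "t < 1 / (2 * b - 1)" if "b > 1 / 2"
        using that \<open>(2 * b - 1) * t < 1\<close> by (simp add: less_divide_eq mult.commute)
      ultimately show ?thesis using \<open>b < 3 / 4\<close> unfolding finite(2) by simp
    next
      case infinite
      have "ereal b < ereal (1 / 2)" using b(2) unfolding infinite(2) .
      then show ?thesis by simp
    qed
    then show "b < 3 / 4" and "b > 1 / 2 \<Longrightarrow> tau x < ereal (1 / (2 * b - 1))" by auto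
  qed
  have \<beta>: "0 \<le> \<beta>" "\<beta> \<le> 1 / 4" "b \<le> 1 / 2 + \<beta>" using b34 by (simp_all add: \<beta>_def max_def)
  obtain N where N: "\<And>n. n \<ge> N \<Longrightarrow> n \<in> tau_indices x \<Longrightarrow> 1 / sqrt (of_int (cf_den x n)) \<le> \<bar>x - cf_conv x n\<bar> powr \<beta>"
  proof (cases "b > 1 / 2")
    case True
    define c where "c = 1 / (2 * b - 1)"
    have c: "c * \<beta> = 1 / 2" using True by (simp add: c_def \<beta>_def field_simps)
    obtain N where N: "\<And>n. n \<in> tau_indices x \<Longrightarrow> n \<ge> N \<Longrightarrow> cf_tau x n < c"
      using tau_less_imp [OF x b_tau [OF True]] unfolding c_def by blast
    show ?thesis
    proof (rule that [of N])
      fix n assume n: "n \<ge> N" "n \<in> tau_indices x"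
      let ?q = "real_of_int (cf_den x n)"
      have q: "?q \<ge> 2" using n by (simp add: tau_indices_def)
      have "1 / sqrt ?q = ?q powr (- (1 / 2))" using q by (simp add: powr_minus_divide powr_half_sqrt)
      also have "\<dots> = (?q powr (- c)) powr \<beta>" by (simp add: powr_powr c)
      also have "\<dots> \<le> (?q powr (- cf_tau x n)) powr \<beta>"
        using N [OF n(2,1)] q \<beta> by (intro powr_mono2 powr_mono) auto
      finally show "1 / sqrt ?q \<le> \<bar>x - cf_conv x n\<bar> powr \<beta>" unfolding cf_tau_powr [OF x n(2)] .
    qed
  next
    case False
    then have "\<beta> = 0" by (simp add: \<beta>_def)
    show ?thesis
    proof (rule that [of 0])
      fix n assume "n \<in> tau_indices x"
      have "real_of_int (cf_den x n) \<ge> 1" using cf_den_pos [OF x, of n] by simp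
      then show "1 / sqrt (of_int (cf_den x n)) \<le> \<bar>x - cf_conv x n\<bar> powr \<beta>"
        using cf_conv_nonzero [OF x, of n] \<open>\<beta> = 0\<close> by simp
    qed
  qed
  obtain \<eta> where \<eta>: "\<eta> > 0" "\<And>h. \<bar>h\<bar> < \<eta> \<Longrightarrow> norm (phi (x + h) - phi x) \<le> (5 + 8 * pi) * \<bar>h\<bar> powr (1 / 2 + \<beta>)"
    using phi_holder_bound [OF x \<beta>(1,2) N] by blast
  show ?thesis
  proof (rule le_holder_exponent [OF b(1), of "min \<eta> 1"])
    fix h :: real assume h: "\<bar>h\<bar> < min \<eta> 1"
    have "norm (L (phi (x + h)) - L (phi x)) \<le> norm (phi (x + h) - phi x)"
      unfolding diff [symmetric] by (rule le)
    also have "\<dots> \<le> (5 + 8 * pi) * \<bar>h\<bar> powr (1 / 2 + \<beta>)" using h by (intro \<eta>) simp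
    also have "\<dots> \<le> (5 + 8 * pi) * \<bar>h\<bar> powr b"
      using h \<beta> by (intro mult_left_mono powr_mono') auto
    finally show "norm (L (phi (x + h)) - L (phi x)) \<le> (5 + 8 * pi) * \<bar>h\<bar> powr b" .
  qed (use \<eta> in simp)
qed

text \<open>
  If the exponent exceeded \<open>a\<close>, then \<open>d^(1/2) \<le> K' d^a q^(1/2)\<close> would hold along the admissible convergents. For those
  with \<open>\<tau>\<^sub>n > c\<close> one has \<open>q^(-1/2) \<ge> d^(1/(2 c))\<close>, and \<open>d\<close> tends to 0, so this is impossible once
  \<open>1/2 + 1/(2 c) < a\<close>.
\<close>

lemma holder_exponent_le:
  fixes L :: "complex \<Rightarrow> 'a::real_normed_field"
  assumes x: "x \<notin> \<rat>" and lin: "bounded_linear L"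
    and le: "\<And>z. norm (L z) \<le> norm z" and ge: "\<And>z. norm z \<le> norm (L z) + norm (L (\<i> * z))"
    and a: "1 / 2 + 1 / (2 * tau x) < ereal a" "a \<le> 1"
  shows "holder_exponent (\<lambda>y. L (phi y)) x \<le> ereal a"
proof (rule ccontr)
  assume "\<not> ?thesis"
  then have less: "ereal a < holder_exponent (\<lambda>y. L (phi y)) x" by simp
  have "a > 1 / 2 \<and> ereal (1 / (2 * a - 1)) < tau x"
    using x
  proof (cases rule: exponent_cases)
    case (finite t)
    have t: "t \<ge> 2" by (rule finite(1))
    have "ereal (1 / 2 + 1 / (2 * t)) < ereal a" using a(1) unfolding finite(3) .
    then have *: "1 / 2 + 1 / (2 * t) < a" by simp
    moreover have "1 / (2 * t) > 0" using t by simp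
    ultimately have "a > 1 / 2" by linarith
    moreover have "1 / (2 * a - 1) < t" using * t \<open>a > 1 / 2\<close> by (simp add: field_simps)
    ultimately show ?thesis unfolding finite(2) by simp
  next
    case infinite
    have "ereal (1 / 2) < ereal a" using a(1) unfolding infinite(2) .
    then show ?thesis unfolding infinite(1) by simp
  qed
  then have a12: "a > 1 / 2" and a_tau: "ereal (1 / (2 * a - 1)) < tau x" by auto
  obtain c where c: "1 / (2 * a - 1) < c" "ereal c < tau x"
    using ereal_dense2 [OF a_tau] by auto
  have c0: "c > 0"
  proof -
    have "0 < 1 / (2 * a - 1)" using a12 by simp
    then show ?thesis using c(1) by linarith
  qed
  define e where "e = a - 1 / 2 - 1 / (2 * c)"
  have e: "e > 0" using c(1) c0 a12 by (simp add: e_def field_simps)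
  have "isCont phi x" using phi_continuous by (simp add: continuous_on_eq_continuous_at)
  then have cont: "isCont (\<lambda>y. L (phi y)) x" by (rule bounded_linear.isCont [OF lin])
  have a0: "a > 0" using a12 by simp
  obtain K \<eta> where \<eta>: "\<eta> > 0" and K: "\<And>h. \<bar>h\<bar> < \<eta> \<Longrightarrow> norm (L (phi (x + h)) - L (phi x)) \<le> K * \<bar>h\<bar> powr a"
    using less_holder_exponent_imp [OF cont a0 a(2) less] by blast
  obtain K' N where K': "K' > 0" and N: "\<And>n. n \<ge> N \<Longrightarrow> n \<in> tau_indices x \<Longrightarrow>
      sqrt \<bar>x - cf_conv x n\<bar> \<le> K' * \<bar>x - cf_conv x n\<bar> powr a * sqrt (of_int (cf_den x n))"
    using holder_bound_at_convergents [OF x lin le ge a0 a(2) \<eta> K] by blast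
  have "((\<lambda>n. \<bar>x - cf_conv x n\<bar> powr e) \<longlonglongrightarrow> 0 powr e)"
    using e by (intro tendsto_powr' cf_conv_tendsto x) auto
  then have "\<forall>\<^sub>F n in sequentially. \<bar>x - cf_conv x n\<bar> powr e < 1 / K'"
    by (rule order_tendstoD) (use e K' in simp)
  then obtain N' where N': "\<And>n. n \<ge> N' \<Longrightarrow> \<bar>x - cf_conv x n\<bar> powr e < 1 / K'"
    by (auto simp: eventually_sequentially)
  obtain n where n: "n \<ge> max N N'" "n \<in> tau_indices x" "cf_tau x n > c"
    using less_tau_imp [OF x c(2)] by blast
  define d where "d = \<bar>x - cf_conv x n\<bar>"
  define q where "q = real_of_int (cf_den x n)"
  have d: "d > 0" using cf_conv_nonzero [OF x, of n] by (simp add: d_def)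
  have q: "q \<ge> 2" using n(2) by (simp add: q_def tau_indices_def)
  have "d = q powr (- cf_tau x n)" unfolding d_def q_def by (rule cf_tau_powr [OF x n(2)])
  also have "\<dots> \<le> q powr (- c)" using n(3) q by (intro powr_mono) auto
  finally have "d powr (1 / (2 * c)) \<le> (q powr (- c)) powr (1 / (2 * c))"
    using d c0 by (intro powr_mono2) auto
  also have "\<dots> = q powr (- (1 / 2))" using c0 by (simp add: powr_powr)
  finally have dq: "d powr (1 / (2 * c)) * sqrt q \<le> 1"
    using q by (simp add: powr_minus powr_half_sqrt field_simps)
  have "d powr (1 / 2) \<le> K' * d powr a * sqrt q"
    using N [OF _ n(2)] n(1) d unfolding d_def q_def by (simp add: powr_half_sqrt)
  also have "d powr a = d powr (1 / 2) * d powr e * d powr (1 / (2 * c))"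
    unfolding powr_add [symmetric] by (simp add: e_def)
  also have "K' * (d powr (1 / 2) * d powr e * d powr (1 / (2 * c))) * sqrt q
      = d powr (1 / 2) * (K' * d powr e) * (d powr (1 / (2 * c)) * sqrt q)" by (simp add: mult_ac)
  also have "\<dots> \<le> d powr (1 / 2) * (K' * d powr e) * 1"
    using dq K' by (intro mult_left_mono) auto
  finally have "1 \<le> K' * d powr e" using d by simp
  moreover have "d powr e < 1 / K'" using N' n(1) unfolding d_def by simp
  then have "K' * d powr e < 1" using K' by (simp add: field_simps)
  ultimately show False by simp
qed

lemma holder_exponent_phi_projection:
  fixes L :: "complex \<Rightarrow> 'a::real_normed_field"
  assumes x: "x \<notin> \<rat>" and lin: "bounded_linear L"
    and le: "\<And>z. norm (L z) \<le> norm z" and ge: "\<And>z. norm z \<le> norm (L z) + norm (L (\<i> * z))"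
  shows "holder_exponent (\<lambda>y. L (phi y)) x = 1 / 2 + 1 / (2 * tau x)"
proof (rule antisym)
  have "1 / 2 + 1 / (2 * tau x) \<le> ereal (3 / 4) \<and> ereal (1 / 2) \<le> 1 / 2 + 1 / (2 * tau x)"
    using x
  proof (cases rule: exponent_cases)
    case (finite t)
    have "1 / (2 * t) \<le> 1 / 4" "1 / (2 * t) \<ge> 0" using finite(1) by auto
    then show ?thesis unfolding finite(3) by simp
  next
    case infinite
    then show ?thesis by simp
  qed
  then have upper: "1 / 2 + 1 / (2 * tau x) \<le> ereal (3 / 4)" and lower: "ereal (1 / 2) \<le> 1 / 2 + 1 / (2 * tau x)"
    by auto
  show "holder_exponent (\<lambda>y. L (phi y)) x \<le> 1 / 2 + 1 / (2 * tau x)"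
  proof (rule dense_ge)
    fix z assume z: "1 / 2 + 1 / (2 * tau x) < z"
    have "1 / 2 + 1 / (2 * tau x) < min z 1"
      using z order.strict_trans1 [OF upper, of 1] by (simp add: one_ereal_def)
    then obtain a where a: "1 / 2 + 1 / (2 * tau x) < ereal a" "ereal a < min z 1"
      using ereal_dense2 by blast
    then have "holder_exponent (\<lambda>y. L (phi y)) x \<le> ereal a"
      by (intro holder_exponent_le [OF x lin le ge]) (auto simp: one_ereal_def)
    also have "\<dots> \<le> z" using a(2) less_imp_le [of "ereal a" z] by simp
    finally show "holder_exponent (\<lambda>y. L (phi y)) x \<le> z" .
  qed
  show "1 / 2 + 1 / (2 * tau x) \<le> holder_exponent (\<lambda>y. L (phi y)) x"
  proof (rule dense_le)
    fix z assume z: "z < 1 / 2 + 1 / (2 * tau x)"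
    have "max z (ereal (1 / 4)) < 1 / 2 + 1 / (2 * tau x)"
      using z order.strict_trans2 [OF _ lower, of "ereal (1 / 4)"] by simp
    then obtain b where b: "max z (ereal (1 / 4)) < ereal b" "ereal b < 1 / 2 + 1 / (2 * tau x)"
      using ereal_dense2 by blast
    have "z \<le> ereal b" using b(1) less_imp_le [of z "ereal b"] by simp
    also have "\<dots> \<le> holder_exponent (\<lambda>y. L (phi y)) x"
      using b by (intro holder_exponent_ge [OF x lin le]) auto
    finally show "z \<le> holder_exponent (\<lambda>y. L (phi y)) x" .
  qed
qed

theorem theorem4p1:
  fixes \<rho> :: real
  assumes "\<rho> \<notin> \<rat>"
  shows "holder_exponent phi \<rho> = 1 / 2 + 1 / (2 * tau \<rho>) \<and>
         holder_exponent (\<lambda>x. Re (phi x)) \<rho> = 1 / 2 + 1 / (2 * tau \<rho>) \<and>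
         holder_exponent (\<lambda>x. Im (phi x)) \<rho> = 1 / 2 + 1 / (2 * tau \<rho>)"
proof (intro conjI)
  show "holder_exponent phi \<rho> = 1 / 2 + 1 / (2 * tau \<rho>)"
    using holder_exponent_phi_projection [OF assms bounded_linear_ident] by simp
  show "holder_exponent (\<lambda>x. Re (phi x)) \<rho> = 1 / 2 + 1 / (2 * tau \<rho>)"
    by (rule holder_exponent_phi_projection [OF assms bounded_linear_Re])
       (use abs_Re_le_cmod cmod_le in auto)
  show "holder_exponent (\<lambda>x. Im (phi x)) \<rho> = 1 / 2 + 1 / (2 * tau \<rho>)"
  proof (rule holder_exponent_phi_projection [OF assms bounded_linear_Im])
    show "norm z \<le> norm (Im z) + norm (Im (\<i> * z))" for z
      using cmod_le [of z] by simp
  qed (use abs_Im_le_cmod in auto)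
qed

end
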